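(* Let $n\ge3$ and $p\in(1,\infty)$. Suppose the coefficients $a_{ij}=a_{ji}$ of $\mathcal L(x,\partial_x)u=a_{ij}(x)\,\partial_i\partial_ju$ are bounded, measurable functions satisfying $\sup_{|x|=r}\|{\bf A}_x-{\bf I}\|\le\omega(r)$ for $0<r<1$, where ${\bf A}_x=(a_{ij}(x))$, ${\bf I}$ is the identity matrix, and $\omega$ is a continuous, nondecreasing function on $[0,1)$ with $\omega(0)=0$, $\int_0^1\omega^2(t)\,t^{-1}dt<\infty$, and $\omega(r)r^{-1+\kappa}$ nonincreasing for $0<r<1$ for some $\kappa\in(0,1)$. Let $$I(r)=\frac1{|S^{n-1}|}\int_{r<|z|<\varepsilon}\left(\mathrm{tr}({\bf A}_z)-n\,\frac{\langle {\bf A}_z z,z\rangle}{|z|^2}\right)\frac{dz}{|z|^n}.$$ For $\varepsilon>0$ sufficiently small, let $Z$ be a solution of $\mathcal L(x,\partial_x)Z=0$ in $B_\varepsilon\setminus\{0\}$ of the form $Z(x)=h(|x|)+v(x)$, where $h(r)=\int_r^\varepsilon s^{1-n}e^{I(s)}\,ds\,(1+\zeta(r))$ with $M_{2,p}(\zeta,r)\le c\,\max(\omega(r),\sigma(r))$ and $M_{2,p}(v,r)\le c\,r^{2-n}e^{I(r)}\omega(r)$. With $U=B_\varepsilon$, consider for $\phi\in C_0^1(U)$ the improper integral $$\langle\mathcal LZ,\phi\rangle=\int_U\left[(a_{ij}(x)-\delta_{ij})\,\partial_i\partial_jZ(x)\,\phi(x)-\partial_iZ(x)\,\partial_i\phi(x)\right]dx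 .$$ (i) If $I(0)=\lim_{r\to0}I(r)$ exists and is finite, then this integral converges and $-\mathcal L(x,\partial_x)Z=C_0\,\delta(x)$ in $U$, i.e. $-\langle\mathcal LZ,\phi\rangle=C_0\,\phi(0)$ for all $\phi\in C_0^1(U)$, with $C_0=|S^{n-1}|\,e^{I(0)}$. (ii) If $I(r)\to-\infty$ as $r\to0$, then this integral converges and $-\mathcal L(x,\partial_x)Z=C_0\,\delta(x)$ in $U$ in the same sense, with $C_0=0$.
   Context: Summation over repeated indices is understood; coefficients are real-valued; $|S^{n-1}|$ is the surface measure of the unit sphere in $\mathbb R^n$; $B_\varepsilon=\{x\in\mathbb R^n:|x|<\varepsilon\}$; $C_0^1(U)$ is the space of $C^1$ functions with compact support in $U$. Solutions are strong solutions ($Z\in W^{2,p}_{\mathrm{loc}}(B_\varepsilon\setminus\{0\})$, equation satisfied a.e.). The improper integral means $\lim_{\eta\to0}\int_{\eta<|x|<\varepsilon}$. Also $\sigma(r)=\int_0^r\omega^2(t)\,t^{-1}dt$. For a function $w$, $M_p(w,r)=\left(|A_r|^{-1}\int_{A_r}|w|^p\,dx\right)^{1/p}$ with $A_r=\{x:r<|x|<2r\}$, and $M_{2,p}(w,r)=r^2M_p(D^2w,r)+rM_p(Dw,r)+M_p(w,r)$, where $Dw$, $D^2w$ are the gradient and Hessian. For a function $\zeta$ of $r>0$, $M_{2,p}(\zeta,r)$ is that of $x\mapsto\zeta(|x|)$. The letter $c$ denotes constants independent of $r$; the estimates are for all sufficiently small $r>0$. (For $\varepsilon$ sufficiently small such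 a solution $Z$ is known to exist.) *)

theory Defs
  imports "HOL-Analysis.Analysis"
begin

definition annulus :: "real \<Rightarrow> real \<Rightarrow> (real^'n) set" where
  "annulus r s = {x. r < norm x \<and> norm x < s}"

text \<open>Surface measure of a subset of the unit sphere, defined in the usual way from Lebesgue
  measure by the cone construction (as in polar coordinates).\<close>

definition surface_measure :: "(real^'n) set \<Rightarrow> real" where
  "surface_measure E =
     real CARD('n) * measure lebesgue {t *\<^sub>R x | t x. 0 < t \<and> t \<le> 1 \<and> x \<in> E}"

subsection \<open>Test functions and weak derivatives\<close>

definition partial_deriv :: "'n \<Rightarrow> (real^'n \<Rightarrow> real) \<Rightarrow> real^'n \<Rightarrow> real" where
  "partial_deriv i f x = frechet_derivative f (at x) (axis i 1)"

text \<open>The space \<open>C\<^sub>0\<^sup>1(U)\<close>; its elements are regarded as functions on the whole space,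
  extended by zero.\<close>

definition C1_compact :: "(real^'n) set \<Rightarrow> (real^'n \<Rightarrow> real) \<Rightarrow> bool" where
  "C1_compact U \<phi> \<longleftrightarrow>
     (\<forall>x. \<phi> differentiable (at x)) \<and>
     (\<forall>i. continuous_on UNIV (partial_deriv i \<phi>)) \<and>
     compact (closure {x. \<phi> x \<noteq> 0}) \<and> closure {x. \<phi> x \<noteq> 0} \<subseteq> U"

definition loc_integrable :: "(real^'n) set \<Rightarrow> (real^'n \<Rightarrow> real) \<Rightarrow> bool" where
  "loc_integrable \<Omega> f \<longleftrightarrow> (\<forall>K. compact K \<and> K \<subseteq> \<Omega> \<longrightarrow> f absolutely_integrable_on K)"

text \<open>First-order weak derivatives are tested against \<open>C\<^sub>0\<^sup>1\<close>, the convention of Gilbarg and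
  Trudinger (a weak derivative of order \<open>k\<close> is tested against \<open>C\<^sub>0\<^sup>k\<close>).  Second-order ones are
  iterated first-order ones.\<close>

definition has_weak_pderiv ::
    "(real^'n) set \<Rightarrow> 'n \<Rightarrow> (real^'n \<Rightarrow> real) \<Rightarrow> (real^'n \<Rightarrow> real) \<Rightarrow> bool" where
  "has_weak_pderiv \<Omega> i f g \<longleftrightarrow>
     loc_integrable \<Omega> f \<and> loc_integrable \<Omega> g \<and>
     (\<forall>\<phi>. C1_compact \<Omega> \<phi> \<longrightarrow>
        (LINT x:\<Omega>|lebesgue. f x * partial_deriv i \<phi> x) = - (LINT x:\<Omega>|lebesgue. g x * \<phi> x))"

text \<open>Weak derivatives are unique only up to null sets; the following choose a version, and
  are meaningful only where the derivatives exist.\<close>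

definition weak_pderiv ::
    "(real^'n) set \<Rightarrow> 'n \<Rightarrow> (real^'n \<Rightarrow> real) \<Rightarrow> real^'n \<Rightarrow> real" where
  "weak_pderiv \<Omega> i f = (SOME g. has_weak_pderiv \<Omega> i f g)"

definition weak_grad :: "(real^'n) set \<Rightarrow> (real^'n \<Rightarrow> real) \<Rightarrow> real^'n \<Rightarrow> real^'n" where
  "weak_grad \<Omega> f x = (\<chi> i. weak_pderiv \<Omega> i f x)"

definition weak_hess :: "(real^'n) set \<Rightarrow> (real^'n \<Rightarrow> real) \<Rightarrow> real^'n \<Rightarrow> real^'n^'n" where
  "weak_hess \<Omega> f x = (\<chi> i j. weak_pderiv \<Omega> i (weak_pderiv \<Omega> j f) x)"

definition twice_weakly_diff :: "(real^'n) set \<Rightarrow> (real^'n \<Rightarrow> real) \<Rightarrow> bool" where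
  "twice_weakly_diff \<Omega> f \<longleftrightarrow>
     (\<forall>j. (\<exists>g. has_weak_pderiv \<Omega> j f g) \<and>
          (\<forall>i. \<exists>g. has_weak_pderiv \<Omega> i (weak_pderiv \<Omega> j f) g))"

definition Lp_on :: "real \<Rightarrow> (real^'n) set \<Rightarrow> (real^'n \<Rightarrow> 'b::euclidean_space) \<Rightarrow> bool" where
  "Lp_on p S f \<longleftrightarrow>
     f \<in> borel_measurable (lebesgue_on S) \<and>
     (\<lambda>x. norm (f x) powr p) absolutely_integrable_on S"

definition W2p :: "real \<Rightarrow> (real^'n) set \<Rightarrow> (real^'n \<Rightarrow> real) \<Rightarrow> bool" where
  "W2p p \<Omega> f \<longleftrightarrow>
     twice_weakly_diff \<Omega> f \<and>
     Lp_on p \<Omega> f \<and> Lp_on p \<Omega> (weak_grad \<Omega> f) \<and> Lp_on p \<Omega> (weak_hess \<Omega> f)"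

definition W2p_loc :: "real \<Rightarrow> (real^'n) set \<Rightarrow> (real^'n \<Rightarrow> real) \<Rightarrow> bool" where
  "W2p_loc p \<Omega> f \<longleftrightarrow>
     twice_weakly_diff \<Omega> f \<and>
     (\<forall>K. compact K \<and> K \<subseteq> \<Omega> \<longrightarrow>
        Lp_on p K f \<and> Lp_on p K (weak_grad \<Omega> f) \<and> Lp_on p K (weak_hess \<Omega> f))"

subsection \<open>Annular means\<close>

definition M_p :: "real \<Rightarrow> (real^'n \<Rightarrow> 'b::euclidean_space) \<Rightarrow> real \<Rightarrow> real" where
  "M_p p w r =
     ((LINT x:annulus r (2*r)|lebesgue. norm (w x) powr p)
        / measure lebesgue (annulus r (2*r) :: (real^'n) set)) powr (1 / p)"

definition M_2p :: "real \<Rightarrow> (real^'n \<Rightarrow> real) \<Rightarrow> real \<Rightarrow> real" where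
  "M_2p p w r =
     r\<^sup>2 * M_p p (weak_hess (annulus r (2*r)) w) r
     + r * M_p p (weak_grad (annulus r (2*r)) w) r
     + M_p p w r"

text \<open>The estimate \<open>M\<^bsub>2,p\<^esub>(w,r) \<le> c b(r)\<close> for all sufficiently small \<open>r > 0\<close>.  Finiteness of
  the left-hand side, i.e. \<open>w \<in> W\<^bsup>2,p\<^esup>\<close> on the annulus, is part of the assertion; it has to be
  spelled out because the library integral of a non-integrable function is 0.\<close>

definition M_2p_bound :: "real \<Rightarrow> (real^'n \<Rightarrow> real) \<Rightarrow> (real \<Rightarrow> real) \<Rightarrow> bool" where
  "M_2p_bound p w b \<longleftrightarrow>
     (\<exists>c. \<forall>\<^sub>F r in at_right 0. W2p p (annulus r (2*r)) w \<and> M_2p p w r \<le> c * b r)"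

subsection \<open>The operator and the distinguished solution\<close>

definition strong_solution ::
    "real \<Rightarrow> (real^'n \<Rightarrow> real^'n^'n) \<Rightarrow> (real^'n) set \<Rightarrow> (real^'n \<Rightarrow> real) \<Rightarrow> bool" where
  "strong_solution p A \<Omega> Z \<longleftrightarrow>
     W2p_loc p \<Omega> Z \<and>
     (AE x in lebesgue. x \<in> \<Omega> \<longrightarrow>
        (\<Sum>i\<in>UNIV. \<Sum>j\<in>UNIV. A x $ i $ j * weak_hess \<Omega> Z x $ i $ j) = 0)"

definition sigma_of :: "(real \<Rightarrow> real) \<Rightarrow> real \<Rightarrow> real" where
  "sigma_of \<omega> r = (LINT t:{0<..<r}|lborel. (\<omega> t)\<^sup>2 / t)"

definition I_of :: "(real^'n \<Rightarrow> real^'n^'n) \<Rightarrow> real \<Rightarrow> real \<Rightarrow> real" where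
  "I_of A \<epsilon> r =
     1 / surface_measure (sphere (0::real^'n) 1) *
     (LINT z:annulus r \<epsilon>|lebesgue.
        (trace (A z) - real CARD('n) * (((A z *v z) \<bullet> z) / (norm z)\<^sup>2)) / norm z ^ CARD('n))"

definition h_of :: "(real^'n \<Rightarrow> real^'n^'n) \<Rightarrow> real \<Rightarrow> (real \<Rightarrow> real) \<Rightarrow> real \<Rightarrow> real" where
  "h_of A \<epsilon> \<zeta> r =
     (LINT s:{r..\<epsilon>}|lborel. s powr (1 - real CARD('n)) * exp (I_of A \<epsilon> s)) * (1 + \<zeta> r)"

subsection \<open>The improper pairing\<close>

definition pairing_integrand ::
    "(real^'n \<Rightarrow> real^'n^'n) \<Rightarrow> real \<Rightarrow> (real^'n \<Rightarrow> real) \<Rightarrow> (real^'n \<Rightarrow> real) \<Rightarrow> real^'n \<Rightarrow> real" where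
  "pairing_integrand A \<epsilon> Z \<phi> x =
     (\<Sum>i\<in>UNIV. \<Sum>j\<in>UNIV.
        (A x $ i $ j - mat 1 $ i $ j) * weak_hess (ball 0 \<epsilon> - {0}) Z x $ i $ j * \<phi> x)
     - (\<Sum>i\<in>UNIV. weak_grad (ball 0 \<epsilon> - {0}) Z x $ i * partial_deriv i \<phi> x)"

definition pairing_upto ::
    "(real^'n \<Rightarrow> real^'n^'n) \<Rightarrow> real \<Rightarrow> (real^'n \<Rightarrow> real) \<Rightarrow> (real^'n \<Rightarrow> real) \<Rightarrow> real \<Rightarrow> real" where
  "pairing_upto A \<epsilon> Z \<phi> \<eta> = (LINT x:annulus \<eta> \<epsilon>|lebesgue. pairing_integrand A \<epsilon> Z \<phi> x)"

definition pairing_converges ::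
    "(real^'n \<Rightarrow> real^'n^'n) \<Rightarrow> real \<Rightarrow> (real^'n \<Rightarrow> real) \<Rightarrow> (real^'n \<Rightarrow> real) \<Rightarrow> bool" where
  "pairing_converges A \<epsilon> Z \<phi> \<longleftrightarrow>
     (\<forall>\<eta>. 0 < \<eta> \<and> \<eta> < \<epsilon> \<longrightarrow> pairing_integrand A \<epsilon> Z \<phi> absolutely_integrable_on annulus \<eta> \<epsilon>) \<and>
     (\<exists>l. (pairing_upto A \<epsilon> Z \<phi> \<longlongrightarrow> l) (at_right 0))"

definition pairing ::
    "(real^'n \<Rightarrow> real^'n^'n) \<Rightarrow> real \<Rightarrow> (real^'n \<Rightarrow> real) \<Rightarrow> (real^'n \<Rightarrow> real) \<Rightarrow> real" where
  "pairing A \<epsilon> Z \<phi> = Lim (at_right 0) (pairing_upto A \<epsilon> Z \<phi>)"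

text \<open>\<open>-L(x,\<partial>\<^sub>x)Z = C \<delta>\<close> in the ball of radius \<open>\<epsilon>\<close>, the pairing integral being convergent.\<close>

definition minus_LZ_eq_delta ::
    "(real^'n \<Rightarrow> real^'n^'n) \<Rightarrow> real \<Rightarrow> (real^'n \<Rightarrow> real) \<Rightarrow> real \<Rightarrow> bool" where
  "minus_LZ_eq_delta A \<epsilon> Z C \<longleftrightarrow>
     (\<forall>\<phi>. C1_compact (ball 0 \<epsilon>) \<phi> \<longrightarrow>
        pairing_converges A \<epsilon> Z \<phi> \<and> - pairing A \<epsilon> Z \<phi> = C * \<phi> 0)"

end

theory Submission
  imports Defs
begin


text \<open>Away from the origin the equation turns \<open>(a\<^sub>i\<^sub>j - \<delta>\<^sub>i\<^sub>j) \<partial>\<^sub>i\<partial>\<^sub>jZ\<close> into \<open>-\<Delta>Z\<close>, so the integrand of the pairing is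
  minus the divergence of \<open>\<phi> \<nabla>Z\<close>, and its integral over \<open>|x| > r\<close> is the flux of \<open>\<phi> \<nabla>Z\<close> through the
  sphere \<open>|x| = r\<close>.  The leading part of \<open>\<nabla>Z\<close> is \<open>exp (I |x|) K(x)\<close> with \<open>K(x) = -x |x|\<^sup>-\<^sup>n\<close>, and the flux of
  \<open>K\<close> through every sphere is minus the area of the unit sphere.  Hence the pairing equals minus that area
  times \<open>\<phi>(0)\<close> times the limit of \<open>exp I\<close>, which is \<open>exp (I 0)\<close> in one case and \<open>0\<close> in the other.

  The difficulty is the rest of \<open>\<nabla>Z\<close>.  It is controlled only through annular means of weak derivatives, so
  its flux through a single sphere has no direct meaning.  The sphere is replaced by radial cut-offs whose
  transition layer lies inside \<open>r < |x| < 2r\<close> and shrinks towards \<open>|x| = r\<close> (\<open>pairing_upto_flux\<close>).  For the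
  widest layer the flux is an average over the annulus, and the annular means suffice
  (\<open>flux_through_layer\<close>).  Two cut-offs differ by a function with compact support in the annulus, so the two
  fluxes differ by an expression that an \<open>L\<^sup>1\<close> bound for the weak divergence of \<open>\<nabla>Z\<close> controls, whatever the
  width of the layer.

  That bound is \<open>weak_divergence_small\<close>.  Every term that contains \<open>\<zeta>\<close>, \<open>v\<close> or their derivatives is small by
  hypothesis.  What remains is the divergence of \<open>exp (I |x|) K\<close>.  The field \<open>K\<close> is divergence free, and
  \<open>exp (I r)\<close> is locally Lipschitz with a constant of order \<open>\<omega>(3r) / r\<close> (\<open>I_Lipschitz\<close>), since only the deviation of the
  coefficients from the identity enters \<open>I\<close>; the lemma \<open>weak_divergence_radial_Lipschitz\<close> turns this into
  an estimate in the weak sense.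

  The cut-offs are twice continuously differentiable.  Their gradients are then test fields themselves, and
  the weak gradient of \<open>Z\<close> in the punctured ball may be exchanged, inside a flux, for the one computed from
  the representation of \<open>Z\<close> on the annulus.\<close>

section \<open>Continuously differentiable functions and test functions\<close>

definition C1_grad :: "(real^'n) set \<Rightarrow> (real^'n \<Rightarrow> real) \<Rightarrow> (real^'n \<Rightarrow> real^'n) \<Rightarrow> bool" where
  "C1_grad V u U \<longleftrightarrow> (\<forall>x\<in>V. GDERIV u x :> U x) \<and> continuous_on V U"

lemma GDERIV_imp_continuous:
  fixes u :: "real^'n \<Rightarrow> real"
  assumes "GDERIV u x :> D"
  shows "isCont u x"
  using assms unfolding gderiv_def by (rule has_derivative_continuous)

lemma GDERIV_imp_partial_deriv:
  fixes u :: "real^'n \<Rightarrow> real"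
  assumes "GDERIV u x :> D"
  shows "partial_deriv i u x = D $ i"
proof -
  have "(u has_derivative (\<lambda>h. h \<bullet> D)) (at x)"
    using assms by (simp add: gderiv_def)
  then have "frechet_derivative u (at x) = (\<lambda>h. h \<bullet> D)"
    by (metis frechet_derivative_at)
  then show ?thesis
    by (simp add: partial_deriv_def inner_axis inner_commute)
qed

lemma GDERIV_transform_open:
  fixes u w :: "real^'n \<Rightarrow> real"
  assumes "GDERIV u x :> D" "open V" "x \<in> V" "\<And>y. y \<in> V \<Longrightarrow> u y = w y"
  shows "GDERIV w x :> D"
  using assms unfolding gderiv_def by (metis has_derivative_transform_within_open)

lemma C1_grad_continuous_on: "C1_grad V u U \<Longrightarrow> continuous_on V u"
  unfolding C1_grad_def by (meson GDERIV_imp_continuous continuous_at_imp_continuous_on)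

lemma C1_grad_partial_deriv: "C1_grad V u U \<Longrightarrow> x \<in> V \<Longrightarrow> partial_deriv i u x = U x $ i"
  unfolding C1_grad_def by (meson GDERIV_imp_partial_deriv)

lemma C1_grad_subset: "C1_grad V u U \<Longrightarrow> W \<subseteq> V \<Longrightarrow> C1_grad W u U"
  unfolding C1_grad_def by (auto elim: continuous_on_subset)

lemma C1_grad_cong:
  assumes "C1_grad V u U" "open V" "\<And>x. x \<in> V \<Longrightarrow> u x = w x" "\<And>x. x \<in> V \<Longrightarrow> U x = W x"
  shows "C1_grad V w W"
proof -
  have "GDERIV w x :> W x" if "x \<in> V" for x
  proof (rule GDERIV_transform_open[of u x "W x" V])
    show "GDERIV u x :> W x"
      using assms(1,4) that by (simp add: C1_grad_def)
  qed (use assms that in auto)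
  moreover have "continuous_on V W"
    using assms(1) continuous_on_eq[of V U W] assms(4) by (auto simp: C1_grad_def)
  ultimately show ?thesis
    by (simp add: C1_grad_def)
qed

lemma C1_grad_Un:
  assumes "C1_grad V u U" "C1_grad W u U" "open V" "open W"
  shows "C1_grad (V \<union> W) u U"
  using assms unfolding C1_grad_def by (auto intro: continuous_on_open_Un)

lemma C1_grad_const: "C1_grad V (\<lambda>_. c) (\<lambda>_. 0)"
  by (simp add: C1_grad_def GDERIV_const)

lemma C1_grad_diff:
  assumes "C1_grad V u U" "C1_grad V w W"
  shows "C1_grad V (\<lambda>x. u x - w x) (\<lambda>x. U x - W x)"
  using assms unfolding C1_grad_def by (auto intro!: GDERIV_diff continuous_intros)

lemma C1_grad_mult:
  assumes "C1_grad V u U" "C1_grad V w W"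
  shows "C1_grad V (\<lambda>x. u x * w x) (\<lambda>x. u x *\<^sub>R W x + w x *\<^sub>R U x)"
  using assms C1_grad_continuous_on[OF assms(1)] C1_grad_continuous_on[OF assms(2)]
  unfolding C1_grad_def by (auto intro!: GDERIV_mult continuous_intros)

lemma C1_grad_component: "C1_grad V (\<lambda>x. x $ i) (\<lambda>_. axis i 1)"
  unfolding C1_grad_def gderiv_def
  by (auto simp: inner_axis intro!: derivative_eq_intros bounded_linear.has_derivative[OF bounded_linear_vec_nth])

lemma C1_grad_radial:
  fixes V :: "(real^'n) set"
  assumes "\<And>x. x \<in> V \<Longrightarrow> (f has_real_derivative f' (norm x)) (at (norm x))"
    and "continuous_on (norm ` V) f'" and "0 \<notin> V"
  shows "C1_grad V (\<lambda>x. f (norm x)) (\<lambda>x. f' (norm x) *\<^sub>R sgn x)"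
proof -
  have "GDERIV (\<lambda>x. f (norm x)) x :> f' (norm x) *\<^sub>R sgn x" if "x \<in> V" for x :: "real^'n"
    using assms that by (intro GDERIV_DERIV_compose GDERIV_norm) auto
  moreover have "continuous_on V (\<lambda>x. f' (norm x))"
    by (rule continuous_on_compose2[OF assms(2)]) (auto intro!: continuous_intros)
  moreover have "continuous_on V (sgn :: real^'n \<Rightarrow> real^'n)"
    using assms(3) by (auto simp: sgn_div_norm intro!: continuous_intros)
  ultimately show ?thesis
    by (auto simp: C1_grad_def intro!: continuous_intros)
qed

lemma C1_compact_imp_C1_grad:
  assumes "C1_compact \<Omega> \<phi>"
  shows "C1_grad UNIV \<phi> (\<lambda>x. \<chi> i. partial_deriv i \<phi> x)"
proof -
  have "GDERIV \<phi> x :> (\<chi> i. partial_deriv i \<phi> x)" for x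
  proof -
    define L where "L = frechet_derivative \<phi> (at x)"
    have L: "(\<phi> has_derivative L) (at x)"
      using assms frechet_derivative_works unfolding C1_compact_def L_def by blast
    then have "linear L"
      using has_derivative_linear by blast
    have "L h = h \<bullet> (\<chi> i. partial_deriv i \<phi> x)" for h
    proof -
      have "L h = L (\<Sum>i\<in>UNIV. h $ i *\<^sub>R axis i 1)"
        by (metis basis_expansion scalar_mult_eq_scaleR)
      also have "\<dots> = (\<Sum>i\<in>UNIV. h $ i * L (axis i 1))"
        using \<open>linear L\<close> by (simp add: linear_sum linear_scale)
      finally show ?thesis
        by (simp add: inner_vec_def partial_deriv_def L_def)
    qed
    then show ?thesis
      using L by (simp add: gderiv_def) (metis (no_types, lifting) ext)
  qed
  moreover have "continuous_on UNIV (\<lambda>x. \<chi> i. partial_deriv i \<phi> x)"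
    using assms unfolding C1_compact_def by (intro continuous_on_vec_lambda) auto
  ultimately show ?thesis
    by (simp add: C1_grad_def)
qed

lemma C1_compactI:
  assumes "C1_grad UNIV \<phi> G" "compact K" "K \<subseteq> \<Omega>" "\<And>x. x \<notin> K \<Longrightarrow> \<phi> x = 0"
  shows "C1_compact \<Omega> \<phi>"
proof -
  have sub: "closure {x. \<phi> x \<noteq> 0} \<subseteq> K"
    using assms by (intro closure_minimal) (auto simp: compact_imp_closed)
  then have "compact (closure {x. \<phi> x \<noteq> 0})"
    using assms(2) by (meson closed_closure compact_Int_closed compact_closure bounded_subset
        compact_imp_bounded closure_subset order_trans)
  moreover have "partial_deriv i \<phi> = (\<lambda>x. G x $ i)" for i
    using C1_grad_partial_deriv[OF assms(1)] by auto
  moreover have "continuous_on UNIV (\<lambda>x. G x $ i)" for i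
    using assms(1) by (auto simp: C1_grad_def intro!: continuous_intros)
  moreover have "\<phi> differentiable (at x)" for x
    using assms(1) by (auto simp: C1_grad_def gderiv_def differentiable_def)
  ultimately show ?thesis
    using sub assms(3) unfolding C1_compact_def by auto
qed

lemma C1_compactE:
  assumes "C1_compact \<Omega> \<phi>"
  obtains K G P where "compact K" "K \<subseteq> \<Omega>" "C1_grad UNIV \<phi> G"
    "\<And>i x. partial_deriv i \<phi> x = G x $ i"
    "\<And>x. x \<notin> K \<Longrightarrow> \<phi> x = 0" "\<And>x. x \<notin> K \<Longrightarrow> G x = 0"
    "0 < P" "\<And>x. \<bar>\<phi> x\<bar> \<le> P" "\<And>x. norm (G x) \<le> P"
proof -
  define K where "K = closure {x. \<phi> x \<noteq> 0}"
  define G where "G = (\<lambda>x. \<chi> i. partial_deriv i \<phi> x)"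
  have C: "C1_grad UNIV \<phi> G"
    unfolding G_def by (rule C1_compact_imp_C1_grad[OF assms])
  have K: "compact K" "K \<subseteq> \<Omega>"
    using assms by (auto simp: C1_compact_def K_def)
  have zero: "\<phi> x = 0" if "x \<notin> K" for x
    using that closure_subset[of "{x. \<phi> x \<noteq> 0}"] unfolding K_def by auto
  have G0: "G x = 0" if "x \<notin> K" for x
  proof -
    have "open (- K)"
      using K by (simp add: compact_imp_closed open_Compl)
    then have "GDERIV \<phi> x :> 0"
      using GDERIV_transform_open[of "\<lambda>_. 0" x 0 "- K" \<phi>] zero that
      by (auto simp: GDERIV_const)
    then show ?thesis
      by (simp add: G_def vec_eq_iff GDERIV_imp_partial_deriv)
  qed
  have "continuous_on K \<phi>" "continuous_on K G"
    using C1_grad_continuous_on[OF C1_grad_subset[OF C, of K]] C1_grad_subset[OF C, of K]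
    by (auto simp: C1_grad_def)
  then have "bounded (\<phi> ` K)" "bounded (G ` K)"
    using K by (auto intro: compact_imp_bounded compact_continuous_image)
  then obtain P1 P2 where P: "0 < P1" "\<forall>y\<in>\<phi> ` K. norm y \<le> P1" "0 < P2" "\<forall>y\<in>G ` K. norm y \<le> P2"
    unfolding bounded_pos by blast
  have bd: "\<bar>\<phi> x\<bar> \<le> P1 + P2 \<and> norm (G x) \<le> P1 + P2" for x
  proof (cases "x \<in> K")
    case True
    then have "\<bar>\<phi> x\<bar> \<le> P1" "norm (G x) \<le> P2"
      using P(2,4) by auto
    then show ?thesis
      using P(1,3) by linarith
  next
    case False
    then show ?thesis
      using zero[OF False] G0[OF False] P(1,3) by simp
  qed
  show ?thesis
  proof (rule that[OF K C])
    show "partial_deriv i \<phi> x = G x $ i" for i x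
      by (simp add: G_def)
    show "0 < P1 + P2"
      using P(1,3) by simp
  qed (use zero G0 bd in auto)
qed

lemma C1_compact_continuous_on:
  assumes "C1_compact \<Omega> \<psi>"
  shows "continuous_on S \<psi>" "continuous_on S (partial_deriv i \<psi>)"
proof -
  have C: "C1_grad UNIV \<psi> (\<lambda>x. \<chi> i. partial_deriv i \<psi> x)"
    using assms by (rule C1_compact_imp_C1_grad)
  show "continuous_on S \<psi>"
    using C1_grad_continuous_on[OF C1_grad_subset[OF C, of S]] by simp
  have "continuous_on UNIV (partial_deriv i \<psi>)"
    using assms by (simp add: C1_compact_def)
  then show "continuous_on S (partial_deriv i \<psi>)"
    using continuous_on_subset by blast
qed

lemma C1_compact_subset: "C1_compact \<Omega> \<phi> \<Longrightarrow> \<Omega> \<subseteq> \<Omega>' \<Longrightarrow> C1_compact \<Omega>' \<phi>"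
  unfolding C1_compact_def by blast

text \<open>Off \<open>K\<close> the function is locally zero, so its gradient vanishes there as well and the continuation by
  zero stays continuously differentiable.\<close>

lemma C1_compactI_local:
  assumes "open V" "C1_grad V u U" "compact K" "K \<subseteq> V" "\<And>x. x \<notin> K \<Longrightarrow> u x = 0"
  shows "C1_compact V u"
proof -
  define W where "W x = (if x \<in> V then U x else 0)" for x
  have "open (- K)"
    using assms(3) by (simp add: compact_imp_closed open_Compl)
  have GD0: "GDERIV u x :> 0" if "x \<notin> K" for x
    using GDERIV_transform_open[of "\<lambda>_. 0" x 0 "- K" u] that assms(5) \<open>open (- K)\<close> GDERIV_const by auto
  have "U x = 0" if "x \<in> V" "x \<notin> K" for x
  proof -
    have "GDERIV u x :> U x"
      using assms(2) that by (simp add: C1_grad_def)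
    then show ?thesis
      using GDERIV_imp_partial_deriv[OF GD0[OF that(2)]] GDERIV_imp_partial_deriv[of u x "U x"]
      by (simp add: vec_eq_iff)
  qed
  then have W0: "W x = 0" if "x \<notin> K" for x
    using that by (simp add: W_def)
  have 1: "C1_grad V u W"
    by (rule C1_grad_cong[OF assms(2,1)]) (auto simp: W_def)
  have 2: "C1_grad (- K) u W"
    using \<open>open (- K)\<close> W0 assms(5) by (intro C1_grad_cong[OF C1_grad_const[of _ 0]]) auto
  have "V \<union> - K = UNIV"
    using assms(4) by auto
  then have "C1_grad UNIV u W"
    using C1_grad_Un[OF 1 2 assms(1) \<open>open (- K)\<close>] by simp
  then show ?thesis
    using assms by (intro C1_compactI[of u W K]) auto
qed

text \<open>The factor \<open>u\<close> need only be defined near the support of the test function; off the support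
  the product is continued by zero.\<close>

lemma C1_compact_mult:
  assumes "open \<Omega>" "C1_grad \<Omega> u U" "C1_compact \<Omega> \<psi>"
  shows "C1_compact \<Omega> (\<lambda>x. u x * \<psi> x)"
    and "x \<in> \<Omega> \<Longrightarrow> partial_deriv i (\<lambda>x. u x * \<psi> x) x = u x * partial_deriv i \<psi> x + U x $ i * \<psi> x"
proof -
  obtain K G P where K: "compact K" "K \<subseteq> \<Omega>" "C1_grad UNIV \<psi> G"
    "\<And>i x. partial_deriv i \<psi> x = G x $ i" "\<And>x. x \<notin> K \<Longrightarrow> \<psi> x = 0"
    by (rule C1_compactE[OF assms(3)]) blast
  note prod = C1_grad_mult[OF assms(2) C1_grad_subset[OF K(3) subset_UNIV]]
  show "C1_compact \<Omega> (\<lambda>x. u x * \<psi> x)"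
    using K(5) by (intro C1_compactI_local[OF assms(1) prod K(1,2)]) auto
  show "partial_deriv i (\<lambda>x. u x * \<psi> x) x = u x * partial_deriv i \<psi> x + U x $ i * \<psi> x" if "x \<in> \<Omega>"
    using C1_grad_partial_deriv[OF prod that] K(4) by simp
qed

section \<open>Local integrability and weak derivatives\<close>

lemma set_integral_superset:
  fixes F :: "'a \<Rightarrow> real"
  assumes "K \<subseteq> \<Omega>" "\<And>x. x \<in> \<Omega> \<Longrightarrow> x \<notin> K \<Longrightarrow> F x = 0"
  shows "(LINT x:\<Omega>|M. F x) = (LINT x:K|M. F x)"
    and "set_integrable M \<Omega> F \<longleftrightarrow> set_integrable M K F"
proof -
  have "(\<lambda>x. indicator \<Omega> x *\<^sub>R F x) = (\<lambda>x. indicator K x *\<^sub>R F x)"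
    using assms by (auto simp: indicator_def fun_eq_iff)
  then show "(LINT x:\<Omega>|M. F x) = (LINT x:K|M. F x)" "set_integrable M \<Omega> F \<longleftrightarrow> set_integrable M K F"
    by (simp_all add: set_lebesgue_integral_def set_integrable_def)
qed

lemma set_integrable_sum:
  fixes F :: "'i \<Rightarrow> 'a \<Rightarrow> real"
  assumes "\<And>i. i \<in> S \<Longrightarrow> set_integrable M \<Omega> (F i)"
  shows "set_integrable M \<Omega> (\<lambda>x. \<Sum>i\<in>S. F i x)"
    and "(LINT x:\<Omega>|M. \<Sum>i\<in>S. F i x) = (\<Sum>i\<in>S. LINT x:\<Omega>|M. F i x)"
  using assms unfolding set_integrable_def set_lebesgue_integral_def
  by (auto simp: scaleR_sum_right simp del: real_scaleR_def intro!: Bochner_Integration.integral_sum)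

lemma set_integral_abs_le:
  fixes F B :: "'a \<Rightarrow> real"
  assumes "set_integrable M \<Omega> F" "set_integrable M \<Omega> B" "\<And>x. x \<in> \<Omega> \<Longrightarrow> \<bar>F x\<bar> \<le> B x"
  shows "\<bar>LINT x:\<Omega>|M. F x\<bar> \<le> (LINT x:\<Omega>|M. B x)"
proof -
  have "\<bar>LINT x:\<Omega>|M. F x\<bar> \<le> (LINT x:\<Omega>|M. \<bar>F x\<bar>)"
    using set_integral_norm_bound[OF assms(1)] by simp
  also have "\<dots> \<le> (LINT x:\<Omega>|M. B x)"
    using assms by (intro set_integral_mono set_integrable_abs)
  finally show ?thesis .
qed

lemma loc_integrable_subset: "loc_integrable \<Omega> f \<Longrightarrow> \<Omega>' \<subseteq> \<Omega> \<Longrightarrow> loc_integrable \<Omega>' f"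
  unfolding loc_integrable_def by blast

lemma loc_integrable_add: "loc_integrable \<Omega> f \<Longrightarrow> loc_integrable \<Omega> g \<Longrightarrow> loc_integrable \<Omega> (\<lambda>x. f x + g x)"
  unfolding loc_integrable_def by (auto intro: set_integral_add)

lemma loc_integrable_sum:
  "(\<And>i. i \<in> S \<Longrightarrow> loc_integrable \<Omega> (f i)) \<Longrightarrow> loc_integrable \<Omega> (\<lambda>x. \<Sum>i\<in>S. f i x)"
  unfolding loc_integrable_def by (auto intro: set_integrable_sum)

lemma set_integrable_imp_loc_integrable:
  assumes "set_integrable lebesgue \<Omega> f"
  shows "loc_integrable \<Omega> f"
  using assms unfolding loc_integrable_def
  by (auto intro: set_integrable_subset lmeasurable_compact fmeasurableD)

lemma loc_integrable_mult_continuous: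
  assumes "loc_integrable \<Omega> f" "continuous_on \<Omega> u"
  shows "loc_integrable \<Omega> (\<lambda>x. u x * f x)"
  unfolding loc_integrable_def
proof (intro allI impI, elim conjE)
  fix K assume K: "compact K" "K \<subseteq> \<Omega>"
  have "continuous_on K u"
    using assms(2) K(2) continuous_on_subset by blast
  moreover have "K \<in> sets lebesgue"
    using K by (simp add: lmeasurable_compact fmeasurableD)
  moreover have "bounded (u ` K)"
    using K calculation by (auto intro: compact_imp_bounded compact_continuous_image)
  ultimately show "(\<lambda>x. u x * f x) absolutely_integrable_on K"
    using assms K unfolding loc_integrable_def
    by (intro absolutely_integrable_bounded_measurable_product[OF bilinear_times]
        continuous_imp_measurable_on_sets_lebesgue) auto
qed

lemma set_integrable_mult_bounded_continuous:
  fixes f u :: "real^'n \<Rightarrow> real"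
  assumes "set_integrable lebesgue S f" "continuous_on S u" "S \<in> sets lebesgue"
    "\<And>x. x \<in> S \<Longrightarrow> \<bar>u x\<bar> \<le> C"
  shows "set_integrable lebesgue S (\<lambda>x. u x * f x)"
  using assms by (intro absolutely_integrable_bounded_measurable_product[OF bilinear_times]
        continuous_imp_measurable_on_sets_lebesgue) (auto simp: bounded_iff)

lemma test_integrable:
  assumes "loc_integrable \<Omega> f" "C1_compact \<Omega> \<psi>"
  shows "set_integrable lebesgue \<Omega> (\<lambda>x. f x * \<psi> x)"
    and "set_integrable lebesgue \<Omega> (\<lambda>x. f x * partial_deriv i \<psi> x)"
    and "set_integrable lebesgue \<Omega> (\<lambda>x. f x * \<bar>\<psi> x\<bar>)"
proof -
  obtain K G P where K: "compact K" "K \<subseteq> \<Omega>" "C1_grad UNIV \<psi> G"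
    "\<And>i x. partial_deriv i \<psi> x = G x $ i"
    "\<And>x. x \<notin> K \<Longrightarrow> \<psi> x = 0" "\<And>x. x \<notin> K \<Longrightarrow> G x = 0"
    by (rule C1_compactE[OF assms(2)]) blast
  have *: "set_integrable lebesgue \<Omega> (\<lambda>x. f x * u x)"
    if "continuous_on UNIV u" "\<And>x. x \<notin> K \<Longrightarrow> u x = 0" for u
  proof -
    have "loc_integrable \<Omega> (\<lambda>x. u x * f x)"
      using assms(1) that(1) by (auto intro: loc_integrable_mult_continuous continuous_on_subset)
    then have "set_integrable lebesgue K (\<lambda>x. f x * u x)"
      using K(1,2) by (simp add: loc_integrable_def mult.commute)
    then show ?thesis
      using set_integral_superset(2)[OF K(2), of "\<lambda>x. f x * u x"] that(2) by auto
  qed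
  have "continuous_on UNIV \<psi>"
    using K(3) by (rule C1_grad_continuous_on)
  then show "set_integrable lebesgue \<Omega> (\<lambda>x. f x * \<psi> x)" "set_integrable lebesgue \<Omega> (\<lambda>x. f x * \<bar>\<psi> x\<bar>)"
    using K(5) by (auto intro!: * continuous_intros)
  have "continuous_on UNIV (partial_deriv i \<psi>)"
    using K(3,4) by (auto simp: C1_grad_def intro!: continuous_intros)
  then show "set_integrable lebesgue \<Omega> (\<lambda>x. f x * partial_deriv i \<psi> x)"
    using K(4,6) by (intro *) auto
qed

lemma has_weak_pderiv_test:
  "has_weak_pderiv \<Omega> i f g \<Longrightarrow> C1_compact \<Omega> \<psi> \<Longrightarrow>
    (LINT x:\<Omega>|lebesgue. f x * partial_deriv i \<psi> x) = - (LINT x:\<Omega>|lebesgue. g x * \<psi> x)"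
  unfolding has_weak_pderiv_def by blast

lemma has_weak_pderiv_loc: "has_weak_pderiv \<Omega> i f g \<Longrightarrow> loc_integrable \<Omega> f \<and> loc_integrable \<Omega> g"
  unfolding has_weak_pderiv_def by blast

lemma has_weak_pderiv_add:
  assumes "has_weak_pderiv \<Omega> i f g" "has_weak_pderiv \<Omega> i f' g'"
  shows "has_weak_pderiv \<Omega> i (\<lambda>x. f x + f' x) (\<lambda>x. g x + g' x)"
  using assms has_weak_pderiv_loc[OF assms(1)] has_weak_pderiv_loc[OF assms(2)]
  unfolding has_weak_pderiv_def
  by (auto simp: distrib_right test_integrable intro: loc_integrable_add)

lemma has_weak_pderiv_subset:
  assumes "has_weak_pderiv \<Omega> i f g" "\<Omega>' \<subseteq> \<Omega>"
  shows "has_weak_pderiv \<Omega>' i f g"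
  unfolding has_weak_pderiv_def
proof (intro conjI allI impI)
  show "loc_integrable \<Omega>' f" "loc_integrable \<Omega>' g"
    using has_weak_pderiv_loc[OF assms(1)] assms(2) by (auto intro: loc_integrable_subset)
  fix \<psi> assume \<psi>: "C1_compact \<Omega>' \<psi>"
  obtain K G P where K: "compact K" "K \<subseteq> \<Omega>'" "\<And>i x. partial_deriv i \<psi> x = G x $ i"
    "\<And>x. x \<notin> K \<Longrightarrow> \<psi> x = 0" "\<And>x. x \<notin> K \<Longrightarrow> G x = 0"
    by (rule C1_compactE[OF \<psi>]) blast
  have "x \<in> \<Omega>' \<Longrightarrow> x \<in> \<Omega>" "x \<notin> \<Omega>' \<Longrightarrow> x \<notin> K" for x
    using K(2) assms(2) by auto
  then show "(LINT x:\<Omega>'|lebesgue. f x * partial_deriv i \<psi> x) = - (LINT x:\<Omega>'|lebesgue. g x * \<psi> x)"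
    using has_weak_pderiv_test[OF assms(1) C1_compact_subset[OF \<psi> assms(2)]] K(3-5)
      set_integral_superset(1)[OF assms(2), of "\<lambda>x. f x * partial_deriv i \<psi> x" lebesgue]
      set_integral_superset(1)[OF assms(2), of "\<lambda>x. g x * \<psi> x" lebesgue] by simp
qed

lemma set_integrable_cong_AE_lebesgue:
  fixes f g :: "real^'n \<Rightarrow> real"
  assumes "set_integrable lebesgue S f" "AE x in lebesgue. x \<in> S \<longrightarrow> f x = g x"
  shows "set_integrable lebesgue S g"
    and "(LINT x:S|lebesgue. f x) = (LINT x:S|lebesgue. g x)"
proof -
  have eq: "AE x in lebesgue. indicator S x *\<^sub>R f x = indicator S x *\<^sub>R g x"
    using assms(2) by (auto simp: indicator_def)
  have f: "(\<lambda>x. indicator S x *\<^sub>R f x) \<in> borel_measurable lebesgue"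
    using assms(1) by (auto simp: set_integrable_def)
  then have g: "(\<lambda>x. indicator S x *\<^sub>R g x) \<in> borel_measurable lebesgue"
    using eq by (rule borel_measurable_AE)
  show "set_integrable lebesgue S g" "(LINT x:S|lebesgue. f x) = (LINT x:S|lebesgue. g x)"
    using assms(1) integrable_cong_AE[OF f g eq] integral_cong_AE[OF f g eq]
    by (auto simp: set_integrable_def set_lebesgue_integral_def)
qed

lemma has_weak_pderiv_cong_AE:
  assumes "has_weak_pderiv \<Omega> i f g" "AE x in lebesgue. x \<in> \<Omega> \<longrightarrow> f x = f' x"
  shows "has_weak_pderiv \<Omega> i f' g"
  unfolding has_weak_pderiv_def
proof (intro conjI allI impI)
  show "loc_integrable \<Omega> g"
    using assms by (simp add: has_weak_pderiv_def)
  show "loc_integrable \<Omega> f'"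
    unfolding loc_integrable_def
  proof (intro allI impI, elim conjE)
    fix K assume "compact K" "K \<subseteq> \<Omega>"
    then have "f absolutely_integrable_on K" "AE x in lebesgue. x \<in> K \<longrightarrow> f x = f' x"
      using assms by (auto simp: has_weak_pderiv_def loc_integrable_def)
    then show "f' absolutely_integrable_on K"
      by (rule set_integrable_cong_AE_lebesgue)
  qed
  fix \<psi> assume \<psi>: "C1_compact \<Omega> \<psi>"
  have "(LINT x:\<Omega>|lebesgue. f x * partial_deriv i \<psi> x) = (LINT x:\<Omega>|lebesgue. f' x * partial_deriv i \<psi> x)"
    using assms \<psi> by (intro set_integrable_cong_AE_lebesgue(2) test_integrable) (auto simp: has_weak_pderiv_def)
  then show "(LINT x:\<Omega>|lebesgue. f' x * partial_deriv i \<psi> x) = - (LINT x:\<Omega>|lebesgue. g x * \<psi> x)"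
    using has_weak_pderiv_test[OF assms(1) \<psi>] by simp
qed

text \<open>The product with a test function is a test function, so testing \<open>f\<close> against it gives the
  product rule.\<close>

lemma has_weak_pderiv_mult:
  assumes "open \<Omega>" "has_weak_pderiv \<Omega> i f g" "C1_grad \<Omega> u U"
  shows "has_weak_pderiv \<Omega> i (\<lambda>x. u x * f x) (\<lambda>x. U x $ i * f x + u x * g x)"
  unfolding has_weak_pderiv_def
proof (intro conjI allI impI)
  note u = C1_grad_continuous_on[OF assms(3)]
  have U: "continuous_on \<Omega> (\<lambda>x. U x $ i)"
    using assms(3) by (auto simp: C1_grad_def intro!: continuous_intros)
  have f: "loc_integrable \<Omega> f" and g: "loc_integrable \<Omega> g"
    using has_weak_pderiv_loc[OF assms(2)] by auto
  note uf = loc_integrable_mult_continuous[OF f u]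
    and ug = loc_integrable_mult_continuous[OF g u]
    and Uf = loc_integrable_mult_continuous[OF f U]
  show "loc_integrable \<Omega> (\<lambda>x. u x * f x)" "loc_integrable \<Omega> (\<lambda>x. U x $ i * f x + u x * g x)"
    by (fact uf, intro loc_integrable_add Uf ug)
  fix \<psi> assume \<psi>: "C1_compact \<Omega> \<psi>"
  note prod = C1_compact_mult[OF assms(1,3) \<psi>]
  have "(LINT x:\<Omega>|lebesgue. u x * f x * partial_deriv i \<psi> x) + (LINT x:\<Omega>|lebesgue. U x $ i * f x * \<psi> x)
      = (LINT x:\<Omega>|lebesgue. u x * f x * partial_deriv i \<psi> x + U x $ i * f x * \<psi> x)"
    using test_integrable(2)[OF uf \<psi>] test_integrable(1)[OF Uf \<psi>] by (intro set_integral_add(2)[symmetric])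
  also have "\<dots> = (LINT x:\<Omega>|lebesgue. f x * partial_deriv i (\<lambda>x. u x * \<psi> x) x)"
    using assms(1) by (intro set_lebesgue_integral_cong) (auto simp: prod(2) distrib_left)
  also have "\<dots> = - (LINT x:\<Omega>|lebesgue. u x * g x * \<psi> x)"
    using has_weak_pderiv_test[OF assms(2) prod(1)] by (simp add: algebra_simps)
  finally have "(LINT x:\<Omega>|lebesgue. u x * f x * partial_deriv i \<psi> x)
    = - ((LINT x:\<Omega>|lebesgue. U x $ i * f x * \<psi> x) + (LINT x:\<Omega>|lebesgue. u x * g x * \<psi> x))"
    by simp
  also have "\<dots> = - (LINT x:\<Omega>|lebesgue. (U x $ i * f x + u x * g x) * \<psi> x)"
    using test_integrable(1)[OF ug \<psi>] test_integrable(1)[OF Uf \<psi>]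
    by (simp add: distrib_right)
  finally show "(LINT x:\<Omega>|lebesgue. u x * f x * partial_deriv i \<psi> x)
    = - (LINT x:\<Omega>|lebesgue. (U x $ i * f x + u x * g x) * \<psi> x)" .
qed

text \<open>The difference quotients of \<open>\<psi>\<close> have integral zero by translation invariance, are bounded
  by the gradient, and vanish off a fixed ball.\<close>

lemma integral_partial_deriv_eq_0:
  fixes \<psi> :: "real^'n \<Rightarrow> real"
  assumes "C1_compact \<Omega> \<psi>"
  shows "(LINT x:\<Omega>|lebesgue. partial_deriv i \<psi> x) = 0"
proof -
  obtain K G P where K: "compact K" "K \<subseteq> \<Omega>" "C1_grad UNIV \<psi> G"
    "\<And>i x. partial_deriv i \<psi> x = G x $ i"
    "\<And>x. x \<notin> K \<Longrightarrow> \<psi> x = 0" "\<And>x. x \<notin> K \<Longrightarrow> G x = 0"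
    and P: "0 < P" "\<And>x. norm (G x) \<le> P"
    by (rule C1_compactE[OF assms]) blast
  obtain R where R: "0 < R" "\<And>x. x \<in> K \<Longrightarrow> norm x \<le> R"
    using compact_imp_bounded[OF K(1)] bounded_pos by metis
  define e :: "real^'n" where "e = axis i 1"
  have e: "norm e = 1"
    by (simp add: e_def)
  define t where "t k = inverse (real (Suc k))" for k
  have t: "0 < t k" "t k \<le> 1" for k
    by (auto simp: t_def field_simps)
  define d where "d k x = (\<psi> (t k *\<^sub>R e + x) - \<psi> x) / t k" for k x
  have cont: "continuous_on UNIV \<psi>"
    using K(3) by (rule C1_grad_continuous_on)
  have [measurable]: "\<psi> \<in> borel_measurable borel"
    using cont by (rule borel_measurable_continuous_onI)
  have int\<psi>: "integrable lborel \<psi>"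
  proof -
    have "integrable lborel (\<lambda>x. indicator K x *\<^sub>R \<psi> x)"
      using borel_integrable_compact[OF K(1) continuous_on_subset[OF cont]] by simp
    also have "(\<lambda>x. indicator K x *\<^sub>R \<psi> x) = \<psi>"
      using K(5) by (force simp: indicator_def)
    finally show ?thesis .
  qed
  have shift: "integrable lborel (\<lambda>x. \<psi> (c + x))" "(LINT x|lborel. \<psi> (c + x)) = (LINT x|lborel. \<psi> x)" for c
    using int\<psi> integrable_distr_eq[of "(+) c" lborel borel \<psi>] integral_distr[of "(+) c" lborel borel \<psi>]
    by (simp_all add: lborel_distr_plus)
  have "(LINT x|lborel. d k x) = 0" for k
    using shift int\<psi> by (simp add: d_def)
  moreover have "(\<lambda>k. LINT x|lborel. d k x) \<longlonglongrightarrow> (LINT x|lborel. G x $ i)"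
  proof (rule integral_dominated_convergence[where w = "\<lambda>x. indicator (cball 0 (R + 1)) x * P"])
    show "(\<lambda>x. G x $ i) \<in> borel_measurable lborel"
      using K(3) by (auto simp: C1_grad_def intro!: borel_measurable_continuous_onI continuous_intros)
    show "d k \<in> borel_measurable lborel" for k
      unfolding d_def by measurable
    show "integrable lborel (\<lambda>x::real^'n. indicator (cball 0 (R + 1)) x * P)"
      using borel_integrable_compact[of "cball (0::real^'n) (R + 1)" "\<lambda>_. P"] by (simp add: mult.commute)
    have line: "((\<lambda>s. \<psi> (s *\<^sub>R e + x)) has_real_derivative (e \<bullet> G (s *\<^sub>R e + x))) (at s)" for s x
    proof -
      have "(\<psi> has_derivative (\<lambda>h. h \<bullet> G (s *\<^sub>R e + x))) (at (s *\<^sub>R e + x))"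
        using K(3) by (simp add: C1_grad_def gderiv_def)
      moreover have "((\<lambda>s. s *\<^sub>R e + x) has_derivative (\<lambda>h. h *\<^sub>R e)) (at s)"
        by (auto intro!: derivative_eq_intros)
      ultimately have "((\<lambda>s. \<psi> (s *\<^sub>R e + x)) has_derivative (\<lambda>h. (h *\<^sub>R e) \<bullet> G (s *\<^sub>R e + x))) (at s)"
        using has_derivative_compose by blast
      then show ?thesis
        by (simp add: has_field_derivative_def mult_commute_abs)
    qed
    show "AE x in lborel. (\<lambda>k. d k x) \<longlonglongrightarrow> G x $ i"
    proof (rule AE_I2)
      fix x
      have "((\<lambda>h. (\<psi> ((0 + h) *\<^sub>R e + x) - \<psi> (0 *\<^sub>R e + x)) / h) \<longlongrightarrow> e \<bullet> G (0 *\<^sub>R e + x)) (at 0)"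
        using line[of x 0] by (simp only: DERIV_def)
      moreover have "filterlim t (at 0) sequentially"
        using LIMSEQ_inverse_real_of_nat t(1) unfolding t_def filterlim_at
        by (auto simp: less_imp_neq)
      ultimately have "(\<lambda>k. (\<psi> ((0 + t k) *\<^sub>R e + x) - \<psi> (0 *\<^sub>R e + x)) / t k) \<longlonglongrightarrow> e \<bullet> G (0 *\<^sub>R e + x)"
        by (rule filterlim_compose)
      then show "(\<lambda>k. d k x) \<longlonglongrightarrow> G x $ i"
        by (simp add: d_def e_def inner_axis')
    qed
    show "AE x in lborel. norm (d k x) \<le> indicator (cball 0 (R + 1)) x * P" for k
    proof (rule AE_I2)
      fix x
      show "norm (d k x) \<le> indicator (cball 0 (R + 1)) x * P"
      proof (cases "norm x \<le> R + 1")
        case True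
        obtain z where "\<psi> (t k *\<^sub>R e + x) - \<psi> (0 *\<^sub>R e + x) = (t k - 0) * (e \<bullet> G (z *\<^sub>R e + x))"
          using MVT2[OF t(1)[of k], of "\<lambda>s. \<psi> (s *\<^sub>R e + x)", OF line] by blast
        then have "d k x = e \<bullet> G (z *\<^sub>R e + x)"
          using t(1)[of k] by (simp add: d_def)
        also have "\<bar>\<dots>\<bar> \<le> norm e * norm (G (z *\<^sub>R e + x))"
          by (rule Cauchy_Schwarz_ineq2)
        finally show ?thesis
          using P(2)[of "z *\<^sub>R e + x"] e True by simp
      next
        case False
        have "norm x \<le> norm (t k *\<^sub>R e + x) + norm (t k *\<^sub>R e)"
          using norm_triangle_ineq4[of "t k *\<^sub>R e + x" "t k *\<^sub>R e"] by simp
        then have "norm (t k *\<^sub>R e + x) > R"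
          using False e t[of k] by simp
        then have "t k *\<^sub>R e + x \<notin> K" "x \<notin> K"
          using R False by fastforce+
        then show ?thesis
          using K(5) P(1) by (simp add: d_def)
      qed
    qed
  qed
  ultimately have "(LINT x|lborel. G x $ i) = 0"
    by (simp add: LIMSEQ_const_iff)
  moreover have "(\<lambda>x. G x $ i) \<in> borel_measurable lborel"
    using K(3) by (auto simp: C1_grad_def intro!: borel_measurable_continuous_onI continuous_intros)
  ultimately have "(LINT x|lebesgue. G x $ i) = 0"
    by (simp add: integral_completion)
  moreover have "(LINT x:UNIV|lebesgue. G x $ i) = (LINT x:K|lebesgue. G x $ i)"
    "(LINT x:\<Omega>|lebesgue. G x $ i) = (LINT x:K|lebesgue. G x $ i)"
    using K(2,6) by (intro set_integral_superset; simp)+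
  ultimately show ?thesis
    by (simp add: K(4) set_lebesgue_integral_def)
qed

lemma has_weak_pderiv_const: "has_weak_pderiv \<Omega> i (\<lambda>_. c) (\<lambda>_. 0)"
proof -
  have "(LINT x:\<Omega>|lebesgue. c * partial_deriv i \<psi> x) = 0" if "C1_compact \<Omega> \<psi>" for \<psi>
    using integral_partial_deriv_eq_0[OF that] by simp
  moreover have "loc_integrable \<Omega> (\<lambda>_. b)" for b
    unfolding loc_integrable_def by (auto intro: absolutely_integrable_on_const lmeasurable_compact)
  ultimately show ?thesis
    by (simp add: has_weak_pderiv_def)
qed

lemma open_annulus: "open (annulus a b :: (real^'n) set)"
  unfolding annulus_def by (intro open_Collect_conj open_Collect_less continuous_intros)

lemma annulus_sets_lebesgue [simp]: "annulus a b \<in> sets lebesgue"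
  using open_annulus by (metis borel_open sets_completionI_sets sets_lborel)

lemma annulus_mem: "x \<in> annulus a b \<longleftrightarrow> a < norm x \<and> norm x < b"
  by (simp add: annulus_def)

text \<open>A Lipschitz factor has no continuous derivative in general, so the product rule above does not apply to
  it.  Its forward averages are continuously differentiable with derivative bounded by the same constant, and
  they converge uniformly; in the limit the product rule survives as an inequality.  The averages look to
  the right, hence the room between \<open>b\<close> and \<open>c\<close>.\<close>

lemma weak_divergence_radial_Lipschitz:
  fixes F D :: "'n::finite \<Rightarrow> real^'n \<Rightarrow> real"
  assumes ab: "0 \<le> a" "a < b" "b < c" and "0 \<le> L"
    and lip: "\<And>s t. s \<in> {a..c} \<Longrightarrow> t \<in> {a..c} \<Longrightarrow> \<bar>u s - u t\<bar> \<le> L * \<bar>s - t\<bar>"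
    and weak: "\<And>i. has_weak_pderiv (annulus a b) i (F i) (D i)"
    and \<psi>: "C1_compact (annulus a b) \<psi>"
  shows "\<bar>LINT x:annulus a b|lebesgue. u (norm x) * (\<Sum>i\<in>UNIV. F i x * partial_deriv i \<psi> x + D i x * \<psi> x)\<bar>
    \<le> L * (LINT x:annulus a b|lebesgue. \<bar>\<Sum>i\<in>UNIV. F i x * sgn x $ i\<bar> * \<bar>\<psi> x\<bar>)"
proof -
  let ?A = "annulus a b :: (real^'n) set"
  define \<Phi> where "\<Phi> x = (\<Sum>i\<in>UNIV. F i x * partial_deriv i \<psi> x + D i x * \<psi> x)" for x
  define R where "R x = (\<Sum>i\<in>UNIV. F i x * sgn x $ i)" for x
  have locF: "loc_integrable ?A (F i)" and locD: "loc_integrable ?A (D i)" for i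
    using has_weak_pderiv_loc[OF weak] by auto
  have sgn_cont: "continuous_on ?A (sgn :: real^'n \<Rightarrow> real^'n)"
    using ab by (auto simp: sgn_div_norm annulus_def intro!: continuous_intros)
  have locR: "loc_integrable ?A R"
    unfolding R_def
    using loc_integrable_mult_continuous[OF locF, of "\<lambda>x. sgn x $ _"] sgn_cont
    by (intro loc_integrable_sum) (auto simp: mult.commute intro!: continuous_intros)
  have int\<Phi>: "set_integrable lebesgue ?A \<Phi>"
    unfolding \<Phi>_def
    by (intro set_integrable_sum set_integral_add test_integrable[OF locF \<psi>] test_integrable[OF locD \<psi>])
  have intR: "set_integrable lebesgue ?A (\<lambda>x. \<bar>R x\<bar> * \<bar>\<psi> x\<bar>)"
    using set_integrable_abs[OF test_integrable(1)[OF locR \<psi>]] by (simp add: abs_mult)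
  have ucont: "continuous_on {a..c} u"
  proof (rule continuous_onI)
    fix s e :: real assume s: "s \<in> {a..c}" and e: "0 < e"
    show "\<exists>d>0. \<forall>t\<in>{a..c}. dist t s < d \<longrightarrow> dist (u t) (u s) \<le> e"
    proof (intro exI[of _ "e / (L + 1)"] conjI ballI impI)
      fix t assume t: "t \<in> {a..c}" "dist t s < e / (L + 1)"
      have "\<bar>u t - u s\<bar> \<le> (L + 1) * \<bar>t - s\<bar>"
        using lip[OF t(1) s] \<open>0 \<le> L\<close> by (simp add: distrib_right)
      also have "\<dots> \<le> e"
        using t(2) \<open>0 \<le> L\<close> by (simp add: dist_real_def field_simps)
      finally show "dist (u t) (u s) \<le> e"
        by (simp add: dist_real_def)
    qed (use e \<open>0 \<le> L\<close> in auto)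
  qed
  obtain g where g: "\<And>s. s \<in> {a..c} \<Longrightarrow> (g has_vector_derivative u s) (at s within {a..c})"
    using antiderivative_continuous[OF ucont] by blast
  have g': "(g has_real_derivative u s) (at s)" if "a < s" "s < c" for s
    using g[of s] that by (simp add: has_real_derivative_iff_has_vector_derivative at_within_Icc_at)
  have bound: "\<bar>LINT x:?A|lebesgue. u (norm x) * \<Phi> x\<bar>
      \<le> L * (LINT x:?A|lebesgue. \<bar>R x\<bar> * \<bar>\<psi> x\<bar>) + L * h * (LINT x:?A|lebesgue. \<bar>\<Phi> x\<bar>)"
    if h: "0 < h" "h < c - b" for h
  proof -
    define w where "w s = (g (s + h) - g s) / h" for s
    define w' where "w' s = (u (s + h) - u s) / h" for s
    have w: "(w has_real_derivative w' s) (at s)" if "a < s" "s < b" for s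
    proof -
      have "((\<lambda>s. g (s + h)) has_real_derivative u (s + h)) (at s)"
        using g'[of "s + h"] that h ab by (simp add: DERIV_shift)
      moreover have "(g has_real_derivative u s) (at s)"
        using g'[of s] that ab by simp
      ultimately show ?thesis
        unfolding w_def w'_def by (intro DERIV_cdivide DERIV_diff)
    qed
    have w'_bound: "\<bar>w' s\<bar> \<le> L" if "a < s" "s < b" for s
      using lip[of "s + h" s] that h ab by (simp add: w'_def field_simps)
    have w_close: "\<bar>u s - w s\<bar> \<le> L * h" if "a < s" "s < b" for s
    proof -
      obtain z where z: "s < z" "z < s + h" "g (s + h) - g s = (s + h - s) * u z"
      proof -
        have "(g has_real_derivative u x) (at x)" if "s \<le> x" "x \<le> s + h" for x
          using \<open>a < s\<close> \<open>s < b\<close> that h by (intro g') auto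
        then show ?thesis
          using MVT2[of s "s + h" g u] h that by auto
      qed
      then have "\<bar>u s - w s\<bar> = \<bar>u s - u z\<bar>"
        using h by (simp add: w_def)
      also have "\<dots> \<le> L * \<bar>s - z\<bar>"
        using z that h ab by (intro lip) auto
      also have "\<dots> \<le> L * h"
        using z \<open>0 \<le> L\<close> by (intro mult_left_mono) auto
      finally show ?thesis .
    qed
    have norm_A: "norm ` ?A \<subseteq> {a<..<b}"
      by (auto simp: annulus_def)
    have w'_cont: "continuous_on (norm ` ?A) w'"
      unfolding w'_def using h ab norm_A
      by (intro continuous_intros continuous_on_compose2[OF ucont] continuous_on_subset[OF ucont]) auto
    have C1: "C1_grad ?A (\<lambda>x. w (norm x)) (\<lambda>x. w' (norm x) *\<^sub>R sgn x)"
      using w w'_cont ab by (intro C1_grad_radial) (auto simp: annulus_def)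
    have wcont: "continuous_on ?A (\<lambda>x. w (norm x))"
      using C1 by (rule C1_grad_continuous_on)
    have w'cont: "continuous_on ?A (\<lambda>x::real^'n. w' (norm x))"
      by (rule continuous_on_compose2[OF w'_cont]) (auto intro!: continuous_intros)
    have locs: "loc_integrable ?A (\<lambda>x. w' (norm x) * sgn x $ i * F i x)" for i
      by (intro loc_integrable_mult_continuous[OF locF] continuous_on_mult w'cont
          continuous_on_component[OF sgn_cont])
    have component: "(LINT x:?A|lebesgue. w (norm x) * (F i x * partial_deriv i \<psi> x + D i x * \<psi> x))
        = - (LINT x:?A|lebesgue. w' (norm x) * (F i x * sgn x $ i) * \<psi> x)" for i
    proof -
      note prod = has_weak_pderiv_mult[OF open_annulus weak C1]
      note locwF = loc_integrable_mult_continuous[OF locF wcont]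
        and locwD = loc_integrable_mult_continuous[OF locD wcont]
      have "(LINT x:?A|lebesgue. w (norm x) * (F i x * partial_deriv i \<psi> x + D i x * \<psi> x))
          = (LINT x:?A|lebesgue. w (norm x) * F i x * partial_deriv i \<psi> x + w (norm x) * D i x * \<psi> x)"
        by (simp add: algebra_simps)
      also have "\<dots> = (LINT x:?A|lebesgue. w (norm x) * F i x * partial_deriv i \<psi> x)
          + (LINT x:?A|lebesgue. w (norm x) * D i x * \<psi> x)"
        by (intro set_integral_add test_integrable[OF locwF \<psi>] test_integrable[OF locwD \<psi>])
      also have "(LINT x:?A|lebesgue. w (norm x) * F i x * partial_deriv i \<psi> x)
          = - (LINT x:?A|lebesgue. w' (norm x) * sgn x $ i * F i x * \<psi> x + w (norm x) * D i x * \<psi> x)"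
        using has_weak_pderiv_test[OF prod \<psi>] by (simp add: distrib_right)
      also have "(LINT x:?A|lebesgue. w' (norm x) * sgn x $ i * F i x * \<psi> x + w (norm x) * D i x * \<psi> x)
          = (LINT x:?A|lebesgue. w' (norm x) * sgn x $ i * F i x * \<psi> x)
            + (LINT x:?A|lebesgue. w (norm x) * D i x * \<psi> x)"
        by (intro set_integral_add test_integrable[OF locs \<psi>] test_integrable[OF locwD \<psi>])
      finally show ?thesis
        by (simp add: mult_ac)
    qed
    have int_w: "set_integrable lebesgue ?A (\<lambda>x. w (norm x) * (F i x * partial_deriv i \<psi> x + D i x * \<psi> x))" for i
      using set_integral_add(1)[OF test_integrable(2)[OF loc_integrable_mult_continuous[OF locF wcont] \<psi>, of i]
        test_integrable(1)[OF loc_integrable_mult_continuous[OF locD wcont] \<psi>], of i]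
      by (simp add: algebra_simps)
    have int_w': "set_integrable lebesgue ?A (\<lambda>x. w' (norm x) * (F i x * sgn x $ i) * \<psi> x)" for i
      using test_integrable(1)[OF locs \<psi>] by (simp add: mult_ac)
    have int_w\<Phi>: "set_integrable lebesgue ?A (\<lambda>x. w (norm x) * \<Phi> x)"
      unfolding \<Phi>_def sum_distrib_left by (intro set_integrable_sum int_w)
    have "(LINT x:?A|lebesgue. w (norm x) * \<Phi> x) = - (LINT x:?A|lebesgue. w' (norm x) * R x * \<psi> x)"
    proof -
      have "(LINT x:?A|lebesgue. w (norm x) * \<Phi> x)
          = (\<Sum>i\<in>UNIV. LINT x:?A|lebesgue. w (norm x) * (F i x * partial_deriv i \<psi> x + D i x * \<psi> x))"
        unfolding \<Phi>_def sum_distrib_left by (intro set_integrable_sum int_w)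
      also have "\<dots> = - (\<Sum>i\<in>UNIV. LINT x:?A|lebesgue. w' (norm x) * (F i x * sgn x $ i) * \<psi> x)"
        by (simp add: component sum_negf)
      also have "\<dots> = - (LINT x:?A|lebesgue. \<Sum>i\<in>UNIV. w' (norm x) * (F i x * sgn x $ i) * \<psi> x)"
        using set_integrable_sum(2)[of UNIV lebesgue ?A "\<lambda>i x. w' (norm x) * (F i x * sgn x $ i) * \<psi> x", OF int_w'] by simp
      finally show ?thesis
        by (simp add: R_def sum_distrib_left sum_distrib_right)
    qed
    also have "\<bar>\<dots>\<bar> \<le> (LINT x:?A|lebesgue. L * (\<bar>R x\<bar> * \<bar>\<psi> x\<bar>))"
      unfolding abs_minus_cancel
    proof (rule set_integral_abs_le)
      show "set_integrable lebesgue ?A (\<lambda>x. w' (norm x) * R x * \<psi> x)"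
        using set_integrable_sum(1)[of UNIV lebesgue ?A "\<lambda>i x. w' (norm x) * (F i x * sgn x $ i) * \<psi> x", OF int_w'] by (simp add: R_def sum_distrib_left sum_distrib_right)
      show "set_integrable lebesgue ?A (\<lambda>x. L * (\<bar>R x\<bar> * \<bar>\<psi> x\<bar>))"
        using intR by simp
      show "\<bar>w' (norm x) * R x * \<psi> x\<bar> \<le> L * (\<bar>R x\<bar> * \<bar>\<psi> x\<bar>)" if "x \<in> ?A" for x
        using w'_bound[of "norm x"] that
        by (simp add: abs_mult annulus_def mult_right_mono mult.assoc)
    qed
    finally have 1: "\<bar>LINT x:?A|lebesgue. w (norm x) * \<Phi> x\<bar> \<le> L * (LINT x:?A|lebesgue. \<bar>R x\<bar> * \<bar>\<psi> x\<bar>)"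
      by simp
    have int_u\<Phi>: "set_integrable lebesgue ?A (\<lambda>x. u (norm x) * \<Phi> x)"
    proof (rule set_integrable_mult_bounded_continuous[OF int\<Phi>])
      show "continuous_on ?A (\<lambda>x. u (norm x))"
        using norm_A ab by (intro continuous_on_compose2[OF ucont]) (auto intro!: continuous_intros)
      show "\<bar>u (norm x)\<bar> \<le> \<bar>u a\<bar> + L * (b - a)" if "x \<in> ?A" for x
      proof -
        have "\<bar>u (norm x) - u a\<bar> \<le> L * \<bar>norm x - a\<bar>"
          using that ab by (intro lip) (auto simp: annulus_def)
        also have "\<dots> \<le> L * (b - a)"
          using that \<open>0 \<le> L\<close> by (intro mult_left_mono) (auto simp: annulus_def)
        finally show ?thesis
          by linarith
      qed
    qed simp
    have "\<bar>(LINT x:?A|lebesgue. u (norm x) * \<Phi> x) - (LINT x:?A|lebesgue. w (norm x) * \<Phi> x)\<bar>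
        = \<bar>LINT x:?A|lebesgue. u (norm x) * \<Phi> x - w (norm x) * \<Phi> x\<bar>"
      using int_u\<Phi> int_w\<Phi> by simp
    also have "\<dots> \<le> (LINT x:?A|lebesgue. (L * h) * \<bar>\<Phi> x\<bar>)"
    proof (rule set_integral_abs_le)
      show "\<bar>u (norm x) * \<Phi> x - w (norm x) * \<Phi> x\<bar> \<le> (L * h) * \<bar>\<Phi> x\<bar>" if "x \<in> ?A" for x
        using w_close[of "norm x"] that
        by (simp add: annulus_def left_diff_distrib[symmetric] abs_mult mult_right_mono)
    qed (use int_u\<Phi> int_w\<Phi> int\<Phi> in \<open>auto intro: set_integrable_abs\<close>)
    finally have "\<bar>(LINT x:?A|lebesgue. u (norm x) * \<Phi> x) - (LINT x:?A|lebesgue. w (norm x) * \<Phi> x)\<bar>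
        \<le> L * h * (LINT x:?A|lebesgue. \<bar>\<Phi> x\<bar>)"
      by simp
    with 1 show ?thesis
      by linarith
  qed
  have "\<bar>LINT x:?A|lebesgue. u (norm x) * \<Phi> x\<bar> \<le> L * (LINT x:?A|lebesgue. \<bar>R x\<bar> * \<bar>\<psi> x\<bar>)"
  proof (rule tendsto_lowerbound)
    show "((\<lambda>h. L * (LINT x:?A|lebesgue. \<bar>R x\<bar> * \<bar>\<psi> x\<bar>) + L * h * (LINT x:?A|lebesgue. \<bar>\<Phi> x\<bar>))
        \<longlongrightarrow> L * (LINT x:?A|lebesgue. \<bar>R x\<bar> * \<bar>\<psi> x\<bar>)) (at_right 0)"
      by (auto intro!: tendsto_eq_intros)
    show "\<forall>\<^sub>F h in at_right 0. \<bar>LINT x:?A|lebesgue. u (norm x) * \<Phi> x\<bar>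
        \<le> L * (LINT x:?A|lebesgue. \<bar>R x\<bar> * \<bar>\<psi> x\<bar>) + L * h * (LINT x:?A|lebesgue. \<bar>\<Phi> x\<bar>)"
      using ab bound by (auto simp: eventually_at_right_field intro!: exI[of _ "c - b"])
  qed simp
  then show ?thesis
    by (simp add: \<Phi>_def R_def)
qed

section \<open>Volumes of shells and integrals of radial functions\<close>

abbreviation unit_vol :: "'n::finite itself \<Rightarrow> real" where
  "unit_vol _ \<equiv> unit_ball_vol (real CARD('n))"

lemma measure_shell:
  assumes "0 \<le> s" "s \<le> t"
  shows "{x::real^'n. s < norm x \<and> norm x \<le> t} \<in> lmeasurable"
    and "measure lebesgue {x::real^'n. s < norm x \<and> norm x \<le> t} = unit_vol TYPE('n) * (t ^ CARD('n) - s ^ CARD('n))"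
proof -
  have eq: "{x::real^'n. s < norm x \<and> norm x \<le> t} = cball 0 t - cball 0 s"
    by auto
  show "{x::real^'n. s < norm x \<and> norm x \<le> t} \<in> lmeasurable"
    unfolding eq by (intro fmeasurable.Diff) auto
  have "measure lebesgue (cball (0::real^'n) t - cball 0 s) = measure lebesgue (cball (0::real^'n) t) - measure lebesgue (cball (0::real^'n) s)"
    using assms by (intro measurable_measure_Diff) auto
  then show "measure lebesgue {x::real^'n. s < norm x \<and> norm x \<le> t} = unit_vol TYPE('n) * (t ^ CARD('n) - s ^ CARD('n))"
    unfolding eq using assms by (simp add: content_cball right_diff_distrib)
qed

lemma measure_annulus:
  assumes "0 \<le> s" "s < t"
  shows "(annulus s t :: (real^'n) set) \<in> lmeasurable"
    and "measure lebesgue (annulus s t :: (real^'n) set) = unit_vol TYPE('n) * (t ^ CARD('n) - s ^ CARD('n))"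
proof -
  have eq: "annulus s t = ball (0::real^'n) t - cball 0 s"
    by (auto simp: annulus_def)
  show "(annulus s t :: (real^'n) set) \<in> lmeasurable"
    unfolding eq by (intro fmeasurable.Diff) auto
  have "measure lebesgue (ball (0::real^'n) t - cball 0 s) = measure lebesgue (ball (0::real^'n) t) - measure lebesgue (cball (0::real^'n) s)"
    using assms by (intro measurable_measure_Diff) auto
  then show "measure lebesgue (annulus s t :: (real^'n) set) = unit_vol TYPE('n) * (t ^ CARD('n) - s ^ CARD('n))"
    unfolding eq using assms by (simp add: content_cball content_ball right_diff_distrib)
qed

lemma surface_measure_unit_sphere:
  "surface_measure (sphere (0::real^'n) 1) = real CARD('n) * unit_vol TYPE('n)"
proof -
  have "{t *\<^sub>R x | t x. 0 < t \<and> t \<le> 1 \<and> x \<in> sphere (0::real^'n) 1} = {x. 0 < norm x \<and> norm x \<le> 1}" (is "?L = ?R")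
  proof
    show "?R \<subseteq> ?L"
    proof
      fix x :: "real^'n" assume "x \<in> ?R"
      then have "x = norm x *\<^sub>R sgn x" "0 < norm x" "norm x \<le> 1" "norm (sgn x) = 1"
        by (auto simp: sgn_div_norm)
      then show "x \<in> ?L"
        by (metis (mono_tags, lifting) dist_0_norm mem_Collect_eq mem_sphere)
    qed
  qed auto
  then show ?thesis
    using measure_shell(2)[of 0 1, where 'n = 'n] by (simp add: surface_measure_def power_0_left)
qed

lemma power_diff_le:
  fixes s t b :: real
  assumes "0 \<le> s" "s \<le> t" "t \<le> b"
  shows "t ^ n - s ^ n \<le> real n * b ^ (n - 1) * (t - s)"
proof (cases n)
  case (Suc m)
  have "t ^ Suc m - s ^ Suc m = (t - s) * (\<Sum>i<Suc m. s ^ (m - i) * t ^ i)"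
    using power_diff_sumr2[of t "Suc m" s] by simp
  also have "\<dots> \<le> (t - s) * (\<Sum>i<Suc m. b ^ m)"
  proof (intro mult_left_mono sum_mono)
    fix i assume "i \<in> {..<Suc m}"
    then have "b ^ m = b ^ (m - i) * b ^ i"
      by (simp add: power_add[symmetric])
    then show "s ^ (m - i) * t ^ i \<le> b ^ m"
      using assms by (simp add: mult_mono power_mono)
  qed (use assms in simp)
  finally show ?thesis
    using Suc by (simp add: mult_ac)
qed simp

text \<open>As a function of the outer radius the integral has derivative \<open>n |B\<^sub>1| t\<^sup>n\<^sup>-\<^sup>1 f(t)\<close>: on a thin shell
  \<open>f\<close> is nearly constant and the volume of the shell is known.\<close>

lemma radial_integral_derivative:
  fixes f :: "real \<Rightarrow> real"
  assumes "0 < a" and cont: "continuous_on {a..b} f" and \<tau>: "\<tau> \<in> {a..b}"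
  shows "((\<lambda>t. LINT x:{x::real^'n. a < norm x \<and> norm x \<le> t}|lebesgue. f (norm x)) has_real_derivative
      real CARD('n) * unit_vol TYPE('n) * \<tau> ^ (CARD('n) - 1) * f \<tau>) (at \<tau> within {a..b})"
proof -
  let ?n = "CARD('n)"
  let ?V = "unit_vol TYPE('n)"
  define S where "S s t = {x::real^'n. s < norm x \<and> norm x \<le> t}" for s t
  define \<Psi> where "\<Psi> t = (LINT x:S a t|lebesgue. f (norm x))" for t
  have int: "set_integrable lebesgue (S s t) (\<lambda>x. f (norm x))" if "a \<le> s" "t \<le> b" for s t
  proof -
    have "bounded (f ` {a..b})"
      using cont by (intro compact_imp_bounded compact_continuous_image) auto
    then obtain C where C: "\<And>s. s \<in> {a..b} \<Longrightarrow> \<bar>f s\<bar> \<le> C"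
      unfolding bounded_iff by (metis imageI real_norm_def)
    have S: "S s t \<in> lmeasurable"
    proof (cases "s \<le> t")
      case True
      then show ?thesis
        unfolding S_def using that assms(1) by (intro measure_shell) auto
    next
      case False
      then have "S s t = {}" by (auto simp: S_def)
      then show ?thesis by simp
    qed
    have "set_integrable lebesgue (S s t) (\<lambda>x. f (norm x) * 1)"
    proof (rule set_integrable_mult_bounded_continuous)
      show "set_integrable lebesgue (S s t) (\<lambda>_. 1::real)"
        using S by (rule absolutely_integrable_on_const)
      show "continuous_on (S s t) (\<lambda>x. f (norm x))"
        using that by (intro continuous_on_compose2[OF cont]) (auto simp: S_def intro!: continuous_intros)
      show "S s t \<in> sets lebesgue"
        using S by (rule fmeasurableD)
      show "\<bar>f (norm x)\<bar> \<le> C" if "x \<in> S s t" for x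
        using that \<open>a \<le> s\<close> \<open>t \<le> b\<close> by (intro C) (auto simp: S_def)
    qed
    then show ?thesis by simp
  qed
  have shell: "\<bar>(\<Psi> t - \<Psi> s) - f \<tau> * (?V * (t ^ ?n - s ^ ?n))\<bar> \<le> e * (?V * (t ^ ?n - s ^ ?n))"
    if "a \<le> s" "s \<le> t" "t \<le> b" and e: "\<And>u. u \<in> {s..t} \<Longrightarrow> \<bar>f u - f \<tau>\<bar> \<le> e" for s t e
  proof -
    have "S a t = S a s \<union> S s t" "S a s \<inter> S s t = {}"
      using that by (auto simp: S_def)
    then have "\<Psi> t = \<Psi> s + (LINT x:S s t|lebesgue. f (norm x))"
      unfolding \<Psi>_def using that by (simp add: set_integral_Un int)
    moreover have m: "S s t \<in> lmeasurable" "measure lebesgue (S s t) = ?V * (t ^ ?n - s ^ ?n)"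
      unfolding S_def using measure_shell[of s t, where 'n = 'n] that assms(1) by auto
    have const: "set_integrable lebesgue (S s t) (\<lambda>_. k)" "(LINT x:S s t|lebesgue. k) = k * (?V * (t ^ ?n - s ^ ?n))" for k :: real
      using m by (auto intro: absolutely_integrable_on_const simp: set_lebesgue_integral_def fmeasurableD)
    have "\<bar>LINT x:S s t|lebesgue. f (norm x) - f \<tau>\<bar> \<le> (LINT x:S s t|lebesgue. e)"
      using e that by (intro set_integral_abs_le set_integral_diff int const) (auto simp: S_def)
    ultimately show ?thesis
      using that by (simp add: const int)
  qed
  have nonneg: "0 \<le> ?V"
    by simp
  define R where "R t = \<Psi> t - f \<tau> * (?V * t ^ ?n)" for t
  have "(R has_derivative (\<lambda>h. 0)) (at \<tau> within {a..b})"
    unfolding has_derivative_within_alt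
  proof (intro conjI allI impI bounded_linear_zero)
    fix e :: real assume "0 < e"
    define N where "N = ?V * (real ?n * b ^ (?n - 1)) + 1"
    have "0 \<le> b ^ (?n - 1)"
      using \<tau> assms(1) by (intro zero_le_power) auto
    then have N: "0 < N"
      using nonneg by (simp add: N_def add_nonneg_pos)
    obtain d where d: "0 < d" "\<And>u. u \<in> {a..b} \<Longrightarrow> dist u \<tau> < d \<Longrightarrow> dist (f u) (f \<tau>) < e / N"
      using cont \<tau> divide_pos_pos[OF \<open>0 < e\<close> N] unfolding continuous_on_iff by meson
    show "\<exists>d>0. \<forall>y\<in>{a..b}. norm (y - \<tau>) < d \<longrightarrow> norm (R y - R \<tau> - 0) \<le> e * norm (y - \<tau>)"
    proof (intro exI[of _ d] conjI ballI impI d(1))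
      fix y assume y: "y \<in> {a..b}" "norm (y - \<tau>) < d"
      have *: "\<bar>R t - R s\<bar> \<le> e * (t - s)" if st: "a \<le> s" "s \<le> t" "t \<le> b" "\<And>u. u \<in> {s..t} \<Longrightarrow> \<bar>f u - f \<tau>\<bar> \<le> e / N" for s t
      proof -
        have "\<bar>R t - R s\<bar> \<le> e / N * (?V * (t ^ ?n - s ^ ?n))"
          using shell[OF st] by (simp add: R_def algebra_simps)
        also have "\<dots> \<le> e / N * (?V * (real ?n * b ^ (?n - 1) * (t - s)))"
          using power_diff_le[of s t b ?n] st assms(1) nonneg \<open>0 < e\<close> N by (intro mult_left_mono) auto
        also have "\<dots> \<le> e / N * (N * (t - s))"
          using st \<open>0 < e\<close> N by (intro mult_left_mono) (auto simp: N_def algebra_simps)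
        finally show ?thesis
          using N by simp
      qed
      have close: "\<bar>f u - f \<tau>\<bar> \<le> e / N" if "u \<in> {min y \<tau>..max y \<tau>}" for u
        using d(2)[of u] that y \<tau> by (auto simp: dist_real_def min_def max_def split: if_splits)
      show "norm (R y - R \<tau> - 0) \<le> e * norm (y - \<tau>)"
      proof (cases "\<tau> \<le> y")
        case True
        then show ?thesis
          using *[of \<tau> y] close y \<tau> by (simp add: min_def max_def)
      next
        case False
        then show ?thesis
          using *[of y \<tau>] close y \<tau> by (simp add: min_def max_def abs_minus_commute)
      qed
    qed
  qed
  then have "(R has_real_derivative 0) (at \<tau> within {a..b})"
    by (simp add: has_field_derivative_def lambda_zero)
  then have "((\<lambda>t. R t + f \<tau> * (?V * t ^ ?n)) has_real_derivative
      (0 + f \<tau> * (?V * (real ?n * \<tau> ^ (?n - 1))))) (at \<tau> within {a..b})"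
    by (auto intro!: derivative_eq_intros)
  moreover have "(\<lambda>t. R t + f \<tau> * (?V * t ^ ?n)) = \<Psi>"
    by (simp add: R_def)
  ultimately show ?thesis
    unfolding \<Psi>_def S_def by (simp add: mult_ac)
qed

lemma radial_integral_derivative_profile:
  fixes q g :: "real \<Rightarrow> real"
  assumes "0 < a" "a \<le> b" "continuous_on {a..b} q"
    "\<And>s. s \<in> {a..b} \<Longrightarrow> (g has_real_derivative q s) (at s)"
  shows "(LINT x:{x::real^'n. a < norm x \<and> norm x \<le> b}|lebesgue. norm x powr (1 - real CARD('n)) * q (norm x))
    = real CARD('n) * unit_vol TYPE('n) * (g b - g a)"
proof -
  let ?c = "real CARD('n) * unit_vol TYPE('n)"
  define f where "f s = s powr (1 - real CARD('n)) * q s" for s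
  define \<Psi> where "\<Psi> t = (LINT x:{x::real^'n. a < norm x \<and> norm x \<le> t}|lebesgue. f (norm x))" for t
  have cont: "continuous_on {a..b} f"
    unfolding f_def using assms by (intro continuous_intros) auto
  have d: "(\<Psi> has_real_derivative ?c * q s) (at s within {a..b})" if s: "s \<in> {a..b}" for s
  proof -
    have "0 < s" using s assms(1) by auto
    then have "s ^ (CARD('n) - 1) = s powr (real CARD('n) - 1)"
      by (simp add: powr_realpow[symmetric] of_nat_diff Suc_leI)
    then have "s ^ (CARD('n) - 1) * s powr (1 - real CARD('n)) = 1"
      using \<open>0 < s\<close> by (simp add: powr_add[symmetric])
    then have "real CARD('n) * unit_vol TYPE('n) * s ^ (CARD('n) - 1) * f s = ?c * q s"
      by (simp add: f_def mult_ac)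
    moreover have "\<Psi> = (\<lambda>t. LINT x:{x::real^'n. a < norm x \<and> norm x \<le> t}|lebesgue. f (norm x))"
      by (simp add: \<Psi>_def fun_eq_iff)
    ultimately show ?thesis
      using radial_integral_derivative[OF assms(1) cont s, where 'n = 'n] by metis
  qed
  have "\<exists>k. \<forall>s\<in>{a..b}. \<Psi> s - ?c * g s = k"
  proof (rule has_derivative_zero_constant[OF convex_real_interval(5)])
    fix s assume s: "s \<in> {a..b}"
    have "((\<lambda>s. \<Psi> s - ?c * g s) has_real_derivative (?c * q s - ?c * q s)) (at s within {a..b})"
      by (intro DERIV_diff d[OF s] DERIV_cmult has_field_derivative_at_within[OF assms(4)[OF s]])
    then show "((\<lambda>s. \<Psi> s - ?c * g s) has_derivative (\<lambda>h. 0)) (at s within {a..b})"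
      by (simp add: has_field_derivative_def lambda_zero)
  qed
  then have "\<Psi> b - ?c * g b = \<Psi> a - ?c * g a"
    using assms(2) by auto
  moreover have "{x::real^'n. a < norm x \<and> norm x \<le> a} = {}"
    by auto
  then have "\<Psi> a = 0"
    by (simp add: \<Psi>_def set_lebesgue_integral_def)
  ultimately show ?thesis
    by (simp add: \<Psi>_def f_def right_diff_distrib)
qed

section \<open>Annular means control integrals\<close>

text \<open>For \<open>l > 0\<close> one has \<open>y \<le> l + l\<^sup>1\<^sup>-\<^sup>p y\<^sup>p\<close> (compare \<open>y\<close> with \<open>l\<close>).  Integrating this with \<open>l\<close> slightly above
  the \<open>p\<close>-mean takes the place of Jensen's inequality, at the cost of a factor \<open>2\<close>.\<close>

lemma Lp_on_annulus_L1:
  fixes w :: "real^'n \<Rightarrow> 'b::euclidean_space"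
  assumes "1 < p" "0 < r" and Lp: "Lp_on p (annulus r (2 * r)) w" and b: "M_p p w r \<le> b"
  shows "set_integrable lebesgue (annulus r (2 * r)) (\<lambda>x. norm (w x))"
    and "(LINT x:annulus r (2 * r)|lebesgue. norm (w x)) \<le> 2 * b * measure lebesgue (annulus r (2 * r) :: (real^'n) set)"
proof -
  let ?A = "annulus r (2 * r) :: (real^'n) set"
  define \<mu> where "\<mu> = measure lebesgue ?A"
  define T where "T = (LINT x:?A|lebesgue. norm (w x) powr p)"
  have \<mu>: "0 < \<mu>"
    unfolding \<mu>_def using assms(2) measure_annulus(2)[of r "2 * r", where 'n = 'n]
    by (simp add: power_strict_mono)
  have A: "?A \<in> lmeasurable"
    using assms(2) by (intro measure_annulus) auto
  have T: "0 \<le> T"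
    unfolding T_def set_lebesgue_integral_def by (intro integral_nonneg_AE) auto
  have intp: "set_integrable lebesgue ?A (\<lambda>x. norm (w x) powr p)"
    using Lp by (simp add: Lp_on_def)
  have M: "M_p p w r = (T / \<mu>) powr (1 / p)"
    by (simp add: M_p_def T_def \<mu>_def)
  have "0 \<le> b"
    using b M by (metis order_trans powr_ge_zero)
  have const: "set_integrable lebesgue ?A (\<lambda>_. k)" "(LINT x:?A|lebesgue. k) = k * \<mu>" for k :: real
    using A by (auto intro: absolutely_integrable_on_const simp: set_lebesgue_integral_def \<mu>_def fmeasurableD)
  have young: "y \<le> l + l powr (1 - p) * y powr p" if "0 < l" "0 \<le> y" for l y :: real
  proof (cases "y \<le> l")
    case True
    have "0 \<le> l powr (1 - p) * y powr p"
      by simp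
    then show ?thesis
      using True by linarith
  next
    case False
    then have "1 \<le> (y / l) powr (p - 1)"
      using that assms(1) by (intro ge_one_powr_ge_zero) auto
    then have "y * 1 \<le> y * (y / l) powr (p - 1)"
      using that by (intro mult_left_mono) auto
    also have "\<dots> = l powr (1 - p) * y powr p"
      using that False by (simp add: powr_divide powr_diff field_simps)
    finally show ?thesis
      using that by simp
  qed
  have meas: "(\<lambda>x. norm (w x)) \<in> borel_measurable (lebesgue_on ?A)"
    using Lp by (auto simp: Lp_on_def)
  have int: "set_integrable lebesgue ?A (\<lambda>x. l + l powr (1 - p) * norm (w x) powr p)" for l
    using const intp by (intro set_integral_add) auto
  show L1: "set_integrable lebesgue ?A (\<lambda>x. norm (w x))"
  proof (rule set_integrable_bound[OF int[of 1]])
    show "set_borel_measurable lebesgue ?A (\<lambda>x. norm (w x))"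
      using meas borel_measurable_if_I[OF meas]
      by (simp add: set_borel_measurable_def borel_measurable_restrict_space_iff)
    show "AE x in lebesgue. x \<in> ?A \<longrightarrow> norm (norm (w x)) \<le> norm (1 + 1 powr (1 - p) * norm (w x) powr p)"
      using young[of 1] by (auto intro: order_trans[OF _ abs_ge_self])
  qed
  have bound: "(LINT x:?A|lebesgue. norm (w x)) \<le> 2 * l * \<mu>" if l: "b < l" for l
  proof -
    have l0: "0 < l"
      using l \<open>0 \<le> b\<close> by simp
    have "(T / \<mu>) = ((T / \<mu>) powr (1 / p)) powr p"
      using T \<mu> assms(1) by (simp add: powr_powr)
    also have "\<dots> \<le> l powr p"
      using M b l assms(1) by (intro powr_mono2) auto
    finally have "T \<le> l powr p * \<mu>"
      using \<mu> by (simp add: field_simps)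
    have "(LINT x:?A|lebesgue. norm (w x)) \<le> (LINT x:?A|lebesgue. l + l powr (1 - p) * norm (w x) powr p)"
      using L1 int young[OF l0] by (intro set_integral_mono) auto
    also have "\<dots> = l * \<mu> + l powr (1 - p) * T"
      using const[of l] intp by (subst set_integral_add) (auto simp: T_def)
    also have "\<dots> \<le> l * \<mu> + l powr (1 - p) * (l powr p * \<mu>)"
      using \<open>T \<le> l powr p * \<mu>\<close> by (intro add_left_mono mult_left_mono) auto
    also have "\<dots> = 2 * l * \<mu>"
      using l0 by (simp add: powr_diff)
    finally show ?thesis .
  qed
  show "(LINT x:?A|lebesgue. norm (w x)) \<le> 2 * b * measure lebesgue ?A"
  proof (rule field_le_epsilon)
    fix e :: real assume "0 < e"
    then have "(LINT x:?A|lebesgue. norm (w x)) \<le> 2 * (b + e / (2 * \<mu>)) * \<mu>"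
      using \<mu> by (intro bound) simp
    also have "\<dots> = 2 * b * \<mu> + e"
      using \<mu> by (simp add: distrib_right distrib_left)
    finally show "(LINT x:?A|lebesgue. norm (w x)) \<le> 2 * b * measure lebesgue ?A + e"
      by (simp add: \<mu>_def)
  qed
qed

lemma twice_weakly_diff_weak_derivatives:
  assumes "twice_weakly_diff \<Omega> f"
  shows "has_weak_pderiv \<Omega> i f (\<lambda>x. weak_grad \<Omega> f x $ i)"
    and "has_weak_pderiv \<Omega> j (\<lambda>x. weak_grad \<Omega> f x $ i) (\<lambda>x. weak_hess \<Omega> f x $ j $ i)"
  using assms unfolding twice_weakly_diff_def weak_grad_def weak_hess_def
  by (simp_all add: weak_pderiv_def[of \<Omega> i f] weak_pderiv_def[of \<Omega> j "weak_pderiv _ _ _"] someI_ex)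
    (metis someI_ex weak_pderiv_def)+

lemma M_2p_L1:
  fixes w :: "real^'n \<Rightarrow> real"
  assumes "1 < p" "0 < r" "W2p p (annulus r (2 * r)) w" "M_2p p w r \<le> b"
  defines "A \<equiv> annulus r (2 * r)"
  shows "set_integrable lebesgue A (\<lambda>x. \<bar>w x\<bar>)"
    "set_integrable lebesgue A (\<lambda>x. norm (weak_grad A w x))"
    "set_integrable lebesgue A (\<lambda>x. norm (weak_hess A w x))"
    "(LINT x:A|lebesgue. \<bar>w x\<bar>) \<le> 2 * b * measure lebesgue A"
    "(LINT x:A|lebesgue. norm (weak_grad A w x)) \<le> 2 * (b / r) * measure lebesgue A"
    "(LINT x:A|lebesgue. norm (weak_hess A w x)) \<le> 2 * (b / r\<^sup>2) * measure lebesgue A"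
proof -
  have nonneg: "0 \<le> M_p p u r" for u :: "real^'n \<Rightarrow> 'c::euclidean_space"
    by (simp add: M_p_def)
  have "r\<^sup>2 * M_p p (weak_hess A w) r + r * M_p p (weak_grad A w) r + M_p p w r \<le> b"
    using assms(4) by (simp add: M_2p_def A_def)
  moreover have "0 \<le> r\<^sup>2 * M_p p (weak_hess A w) r" "0 \<le> r * M_p p (weak_grad A w) r" "0 \<le> M_p p w r"
    using nonneg[of "weak_hess A w"] nonneg[of "weak_grad A w"] nonneg[of w] assms(2) by auto
  ultimately have "M_p p w r \<le> b" "r * M_p p (weak_grad A w) r \<le> b" "r\<^sup>2 * M_p p (weak_hess A w) r \<le> b"
    by linarith+
  then have b: "M_p p w r \<le> b" "M_p p (weak_grad A w) r \<le> b / r" "M_p p (weak_hess A w) r \<le> b / r\<^sup>2"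
    using assms(2) by (auto simp: field_simps)
  show "set_integrable lebesgue A (\<lambda>x. \<bar>w x\<bar>)"
    "set_integrable lebesgue A (\<lambda>x. norm (weak_grad A w x))"
    "set_integrable lebesgue A (\<lambda>x. norm (weak_hess A w x))"
    "(LINT x:A|lebesgue. \<bar>w x\<bar>) \<le> 2 * b * measure lebesgue A"
    "(LINT x:A|lebesgue. norm (weak_grad A w x)) \<le> 2 * (b / r) * measure lebesgue A"
    "(LINT x:A|lebesgue. norm (weak_hess A w x)) \<le> 2 * (b / r\<^sup>2) * measure lebesgue A"
    using assms(3) Lp_on_annulus_L1[OF assms(1,2) _ b(1)] Lp_on_annulus_L1[OF assms(1,2) _ b(2)]
      Lp_on_annulus_L1[OF assms(1,2) _ b(3)]
    unfolding A_def by (simp_all add: W2p_def)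
qed

section \<open>Radial cut-off functions\<close>

lemma has_real_derivative_truncated_power:
  "((\<lambda>t::real. max 0 t ^ Suc (Suc k)) has_real_derivative real (Suc (Suc k)) * max 0 t ^ Suc k) (at t)"
proof -
  consider "0 < t" | "t < 0" | "t = 0"
    by linarith
  then show ?thesis
  proof cases
    case 1
    have "((\<lambda>t. t ^ Suc (Suc k)) has_real_derivative real (Suc (Suc k)) * max 0 t ^ Suc k) (at t)"
      using 1 DERIV_pow[of "Suc (Suc k)" t] by simp
    then show ?thesis
      by (rule has_field_derivative_transform_within_open[of _ _ _ "{0<..}"]) (use 1 in auto)
  next
    case 2
    have "((\<lambda>t. 0) has_real_derivative real (Suc (Suc k)) * max 0 t ^ Suc k) (at t)"
      using 2 by simp
    then show ?thesis
      by (rule has_field_derivative_transform_within_open[of _ _ _ "{..<0}"]) (use 2 in auto)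
  next
    case 3
    have "((\<lambda>h::real. max 0 h ^ Suc k) \<longlongrightarrow> max 0 0 ^ Suc k) (at 0)"
      by (intro tendsto_intros)
    moreover have "((\<lambda>h::real. max 0 h ^ Suc k) \<longlongrightarrow> 0) (at 0) \<longleftrightarrow> ((\<lambda>h::real. max 0 h ^ Suc (Suc k) / h) \<longlongrightarrow> 0) (at 0)"
      by (rule LIM_equal) (auto simp: max_def)
    ultimately have "((\<lambda>h::real. max 0 h ^ Suc (Suc k) / h) \<longlongrightarrow> 0) (at 0)"
      by simp
    then show ?thesis
      using 3 by (simp add: DERIV_def)
  qed
qed

text \<open>The integrated quadratic B-spline: twice continuously differentiable, \<open>0\<close> up to \<open>0\<close> and \<open>1\<close>
  from \<open>3\<close> on.\<close>

definition spline_step :: "real \<Rightarrow> real" where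
  "spline_step t = (max 0 t ^ 3 - 3 * max 0 (t - 1) ^ 3 + 3 * max 0 (t - 2) ^ 3 - max 0 (t - 3) ^ 3) / 6"

definition spline_step' :: "real \<Rightarrow> real" where
  "spline_step' t = ((max 0 t)\<^sup>2 - 3 * (max 0 (t - 1))\<^sup>2 + 3 * (max 0 (t - 2))\<^sup>2 - (max 0 (t - 3))\<^sup>2) / 2"

definition spline_step'' :: "real \<Rightarrow> real" where
  "spline_step'' t = max 0 t - 3 * max 0 (t - 1) + 3 * max 0 (t - 2) - max 0 (t - 3)"

lemma DERIV_spline_step:
  "(spline_step has_real_derivative spline_step' t) (at t)"
  "(spline_step' has_real_derivative spline_step'' t) (at t)"
proof -
  have 3: "((\<lambda>t. max 0 (t - c) ^ 3) has_real_derivative 3 * (max 0 (t - c))\<^sup>2) (at t)" for c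
    using has_real_derivative_truncated_power[of 1 "t + - c"] DERIV_shift[of "\<lambda>t. max 0 t ^ 3" _ t "- c"]
    by (simp add: numeral_eq_Suc)
  have 2: "((\<lambda>t. (max 0 (t - c))\<^sup>2) has_real_derivative 2 * max 0 (t - c)) (at t)" for c
    using has_real_derivative_truncated_power[of 0 "t + - c"] DERIV_shift[of "\<lambda>t. (max 0 t)\<^sup>2" _ t "- c"]
    by (simp add: numeral_eq_Suc)
  note c3 = 3[of 0, simplified] 3[of 1] 3[of 2] 3[of 3]
  note c2 = 2[of 0, simplified] 2[of 1] 2[of 2] 2[of 3]
  have "(spline_step has_real_derivative (3 * (max 0 t)\<^sup>2 - 3 * (3 * (max 0 (t - 1))\<^sup>2)
      + 3 * (3 * (max 0 (t - 2))\<^sup>2) - 3 * (max 0 (t - 3))\<^sup>2) / 6) (at t)"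
    unfolding spline_step_def [abs_def] by (intro DERIV_cdivide DERIV_diff DERIV_add DERIV_cmult c3)
  then show "(spline_step has_real_derivative spline_step' t) (at t)"
    by (rule DERIV_cong) (simp add: spline_step'_def)
  have "(spline_step' has_real_derivative (2 * max 0 t - 3 * (2 * max 0 (t - 1))
      + 3 * (2 * max 0 (t - 2)) - 2 * max 0 (t - 3)) / 2) (at t)"
    unfolding spline_step'_def [abs_def] by (intro DERIV_cdivide DERIV_diff DERIV_add DERIV_cmult c2)
  then show "(spline_step' has_real_derivative spline_step'' t) (at t)"
    by (rule DERIV_cong) (simp add: spline_step''_def)
qed

lemma spline_step_values:
  "t \<le> 0 \<Longrightarrow> spline_step t = 0" "3 \<le> t \<Longrightarrow> spline_step t = 1"
  "t \<le> 0 \<Longrightarrow> spline_step' t = 0" "3 \<le> t \<Longrightarrow> spline_step' t = 0"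
  by (simp_all add: spline_step_def spline_step'_def max_def power2_eq_square power3_eq_cube algebra_simps)

lemma spline_step_bounds: "\<bar>spline_step t\<bar> \<le> 36" "\<bar>spline_step' t\<bar> \<le> 36"
proof -
  consider "t \<le> 0" | "3 \<le> t" | "0 < t" "t < 3"
    by linarith
  then have "\<bar>spline_step t\<bar> \<le> 36 \<and> \<bar>spline_step' t\<bar> \<le> 36"
  proof cases
    case 3
    have "0 \<le> max 0 (t - c) ^ k \<and> max 0 (t - c) ^ k \<le> 3 ^ k" if "0 \<le> c" for c k
      using 3 that by (auto intro!: power_mono)
    note b = this
    have m: "0 \<le> max 0 t ^ k \<and> max 0 t ^ k \<le> 3 ^ k" "0 \<le> max 0 (t - 1) ^ k \<and> max 0 (t - 1) ^ k \<le> 3 ^ k"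
      "0 \<le> max 0 (t - 2) ^ k \<and> max 0 (t - 2) ^ k \<le> 3 ^ k" "0 \<le> max 0 (t - 3) ^ k \<and> max 0 (t - 3) ^ k \<le> 3 ^ k" for k
      using b[of 0 k] b[of 1 k] b[of 2 k] b[of 3 k] by simp_all
    have combination: "\<bar>A - 3 * B + 3 * C - D\<bar> \<le> 4 * M"
      if "0 \<le> A \<and> A \<le> M" "0 \<le> B \<and> B \<le> M" "0 \<le> C \<and> C \<le> M" "0 \<le> D \<and> D \<le> M" for A B C D M :: real
      using that by (intro abs_leI) linarith+
    show ?thesis
      using combination[OF m(1)[of 3] m(2)[of 3] m(3)[of 3] m(4)[of 3]]
        combination[OF m(1)[of 2] m(2)[of 2] m(3)[of 2] m(4)[of 2]]
      unfolding spline_step_def spline_step'_def abs_divide by simp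
  qed (auto simp: spline_step_values)
  then show "\<bar>spline_step t\<bar> \<le> 36" "\<bar>spline_step' t\<bar> \<le> 36"
    by auto
qed

text \<open>The transition from \<open>0\<close> to \<open>1\<close> takes place for \<open>r + a \<le> |x| \<le> r + 4a\<close>.  It keeps the distance \<open>a\<close> from the
  sphere \<open>|x| = r\<close>, so that the gradient has compact support in the open annulus for every \<open>a\<close>.\<close>

definition cutoff :: "real \<Rightarrow> real \<Rightarrow> real^'n \<Rightarrow> real" where
  "cutoff r a x = spline_step ((norm x - r - a) / a)"

definition cutoff_slope :: "real \<Rightarrow> real \<Rightarrow> real^'n \<Rightarrow> real" where
  "cutoff_slope r a x = spline_step' ((norm x - r - a) / a) / a"

lemma cutoff_values:
  assumes "0 < a"
  shows "norm x \<le> r + a \<Longrightarrow> cutoff r a x = 0" "r + 4 * a \<le> norm x \<Longrightarrow> cutoff r a x = 1"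
    "norm x \<le> r + a \<Longrightarrow> cutoff_slope r a x = 0" "r + 4 * a \<le> norm x \<Longrightarrow> cutoff_slope r a x = 0"
    "\<bar>cutoff r a x\<bar> \<le> 36" "\<bar>cutoff_slope r a x\<bar> \<le> 36 / a"
proof -
  have 1: "(norm x - r - a) / a \<le> 0" if "norm x \<le> r + a"
    using that assms by (simp add: divide_le_0_iff)
  have 2: "3 \<le> (norm x - r - a) / a" if "r + 4 * a \<le> norm x"
    using that assms by (simp add: pos_le_divide_eq)
  show "norm x \<le> r + a \<Longrightarrow> cutoff r a x = 0" "r + 4 * a \<le> norm x \<Longrightarrow> cutoff r a x = 1"
    "norm x \<le> r + a \<Longrightarrow> cutoff_slope r a x = 0" "r + 4 * a \<le> norm x \<Longrightarrow> cutoff_slope r a x = 0"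
    using spline_step_values 1 2 by (simp_all add: cutoff_def cutoff_slope_def)
  show "\<bar>cutoff r a x\<bar> \<le> 36" "\<bar>cutoff_slope r a x\<bar> \<le> 36 / a"
    using spline_step_bounds assms by (simp_all add: cutoff_def cutoff_slope_def divide_right_mono)
qed

lemma DERIV_cutoff_profile:
  assumes "0 < a"
  shows "((\<lambda>s. spline_step ((s - r - a) / a)) has_real_derivative spline_step' ((s - r - a) / a) / a) (at s)"
    "((\<lambda>s. spline_step' ((s - r - a) / a) / a) has_real_derivative spline_step'' ((s - r - a) / a) / a / a) (at s)"
proof -
  have inner: "((\<lambda>s. (s - r - a) / a) has_real_derivative 1 / a) (at s)"
    using assms by (auto intro!: derivative_eq_intros)
  show "((\<lambda>s. spline_step ((s - r - a) / a)) has_real_derivative spline_step' ((s - r - a) / a) / a) (at s)"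
    using DERIV_chain2[OF DERIV_spline_step(1) inner] by simp
  show "((\<lambda>s. spline_step' ((s - r - a) / a) / a) has_real_derivative spline_step'' ((s - r - a) / a) / a / a) (at s)"
    using DERIV_cdivide[OF DERIV_chain2[OF DERIV_spline_step(2) inner]] by simp
qed

lemma continuous_on_spline_derivatives:
  "continuous_on S spline_step'" "continuous_on S spline_step''"
proof -
  show "continuous_on S spline_step'"
    using DERIV_spline_step(2) by (meson DERIV_isCont continuous_at_imp_continuous_on)
  show "continuous_on S spline_step''"
    unfolding spline_step''_def [abs_def] by (intro continuous_intros)
qed

lemma C1_grad_cutoff:
  assumes "0 < a" "0 < r"
  shows "C1_grad UNIV (cutoff r a) (\<lambda>x::real^'n. cutoff_slope r a x *\<^sub>R sgn x)"
proof -
  have 1: "C1_grad (- {0}) (cutoff r a) (\<lambda>x::real^'n. cutoff_slope r a x *\<^sub>R sgn x)"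
    unfolding cutoff_def [abs_def] cutoff_slope_def using assms
    by (intro C1_grad_radial DERIV_cutoff_profile continuous_intros
        continuous_on_compose2[OF continuous_on_spline_derivatives(1)[of UNIV]]) auto
  have 2: "C1_grad (ball 0 (r + a)) (cutoff r a) (\<lambda>x::real^'n. cutoff_slope r a x *\<^sub>R sgn x)"
    by (rule C1_grad_cong[OF C1_grad_const[of _ 0]]) (use assms in \<open>auto simp: cutoff_values\<close>)
  have "- {0} \<union> ball 0 (r + a) = (UNIV :: (real^'n) set)"
    using assms by auto
  then show ?thesis
    using C1_grad_Un[OF 1 2] by auto
qed

lemma compact_closed_shell: "compact {x::real^'n. s \<le> norm x \<and> norm x \<le> t}"
proof -
  have "{x::real^'n. s \<le> norm x \<and> norm x \<le> t} = cball 0 t - ball 0 s"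
    by auto
  then show ?thesis
    by (simp add: compact_diff)
qed

text \<open>A function may be tested with the gradient of a cut-off only if that gradient is continuously differentiable,
  hence the second derivative of the spline.\<close>

lemma C1_compact_cutoff_gradient:
  assumes "0 < a" "0 < r" "a \<le> r / 8"
  shows "C1_compact (annulus r (2 * r)) (\<lambda>x::real^'n. cutoff_slope r a x * sgn x $ i)"
proof -
  let ?A = "annulus r (2 * r) :: (real^'n) set"
  define f where "f s = spline_step' ((s - r - a) / a) / a * inverse s" for s
  define f' where "f' s = spline_step'' ((s - r - a) / a) / a / a * inverse s
      + - (inverse s ^ Suc (Suc 0)) * (spline_step' ((s - r - a) / a) / a)" for s
  have "(f has_real_derivative f' s) (at s)" if "s \<noteq> 0" for s
    unfolding f_def [abs_def] f'_def
    by (intro DERIV_mult DERIV_cutoff_profile(2) assms(1) DERIV_inverse that)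
  moreover have "continuous_on (norm ` ?A) f'"
    unfolding f'_def using assms by (intro continuous_intros
        continuous_on_compose2[OF continuous_on_spline_derivatives(1)[of UNIV]]
        continuous_on_compose2[OF continuous_on_spline_derivatives(2)[of UNIV]]) (auto simp: annulus_def)
  moreover have "norm x \<noteq> 0" if "x \<in> ?A" for x
    using that assms(2) by (auto simp: annulus_def)
  ultimately have "C1_grad ?A (\<lambda>x. f (norm x)) (\<lambda>x. f' (norm x) *\<^sub>R sgn x)"
  proof (intro C1_grad_radial)
    show "0 \<notin> ?A"
      using assms(2) by (simp add: annulus_def)
  qed auto
  from C1_grad_mult[OF this C1_grad_component[of _ i]]
  obtain U where "C1_grad ?A (\<lambda>x. f (norm x) * x $ i) U"
    by blast
  moreover have "(\<lambda>x::real^'n. f (norm x) * x $ i) = (\<lambda>x. cutoff_slope r a x * sgn x $ i)"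
    by (auto simp: f_def cutoff_slope_def sgn_div_norm)
  ultimately have "C1_grad ?A (\<lambda>x. cutoff_slope r a x * sgn x $ i) U"
    by simp
  then show ?thesis
    using assms cutoff_values(3,4)[OF assms(1) less_imp_le]
    by (intro C1_compactI_local[OF open_annulus _ compact_closed_shell[of "r + a" "r + 4 * a"]])
      (auto simp: annulus_def not_le)
qed

lemma C1_compact_cutoff_diff:
  assumes "0 < a" "0 < b" "a \<le> r / 8" "b \<le> r / 8" "0 < r"
  shows "C1_compact (annulus r (2 * r)) (\<lambda>x::real^'n. cutoff r a x - cutoff r b x)"
proof (rule C1_compactI)
  show "C1_grad UNIV (\<lambda>x::real^'n. cutoff r a x - cutoff r b x)
      (\<lambda>x. cutoff_slope r a x *\<^sub>R sgn x - cutoff_slope r b x *\<^sub>R sgn x)"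
    using assms by (intro C1_grad_diff C1_grad_cutoff)
  show "compact {x::real^'n. r + min a b \<le> norm x \<and> norm x \<le> r + r / 2}"
    by (rule compact_closed_shell)
  show "{x::real^'n. r + min a b \<le> norm x \<and> norm x \<le> r + r / 2} \<subseteq> annulus r (2 * r)"
    using assms by (auto simp: annulus_def)
  show "cutoff r a x - cutoff r b x = 0" if "x \<notin> {x. r + min a b \<le> norm x \<and> norm x \<le> r + r / 2}" for x :: "real^'n"
  proof -
    have "norm x \<le> r + min a b \<or> r + r / 2 \<le> norm x"
      using that by auto
    then show ?thesis
    proof
      assume "norm x \<le> r + min a b"
      then show ?thesis
        using assms cutoff_values(1)[of a x r] cutoff_values(1)[of b x r] by simp
    next
      assume "r + r / 2 \<le> norm x"
      then show ?thesis
        using assms cutoff_values(2)[of a r x] cutoff_values(2)[of b r x] by simp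
    qed
  qed
qed

lemma C1_compact_times_cutoff:
  assumes "C1_compact (ball 0 \<epsilon>) \<phi>" "0 < a" "0 < r"
  shows "C1_compact (ball 0 \<epsilon> - {0}) (\<lambda>x::real^'n. \<phi> x * cutoff r a x)"
    and "partial_deriv i (\<lambda>x::real^'n. \<phi> x * cutoff r a x) x
      = cutoff r a x * partial_deriv i \<phi> x + \<phi> x * (cutoff_slope r a x * sgn x $ i)"
proof -
  obtain K G P where K: "compact K" "K \<subseteq> ball 0 \<epsilon>" "C1_grad UNIV \<phi> G"
    "\<And>i x. partial_deriv i \<phi> x = G x $ i"
    "\<And>x. x \<notin> K \<Longrightarrow> \<phi> x = 0" "\<And>x. x \<notin> K \<Longrightarrow> G x = 0"
    by (rule C1_compactE[OF assms(1)]) blast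
  note prod = C1_grad_mult[OF K(3) C1_grad_cutoff[OF assms(2,3)]]
  show "C1_compact (ball 0 \<epsilon> - {0}) (\<lambda>x. \<phi> x * cutoff r a x)"
  proof (rule C1_compactI[OF prod])
    show "compact (K - ball 0 (r + a))"
      using K(1) by (simp add: compact_diff)
    show "K - ball 0 (r + a) \<subseteq> ball 0 \<epsilon> - {0}"
      using K(2) assms by auto
    show "\<phi> x * cutoff r a x = 0" if "x \<notin> K - ball 0 (r + a)" for x
      using that K(5)[of x] cutoff_values(1)[OF assms(2), of x r] by (cases "x \<in> K") auto
  qed
  show "partial_deriv i (\<lambda>x::real^'n. \<phi> x * cutoff r a x) x
      = cutoff r a x * partial_deriv i \<phi> x + \<phi> x * (cutoff_slope r a x * sgn x $ i)"
    using C1_grad_partial_deriv[OF prod, of x i] by (simp add: K(4))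
qed

text \<open>This is where the area of the unit sphere enters: the weight \<open>|x|\<^sup>1\<^sup>-\<^sup>n\<close> cancels the growth of the spheres, and
  the profile of the cut-off rises by \<open>1\<close>.\<close>

lemma integral_cutoff_slope:
  assumes "0 < r"
  shows "(LINT x:annulus r (2 * r)|lebesgue. norm x powr (1 - real CARD('n)) * cutoff_slope r (r / 8) (x::real^'n))
    = surface_measure (sphere (0::real^'n) 1)"
    and "set_integrable lebesgue (annulus r (2 * r)) (\<lambda>x::real^'n. norm x powr (1 - real CARD('n)) * cutoff_slope r (r / 8) x)"
proof -
  let ?a = "r / 8"
  define F where "F x = norm x powr (1 - real CARD('n)) * cutoff_slope r ?a x" for x :: "real^'n"
  define B where "B = {x::real^'n. r < norm x \<and> norm x \<le> r + 4 * ?a}"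
  have a: "0 < ?a" using assms by simp
  have sub: "B \<subseteq> annulus r (2 * r)"
    using assms by (auto simp: B_def annulus_def)
  have zero: "F x = 0" if "x \<in> annulus r (2 * r)" "x \<notin> B" for x
    using that cutoff_values(4)[OF a, of r x] by (auto simp: F_def B_def annulus_def)
  have "(LINT x:B|lebesgue. F x) = real CARD('n) * unit_vol TYPE('n) *
      (spline_step ((r + 4 * ?a - r - ?a) / ?a) - spline_step ((r - r - ?a) / ?a))"
    unfolding B_def F_def cutoff_slope_def using assms a
    by (intro radial_integral_derivative_profile DERIV_cutoff_profile(1) continuous_intros
        continuous_on_compose2[OF continuous_on_spline_derivatives(1)[of UNIV]]) auto
  also have "\<dots> = surface_measure (sphere (0::real^'n) 1)"
    using assms by (simp add: spline_step_values surface_measure_unit_sphere)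
  finally show "(LINT x:annulus r (2 * r)|lebesgue. F x) = surface_measure (sphere (0::real^'n) 1)"
    using set_integral_superset(1)[OF sub zero] by simp
  have "continuous_on (annulus r (2 * r)) F"
    unfolding F_def cutoff_slope_def using assms
    by (intro continuous_intros continuous_on_compose2[OF continuous_on_spline_derivatives(1)[of UNIV]])
      (auto simp: annulus_def)
  moreover have "\<bar>F x\<bar> \<le> r powr (1 - real CARD('n)) * (36 / ?a)" if "x \<in> annulus r (2 * r)" for x
    using that assms cutoff_values(6)[OF a, of r x] unfolding F_def abs_mult
    by (intro mult_mono) (auto simp: annulus_def intro!: powr_mono2' Suc_leI)
  moreover have "set_integrable lebesgue (annulus r (2 * r)) (\<lambda>x::real^'n. 1::real)"
    using assms by (intro absolutely_integrable_on_const measure_annulus) auto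
  ultimately show "set_integrable lebesgue (annulus r (2 * r)) F"
    using set_integrable_mult_bounded_continuous[of "annulus r (2 * r)" "\<lambda>_. 1" F
        "r powr (1 - real CARD('n)) * (36 / ?a)"] by simp
qed

section \<open>The exponent and the radial profile of the fundamental solution\<close>

locale perturbed_Laplacian =
  fixes A :: "real^'n \<Rightarrow> real^'n^'n" and \<omega> :: "real \<Rightarrow> real" and \<epsilon> :: real
  assumes bounded_A: "bounded (A ` ball 0 1)"
    and measurable_A: "A \<in> borel_measurable (lebesgue_on (ball 0 1))"
    and oscillation: "\<And>r. 0 < r \<Longrightarrow> r < 1 \<Longrightarrow>
           (SUP x\<in>sphere 0 r. onorm (\<lambda>y. (A x - mat 1) *v y)) \<le> \<omega> r"
    and mono_\<omega>: "mono_on {0..<1} \<omega>"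
    and eps: "0 < \<epsilon>" "\<epsilon> < 1"
begin

abbreviation I :: "real \<Rightarrow> real" where "I \<equiv> I_of A \<epsilon>"

definition exponent_density :: "real^'n \<Rightarrow> real" where
  "exponent_density z = (trace (A z) - real CARD('n) * (((A z *v z) \<bullet> z) / (norm z)\<^sup>2)) / norm z ^ CARD('n)"

lemma onorm_deviation_le:
  assumes "z \<noteq> 0" "norm z < 1"
  shows "onorm (\<lambda>y. (A z - mat 1) *v y) \<le> \<omega> (norm z)"
proof -
  obtain C where C: "\<And>x. x \<in> ball 0 1 \<Longrightarrow> norm (A x) \<le> C"
    using bounded_A unfolding bounded_iff by blast
  have "onorm ((*v) (A x - mat 1)) \<le> real CARD('n) * real CARD('n) * (C + norm (mat 1 :: real^'n^'n))"
    if "x \<in> ball 0 1" for x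
  proof (rule onorm_le_matrix_component)
    fix i j
    have "\<bar>(A x - mat 1) $ i $ j\<bar> \<le> norm ((A x - mat 1) $ i)"
      by (rule component_le_norm_cart)
    also have "\<dots> \<le> norm (A x - mat 1)"
      by (rule Finite_Cartesian_Product.norm_nth_le)
    also have "\<dots> \<le> norm (A x) + norm (mat 1 :: real^'n^'n)"
      by (rule norm_triangle_ineq4)
    finally show "\<bar>(A x - mat 1) $ i $ j\<bar> \<le> C + norm (mat 1 :: real^'n^'n)"
      using C[OF that] by simp
  qed
  then have "bdd_above ((\<lambda>x. onorm (\<lambda>y. (A x - mat 1) *v y)) ` sphere 0 (norm z))"
    using assms
    by (intro bdd_aboveI2[where M = "real CARD('n) * real CARD('n) * (C + norm (mat 1 :: real^'n^'n))"]) auto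
  then have "onorm (\<lambda>y. (A z - mat 1) *v y) \<le> (SUP x\<in>sphere 0 (norm z). onorm (\<lambda>y. (A x - mat 1) *v y))"
    by (intro cSUP_upper) auto
  also have "\<dots> \<le> \<omega> (norm z)"
    using assms by (intro oscillation) auto
  finally show ?thesis .
qed

lemma \<omega>_nonneg:
  assumes "0 < r" "r < 1"
  shows "0 \<le> \<omega> r"
proof -
  have "0 \<le> onorm (\<lambda>y. (A (r *\<^sub>R axis undefined 1) - mat 1) *v y)"
    by (rule onorm_pos_le) simp
  also have "\<dots> \<le> \<omega> (norm (r *\<^sub>R axis undefined 1 :: real^'n))"
    using assms by (intro onorm_deviation_le) (auto simp: axis_eq_0_iff)
  finally show ?thesis
    using assms by simp
qed

text \<open>The identity matrix contributes nothing to the density of the exponent, so only the deviation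
  from it counts.\<close>

lemma exponent_density_bound:
  assumes "z \<noteq> 0" "norm z < 1"
  shows "\<bar>exponent_density z\<bar> \<le> 2 * real CARD('n) * \<omega> (norm z) / norm z ^ CARD('n)"
proof -
  define B where "B = A z - mat 1"
  let ?n = "real CARD('n)"
  have on: "onorm ((*v) B) \<le> \<omega> (norm z)"
    using onorm_deviation_le[OF assms] by (simp add: B_def)
  have Bv: "\<bar>(B *v y) \<bullet> y\<bar> \<le> \<omega> (norm z) * (norm y)\<^sup>2" for y
  proof -
    have "\<bar>(B *v y) \<bullet> y\<bar> \<le> norm (B *v y) * norm y"
      by (rule Cauchy_Schwarz_ineq2)
    also have "\<dots> \<le> (onorm ((*v) B) * norm y) * norm y"
      by (intro mult_right_mono onorm) auto
    also have "\<dots> \<le> (\<omega> (norm z) * norm y) * norm y"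
      using on by (intro mult_right_mono) auto
    finally show ?thesis
      by (simp add: power2_eq_square mult.assoc)
  qed
  have "\<bar>B $ i $ i\<bar> \<le> \<omega> (norm z)" for i
    using Bv[of "axis i 1"] by (simp add: matrix_vector_mul_component inner_axis)
  then have "\<bar>\<Sum>i\<in>UNIV. B $ i $ i\<bar> \<le> (\<Sum>i\<in>(UNIV::'n set). \<omega> (norm z))"
    by (intro order_trans[OF sum_abs] sum_mono) auto
  then have tr: "\<bar>trace B\<bar> \<le> ?n * \<omega> (norm z)"
    by (simp add: trace_def)
  have "A z = B + mat 1"
    by (simp add: B_def)
  then have "trace (A z) = trace B + ?n" "(A z *v z) \<bullet> z = (B *v z) \<bullet> z + (norm z)\<^sup>2"
    by (simp_all add: trace_add trace_I matrix_vector_mult_add_rdistrib inner_add_left power2_norm_eq_inner)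
  then have "trace (A z) - ?n * (((A z *v z) \<bullet> z) / (norm z)\<^sup>2)
      = trace B - ?n * (((B *v z) \<bullet> z) / (norm z)\<^sup>2)"
    using assms(1) by (simp add: add_divide_distrib distrib_left)
  also have "\<bar>\<dots>\<bar> \<le> ?n * \<omega> (norm z) + ?n * \<omega> (norm z)"
  proof -
    have "\<bar>((B *v z) \<bullet> z) / (norm z)\<^sup>2\<bar> \<le> \<omega> (norm z)"
      using Bv[of z] assms(1) by (simp add: abs_divide field_simps)
    then have "\<bar>?n * (((B *v z) \<bullet> z) / (norm z)\<^sup>2)\<bar> \<le> ?n * \<omega> (norm z)"
      by (simp add: abs_mult mult_left_mono del: times_divide_eq_right)
    then show ?thesis
      by (intro order_trans[OF abs_triangle_ineq4] add_mono tr)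
  qed
  finally show ?thesis
    using assms(1) by (simp add: exponent_density_def abs_divide divide_right_mono)
qed

lemma exponent_density_bound_shell:
  assumes "0 < s" "s < norm z" "norm z \<le> t" "t < 1"
  shows "\<bar>exponent_density z\<bar> \<le> 2 * real CARD('n) * \<omega> t / s ^ CARD('n)"
proof -
  have "\<bar>exponent_density z\<bar> \<le> 2 * real CARD('n) * \<omega> (norm z) / norm z ^ CARD('n)"
    using assms by (intro exponent_density_bound) auto
  also have "\<dots> \<le> 2 * real CARD('n) * \<omega> t / s ^ CARD('n)"
  proof (intro frac_le mult_left_mono power_mono)
    show "\<omega> (norm z) \<le> \<omega> t"
      using assms mono_\<omega> by (auto simp: mono_on_def)
    show "0 \<le> 2 * real CARD('n) * \<omega> t"
      using assms \<omega>_nonneg[of t] by simp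
  qed (use assms in auto)
  finally show ?thesis .
qed

lemma measurable_exponent_density: "0 < s \<Longrightarrow> exponent_density \<in> borel_measurable (lebesgue_on (annulus s \<epsilon>))"
proof -
  have "A \<in> borel_measurable (lebesgue_on (annulus s \<epsilon>))"
    using eps by (intro measurable_restrict_mono[OF measurable_A]) (auto simp: annulus_def)
  then have "(\<lambda>z. A z $ i $ j) \<in> borel_measurable (lebesgue_on (annulus s \<epsilon>))" for i j
    by (intro borel_measurable_continuous_on[where f = "\<lambda>M. M $ i $ j"] continuous_intros)
  moreover have id: "(\<lambda>z::real^'n. z) \<in> borel_measurable (lebesgue_on (annulus s \<epsilon>))"
    by (intro continuous_imp_measurable_on_sets_lebesgue continuous_on_id) simp
  moreover have "(\<lambda>z::real^'n. z $ i) \<in> borel_measurable (lebesgue_on (annulus s \<epsilon>))" for i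
    by (intro borel_measurable_continuous_on[where f = "\<lambda>x. x $ i", OF _ id] continuous_intros)
  ultimately show ?thesis
    unfolding exponent_density_def [abs_def] trace_def inner_vec_def matrix_vector_mult_def
    by (auto intro!: borel_measurable_divide borel_measurable_diff borel_measurable_times borel_measurable_sum
        borel_measurable_power borel_measurable_norm borel_measurable_const)
qed

lemma integrable_exponent_density:
  assumes "0 < s"
  shows "set_integrable lebesgue (annulus s \<epsilon>) exponent_density"
proof (cases "s < \<epsilon>")
  case True
  have A: "(annulus s \<epsilon> :: (real^'n) set) \<in> lmeasurable"
    using True assms by (intro measure_annulus) auto
  have "\<bar>exponent_density z\<bar> \<le> 2 * real CARD('n) * \<omega> \<epsilon> / s ^ CARD('n)" if "z \<in> annulus s \<epsilon>" for z
    using that assms eps by (intro exponent_density_bound_shell) (auto simp: annulus_def)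
  then have "bounded (exponent_density ` annulus s \<epsilon>)"
    unfolding bounded_iff by auto
  then have "set_integrable lebesgue (annulus s \<epsilon>) (\<lambda>z. exponent_density z * 1)"
    using A measurable_exponent_density[OF assms]
    by (intro absolutely_integrable_bounded_measurable_product[OF bilinear_times] absolutely_integrable_on_const) auto
  then show ?thesis
    by simp
next
  case False
  then have "annulus s \<epsilon> = ({} :: (real^'n) set)"
    by (auto simp: annulus_def)
  then show ?thesis
    by simp
qed

lemma I_eq: "I r = 1 / surface_measure (sphere (0::real^'n) 1) * (LINT z:annulus r \<epsilon>|lebesgue. exponent_density z)"
  by (simp add: I_of_def exponent_density_def)

lemma I_diff_le:
  assumes "0 < s" "s \<le> t" "t \<le> \<epsilon>"
  shows "\<bar>I s - I t\<bar> \<le> 2 * \<omega> t * (real CARD('n) * t ^ (CARD('n) - 1)) / s ^ CARD('n) * (t - s)"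
proof -
  let ?n = "CARD('n)"
  let ?V = "unit_vol TYPE('n)"
  define D where "D = annulus s \<epsilon> - (annulus t \<epsilon> :: (real^'n) set)"
  define S where "S = {x::real^'n. s < norm x \<and> norm x \<le> t}"
  have S: "S \<in> lmeasurable" "measure lebesgue S = ?V * (t ^ ?n - s ^ ?n)"
    unfolding S_def using measure_shell[of s t, where 'n = 'n] assms by auto
  have DS: "D \<subseteq> S" "D \<in> sets lebesgue"
    unfolding D_def by (auto simp: S_def annulus_mem intro!: sets.Diff)
  have D: "D \<in> lmeasurable"
    by (rule fmeasurableI2[OF S(1) DS])
  have mD: "measure lebesgue D \<le> ?V * (t ^ ?n - s ^ ?n)"
    using measure_mono_fmeasurable[OF DS S(1)] S(2) by simp
  define b where "b = 2 * real ?n * \<omega> t / s ^ ?n"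
  have b: "0 \<le> b"
    using \<omega>_nonneg[of t] assms eps by (simp add: b_def)
  have int: "set_integrable lebesgue D exponent_density"
    using integrable_exponent_density[OF assms(1)] DS(2) by (rule set_integrable_subset) (auto simp: D_def)
  have "annulus s \<epsilon> = D \<union> annulus t \<epsilon>" "D \<inter> annulus t \<epsilon> = {}"
    using assms by (auto simp: D_def annulus_def)
  then have "(LINT z:annulus s \<epsilon>|lebesgue. exponent_density z) = (LINT z:D|lebesgue. exponent_density z) + (LINT z:annulus t \<epsilon>|lebesgue. exponent_density z)"
    using integrable_exponent_density[of t] int assms by (simp add: set_integral_Un)
  then have eq: "\<bar>I s - I t\<bar> = 1 / (real ?n * ?V) * \<bar>LINT z:D|lebesgue. exponent_density z\<bar>"
    by (simp add: I_eq surface_measure_unit_sphere right_diff_distrib[symmetric] abs_mult add_divide_distrib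
        diff_divide_distrib[symmetric])
  have "\<bar>LINT z:D|lebesgue. exponent_density z\<bar> \<le> (LINT z:D|lebesgue. b)"
    using int D exponent_density_bound_shell[of s _ t] assms eps DS(1)
    by (intro set_integral_abs_le) (auto simp: b_def S_def intro!: absolutely_integrable_on_const)
  also have "\<dots> = b * measure lebesgue D"
    using D by (simp add: set_lebesgue_integral_def fmeasurableD)
  also have "\<dots> \<le> b * (?V * (t ^ ?n - s ^ ?n))"
    using mD b by (rule mult_left_mono)
  also have "\<dots> \<le> b * (?V * (real ?n * t ^ (?n - 1) * (t - s)))"
    using power_diff_le[of s t t ?n] assms b by (intro mult_left_mono) auto
  finally have "\<bar>I s - I t\<bar> \<le> 1 / (real ?n * ?V) * (b * (?V * (real ?n * t ^ (?n - 1) * (t - s))))"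
    unfolding eq by (intro mult_left_mono) auto
  also have "\<dots> = b * t ^ (?n - 1) * (t - s)"
  proof -
    have "?V \<noteq> 0"
      using unit_ball_vol_pos[of "real ?n"] by (metis of_nat_0_le_iff order_less_irrefl)
    then show ?thesis
      by (simp add: divide_simps)
  qed
  finally show ?thesis
    by (simp add: b_def mult_ac)
qed

lemma I_Lipschitz_on:
  assumes "0 < a" "b \<le> \<epsilon>" "s \<in> {a..b}" "t \<in> {a..b}"
  shows "\<bar>I s - I t\<bar> \<le> 2 * \<omega> b * (real CARD('n) * b ^ (CARD('n) - 1)) / a ^ CARD('n) * \<bar>s - t\<bar>"
proof -
  let ?L = "2 * \<omega> b * (real CARD('n) * b ^ (CARD('n) - 1)) / a ^ CARD('n)"
  have *: "\<bar>I s - I t\<bar> \<le> ?L * (t - s)" if "a \<le> s" "s \<le> t" "t \<le> b" for s t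
  proof -
    have w: "\<omega> t \<le> \<omega> b" "0 \<le> \<omega> t" "0 \<le> \<omega> b"
      using mono_\<omega> that assms eps \<omega>_nonneg by (auto simp: mono_on_def)
    have "\<bar>I s - I t\<bar> \<le> 2 * \<omega> t * (real CARD('n) * t ^ (CARD('n) - 1)) / s ^ CARD('n) * (t - s)"
      using that assms by (intro I_diff_le) auto
    also have "\<dots> \<le> ?L * (t - s)"
      using that assms w by (intro mult_right_mono frac_le mult_mono power_mono) auto
    finally show ?thesis .
  qed
  show ?thesis
  proof (cases "s \<le> t")
    case True
    then show ?thesis
      using *[of s t] assms(3,4) by simp
  next
    case False
    then show ?thesis
      using *[of t s] assms(3,4) by (simp add: abs_minus_commute)
  qed
qed

text \<open>On \<open>r \<le> |x| \<le> 3r\<close> the density is of order \<open>\<omega>(3r) / r\<^sup>n\<close>, and a shell of thickness \<open>h\<close> has volume of order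
  \<open>r\<^sup>n\<^sup>-\<^sup>1 h\<close>.  The interval reaches beyond \<open>2r\<close> to leave room for averaging to the right of the annulus.\<close>

lemma I_Lipschitz:
  assumes "0 < r" "3 * r \<le> \<epsilon>" "s \<in> {r..3 * r}" "t \<in> {r..3 * r}"
  shows "\<bar>I s - I t\<bar> \<le> 2 * real CARD('n) * 3 ^ CARD('n) * \<omega> (3 * r) / r * \<bar>s - t\<bar>"
proof -
  let ?n = "CARD('n)"
  have "0 \<le> \<omega> (3 * r)"
    using assms eps by (intro \<omega>_nonneg) auto
  have "2 * \<omega> (3 * r) * (real ?n * (3 * r) ^ (?n - 1)) / r ^ ?n = 2 * \<omega> (3 * r) * real ?n * 3 ^ (?n - 1) / r"
    using assms(1) by (cases ?n) (auto simp: power_mult_distrib field_simps)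
  also have "\<dots> \<le> 2 * \<omega> (3 * r) * real ?n * 3 ^ ?n / r"
    using assms(1) \<open>0 \<le> \<omega> (3 * r)\<close> by (intro divide_right_mono mult_left_mono power_increasing) auto
  finally have "2 * \<omega> (3 * r) * (real ?n * (3 * r) ^ (?n - 1)) / r ^ ?n * \<bar>s - t\<bar>
      \<le> 2 * \<omega> (3 * r) * real ?n * 3 ^ ?n / r * \<bar>s - t\<bar>"
    by (rule mult_right_mono) simp
  then show ?thesis
    using I_Lipschitz_on[OF assms] by (simp add: mult_ac)
qed

lemma continuous_on_I:
  assumes "0 < a"
  shows "continuous_on {a..\<epsilon>} I"
proof -
  have "(2 * \<omega> \<epsilon> * (real CARD('n) * \<epsilon> ^ (CARD('n) - 1)) / a ^ CARD('n))-lipschitz_on {a..\<epsilon>} I"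
    using I_Lipschitz_on[OF assms order_refl] \<omega>_nonneg[of \<epsilon>] eps assms
    by (intro lipschitz_onI) (auto simp: dist_real_def)
  then show ?thesis
    by (rule lipschitz_on_continuous_on)
qed

lemma exp_I_bounded:
  assumes "((\<lambda>r. exp (I r)) \<longlongrightarrow> E) (at_right 0)"
  obtains M where "1 \<le> M" "\<And>s. s \<in> {0<..\<epsilon>} \<Longrightarrow> exp (I s) \<le> M"
proof -
  have "\<forall>\<^sub>F r in at_right 0. exp (I r) < E + 1"
    using assms by (rule order_tendstoD) simp
  then obtain d where d: "0 < d" "\<And>r. 0 < r \<Longrightarrow> r < d \<Longrightarrow> exp (I r) < E + 1"
    by (auto simp: eventually_at_right_field)
  have "bounded ((\<lambda>r. exp (I r)) ` {d..\<epsilon>})"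
    using continuous_on_I[OF d(1)] by (intro compact_imp_bounded compact_continuous_image continuous_intros) auto
  then obtain C where "\<forall>y\<in>(\<lambda>r. exp (I r)) ` {d..\<epsilon>}. norm y \<le> C"
    unfolding bounded_iff by blast
  then have C: "exp (I r) \<le> C" if "r \<in> {d..\<epsilon>}" for r
    using that by auto
  show ?thesis
  proof (rule that[of "max 1 (max (E + 1) C)"])
    fix s assume "s \<in> {0<..\<epsilon>}"
    then show "exp (I s) \<le> max 1 (max (E + 1) C)"
      using d(2)[of s] C[of s] by (cases "s < d") auto
  qed simp
qed

definition profile :: "real \<Rightarrow> real" where
  "profile r = (LINT s:{r..\<epsilon>}|lborel. s powr (1 - real CARD('n)) * exp (I s))"

lemma h_of_eq: "h_of A \<epsilon> \<zeta> r = profile r * (1 + \<zeta> r)"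
  by (simp add: h_of_def profile_def)

lemma continuous_on_profile_derivative:
  assumes "0 < a"
  shows "continuous_on {a..\<epsilon>} (\<lambda>s. s powr (1 - real CARD('n)) * exp (I s))"
  using assms continuous_on_I[OF assms] by (intro continuous_intros) auto

lemma profile_eq_integral:
  assumes "0 < a"
  shows "profile a = integral {a..\<epsilon>} (\<lambda>s. s powr (1 - real CARD('n)) * exp (I s))"
  unfolding profile_def
  by (intro set_borel_integral_eq_integral borel_integrable_atLeastAtMost' continuous_on_profile_derivative assms)

lemma DERIV_profile:
  assumes "0 < r" "r < \<epsilon>"
  shows "(profile has_real_derivative - (r powr (1 - real CARD('n)) * exp (I r))) (at r)"
proof -
  define g where "g s = s powr (1 - real CARD('n)) * exp (I s)" for s
  define a where "a = r / 2"
  have a: "0 < a" "a < r"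
    using assms by (auto simp: a_def)
  have cont: "continuous_on {a..\<epsilon>} g"
    unfolding g_def by (rule continuous_on_profile_derivative[OF a(1)])
  have "((\<lambda>x. integral {a..x} g) has_real_derivative g r) (at r within {a..\<epsilon>})"
    using a assms by (intro integral_has_real_derivative[OF cont]) auto
  then have "((\<lambda>x. integral {a..x} g) has_real_derivative g r) (at r)"
    using a assms by (simp add: at_within_Icc_at)
  then have "((\<lambda>x. profile a - integral {a..x} g) has_real_derivative - g r) (at r)"
    by (auto intro!: derivative_eq_intros)
  moreover have "profile a - integral {a..x} g = profile x" if "x \<in> {a<..<\<epsilon>}" for x
    using Henstock_Kurzweil_Integration.integral_combine[OF _ _ integrable_continuous_real[OF cont], of x] that a
      profile_eq_integral[of a] profile_eq_integral[of x] by (simp add: g_def [abs_def])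
  ultimately have "(profile has_real_derivative - g r) (at r)"
    using has_field_derivative_transform_within_open[of _ _ r "{a<..<\<epsilon>}" profile] a assms by auto
  then show ?thesis
    by (simp add: g_def)
qed

text \<open>In dimension at least three \<open>s\<^sup>1\<^sup>-\<^sup>n\<close> is integrable at infinity, so the bound does not depend on the upper
  limit \<open>\<epsilon>\<close>.\<close>

lemma profile_bound:
  assumes n: "3 \<le> CARD('n)" and M: "\<And>s. s \<in> {0<..\<epsilon>} \<Longrightarrow> exp (I s) \<le> M" and r: "0 < r" "r < \<epsilon>"
  shows "\<bar>profile r\<bar> \<le> M * r powr (2 - real CARD('n))"
proof -
  let ?n = "real CARD('n)"
  have "0 < M"
    using M[of r] r by (auto intro: less_le_trans[OF exp_gt_zero])
  have FTC: "((\<lambda>s. M * s powr (1 - ?n)) has_integral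
      (M * (\<epsilon> powr (2 - ?n) / (2 - ?n)) - M * (r powr (2 - ?n) / (2 - ?n)))) {r..\<epsilon>}"
  proof (rule fundamental_theorem_of_calculus)
    fix s assume "s \<in> {r..\<epsilon>}"
    then have "((\<lambda>s. M * (s powr (2 - ?n) / (2 - ?n))) has_real_derivative
        M * ((2 - ?n) * s powr (2 - ?n - 1) / (2 - ?n))) (at s)"
      using r by (intro DERIV_cmult DERIV_cdivide has_real_derivative_powr) auto
    then have "((\<lambda>s. M * (s powr (2 - ?n) / (2 - ?n))) has_real_derivative M * s powr (1 - ?n)) (at s)"
      using n by (simp add: add_diff_eq)
    then show "((\<lambda>s. M * (s powr (2 - ?n) / (2 - ?n))) has_vector_derivative M * s powr (1 - ?n)) (at s within {r..\<epsilon>})"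
      by (simp add: has_real_derivative_iff_has_vector_derivative has_vector_derivative_at_within)
  qed (use r in simp)
  have int: "(\<lambda>s. s powr (1 - ?n) * exp (I s)) integrable_on {r..\<epsilon>}"
    by (intro integrable_continuous_real continuous_on_profile_derivative r)
  have "0 \<le> integral {r..\<epsilon>} (\<lambda>s. s powr (1 - ?n) * exp (I s))"
    using int by (rule integral_nonneg) auto
  moreover have "integral {r..\<epsilon>} (\<lambda>s. s powr (1 - ?n) * exp (I s))
      \<le> M * (\<epsilon> powr (2 - ?n) / (2 - ?n)) - M * (r powr (2 - ?n) / (2 - ?n))"
  proof (rule has_integral_le[OF integrable_integral[OF int] FTC])
    fix s assume "s \<in> {r..\<epsilon>}"
    then have "exp (I s) \<le> M"
      using r by (intro M) auto
    then show "s powr (1 - ?n) * exp (I s) \<le> M * s powr (1 - ?n)"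
      by (simp add: mult.commute mult_right_mono)
  qed
  moreover have "M * (\<epsilon> powr (2 - ?n) / (2 - ?n)) - M * (r powr (2 - ?n) / (2 - ?n)) \<le> M * r powr (2 - ?n)"
  proof -
    have "\<epsilon> powr (2 - ?n) / (2 - ?n) \<le> 0"
      using n by (simp add: divide_le_0_iff)
    moreover have "- (r powr (2 - ?n) / (2 - ?n)) = r powr (2 - ?n) / (?n - 2)"
      by (simp add: minus_divide_right)
    moreover have "r powr (2 - ?n) / (?n - 2) \<le> r powr (2 - ?n) / 1"
      using n by (intro divide_left_mono) auto
    ultimately have "M * (\<epsilon> powr (2 - ?n) / (2 - ?n) - r powr (2 - ?n) / (2 - ?n)) \<le> M * r powr (2 - ?n)"
      using \<open>0 < M\<close> by (intro mult_left_mono) auto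
    then show ?thesis
      by (simp add: right_diff_distrib)
  qed
  ultimately show ?thesis
    using profile_eq_integral[OF r(1)] by simp
qed

end

text \<open>Up to the factor \<open>n - 2\<close> the gradient of \<open>|x|\<^sup>2\<^sup>-\<^sup>n\<close>.\<close>

definition Newton_field :: "'n::finite \<Rightarrow> real^'n \<Rightarrow> real" where
  "Newton_field i x = - (norm x powr (- real CARD('n))) * x $ i"

text \<open>The vanishing divergence is what keeps the leading part of \<open>\<nabla>Z\<close> from contributing a term without a small
  factor to the divergence of \<open>\<nabla>Z\<close>.\<close>

lemma C1_grad_Newton_field:
  assumes "0 \<le> a"
  obtains U :: "'n::finite \<Rightarrow> real^'n \<Rightarrow> real^'n"
  where "\<And>i. C1_grad (annulus a b) (Newton_field i) (U i)"
    "\<And>x. x \<in> annulus a b \<Longrightarrow> (\<Sum>i\<in>UNIV. U i x $ i) = 0"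
proof -
  let ?n = "real CARD('n)"
  let ?A = "annulus a b :: (real^'n) set"
  define f where "f s = - (s powr (- ?n))" for s :: real
  define f' where "f' s = ?n * s powr (- ?n - 1)" for s :: real
  define U where "U i x = f (norm x) *\<^sub>R axis i 1 + x $ i *\<^sub>R (f' (norm x) *\<^sub>R sgn x)" for i and x :: "real^'n"
  have "C1_grad ?A (\<lambda>x. f (norm x)) (\<lambda>x. f' (norm x) *\<^sub>R sgn x)"
  proof (rule C1_grad_radial)
    show "continuous_on (norm ` ?A) f'"
      unfolding f'_def using assms by (intro continuous_intros) (auto simp: annulus_def)
    show "0 \<notin> ?A"
      using assms by (simp add: annulus_def)
    fix x assume "x \<in> ?A"
    then have "0 < norm x"
      using assms by (auto simp: annulus_def)
    then show "(f has_real_derivative f' (norm x)) (at (norm x))"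
      unfolding f_def [abs_def] f'_def using DERIV_minus[OF has_real_derivative_powr[of "norm x" "- ?n"]] by simp
  qed
  then have "C1_grad ?A (\<lambda>x. f (norm x) * x $ i) (U i)" for i
    unfolding U_def by (intro C1_grad_mult C1_grad_component)
  moreover have "(\<lambda>x. f (norm x) * x $ i) = Newton_field i" for i :: 'n
    by (simp add: f_def Newton_field_def fun_eq_iff)
  moreover have "(\<Sum>i\<in>UNIV. U i x $ i) = 0" if "x \<in> ?A" for x
  proof -
    have x: "0 < norm x"
      using that assms by (auto simp: annulus_def)
    have "(\<Sum>i\<in>UNIV. U i x $ i) = ?n * f (norm x) + f' (norm x) * (\<Sum>i\<in>UNIV. x $ i * sgn x $ i)"
      by (simp add: U_def sum.distrib sum_distrib_left axis_def mult_ac)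
    also have "(\<Sum>i\<in>UNIV. x $ i * sgn x $ i) = x \<bullet> sgn x"
      by (simp add: inner_vec_def)
    also have "x \<bullet> sgn x = norm x"
      using x by (simp add: sgn_div_norm power2_norm_eq_inner[symmetric] power2_eq_square)
    also have "f' (norm x) * norm x = ?n * norm x powr (- ?n)"
      using x by (simp add: f'_def powr_diff)
    finally show ?thesis
      by (simp add: f_def)
  qed
  ultimately show ?thesis
    using that[of U] by simp
qed

lemma Newton_field_radial:
  fixes x :: "real^'n"
  assumes "x \<noteq> 0"
  shows "(\<Sum>i\<in>UNIV. Newton_field i x * sgn x $ i) = - (norm x powr (1 - real CARD('n)))"
    and "Newton_field i x = - (norm x powr (1 - real CARD('n))) * sgn x $ i"
    and "\<bar>Newton_field i x\<bar> \<le> norm x powr (1 - real CARD('n))"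
proof -
  have 0: "norm x powr (1 - real CARD('n)) = norm x * norm x powr (- real CARD('n))"
    using assms by (simp add: powr_diff powr_minus field_simps)
  then show 1: "Newton_field i x = - (norm x powr (1 - real CARD('n))) * sgn x $ i" for i
    using assms by (simp add: Newton_field_def sgn_div_norm)
  have "(\<Sum>i\<in>UNIV. sgn x $ i * sgn x $ i) = 1"
    using assms norm_sgn[of x] by (simp add: norm_eq_1 inner_vec_def)
  moreover have "(\<Sum>i\<in>UNIV. Newton_field i x * sgn x $ i) = - (norm x powr (1 - real CARD('n))) * (\<Sum>i\<in>UNIV. sgn x $ i * sgn x $ i)"
    unfolding 1 sum_distrib_left by (simp add: mult.assoc)
  ultimately show "(\<Sum>i\<in>UNIV. Newton_field i x * sgn x $ i) = - (norm x powr (1 - real CARD('n)))"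
    by simp
  have "\<bar>sgn x $ i\<bar> \<le> 1"
    using component_le_norm_cart[of "sgn x" i] assms by (simp add: norm_sgn)
  then show "\<bar>Newton_field i x\<bar> \<le> norm x powr (1 - real CARD('n))"
    unfolding 1 abs_mult by (simp add: mult_left_le)
qed

context perturbed_Laplacian
begin

lemma C1_grad_profile:
  assumes "0 \<le> a" "b \<le> \<epsilon>"
  shows "C1_grad (annulus a b) (\<lambda>x::real^'n. profile (norm x)) (\<lambda>x. \<chi> i. exp (I (norm x)) * Newton_field i x)"
proof -
  let ?A = "annulus a b :: (real^'n) set"
  let ?g = "\<lambda>s. - (s powr (1 - real CARD('n)) * exp (I s))"
  have "continuous_on {0<..<\<epsilon>} ?g"
  proof (rule continuous_at_imp_continuous_on, rule ballI)
    fix s assume s: "s \<in> {0<..<\<epsilon>}"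
    then have "continuous_on {s / 2..\<epsilon>} ?g"
      by (intro continuous_intros continuous_on_I) auto
    then show "isCont ?g s"
      using s by (intro continuous_on_interior[of "{s / 2..\<epsilon>}"]) auto
  qed
  then have "continuous_on (norm ` ?A) ?g"
    using assms by (rule_tac continuous_on_subset) (auto simp: annulus_def)
  then have "C1_grad ?A (\<lambda>x. profile (norm x)) (\<lambda>x. ?g (norm x) *\<^sub>R sgn x)"
    using assms by (intro C1_grad_radial DERIV_profile) (auto simp: annulus_def)
  then show ?thesis
  proof (rule C1_grad_cong[OF _ open_annulus refl])
    fix x assume "x \<in> ?A"
    then have "x \<noteq> 0"
      using assms by (auto simp: annulus_def)
    then show "?g (norm x) *\<^sub>R sgn x = (\<chi> i. exp (I (norm x)) * Newton_field i x)"
      by (simp add: vec_eq_iff Newton_field_radial(2))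
  qed
qed

end

section \<open>The flux through a thin layer\<close>

lemma integral_mult_bound:
  fixes f u \<psi> :: "real^'n \<Rightarrow> real"
  assumes f: "set_integrable lebesgue S f" and S: "S \<in> sets lebesgue"
    and u: "continuous_on S u" "\<And>x. x \<in> S \<Longrightarrow> \<bar>u x\<bar> \<le> C"
    and b: "(LINT x:S|lebesgue. \<bar>f x\<bar>) \<le> b" and C: "0 \<le> C"
  shows "set_integrable lebesgue S (\<lambda>x. u x * f x)" "\<bar>LINT x:S|lebesgue. u x * f x\<bar> \<le> C * b"
proof -
  show int: "set_integrable lebesgue S (\<lambda>x. u x * f x)"
    using assms by (intro set_integrable_mult_bounded_continuous)
  have "\<bar>LINT x:S|lebesgue. u x * f x\<bar> \<le> (LINT x:S|lebesgue. C * \<bar>f x\<bar>)"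
    using int set_integrable_abs[OF f] u(2)
    by (intro set_integral_abs_le) (auto simp: abs_mult mult_right_mono)
  also have "\<dots> \<le> C * b"
    using b C by (simp add: mult_left_mono)
  finally show "\<bar>LINT x:S|lebesgue. u x * f x\<bar> \<le> C * b" .
qed

lemma integral_test_bound:
  fixes f u \<psi> :: "real^'n \<Rightarrow> real"
  assumes f: "set_integrable lebesgue S f" and S: "S \<in> sets lebesgue"
    and u: "continuous_on S u" "\<And>x. x \<in> S \<Longrightarrow> \<bar>u x\<bar> \<le> C"
    and \<psi>: "continuous_on S \<psi>" "\<And>x. \<bar>\<psi> x\<bar> \<le> Q"
    and C: "0 \<le> C" "C * (LINT x:S|lebesgue. \<bar>f x\<bar>) \<le> b"
  shows "\<bar>LINT x:S|lebesgue. u x * f x * \<psi> x\<bar> \<le> Q * b"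
proof -
  have Q: "0 \<le> Q"
    using \<psi>(2)[of undefined] by linarith
  have "\<bar>LINT x:S|lebesgue. (u x * \<psi> x) * f x\<bar> \<le> (C * Q) * (LINT x:S|lebesgue. \<bar>f x\<bar>)"
  proof (rule integral_mult_bound(2)[OF f S])
    show "continuous_on S (\<lambda>x. u x * \<psi> x)"
      using u(1) \<psi>(1) by (rule continuous_on_mult)
    show "\<bar>u x * \<psi> x\<bar> \<le> C * Q" if "x \<in> S" for x
      unfolding abs_mult using u(2)[OF that] \<psi>(2) C(1) by (intro mult_mono) auto
  qed (use C Q in auto)
  also have "\<dots> = Q * (C * (LINT x:S|lebesgue. \<bar>f x\<bar>))"
    by simp
  also have "\<dots> \<le> Q * b"
    using C(2) Q by (rule mult_left_mono)
  finally show ?thesis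
    by (simp add: mult_ac)
qed

definition divergence_constant :: "nat \<Rightarrow> real \<Rightarrow> real \<Rightarrow> real" where
  "divergence_constant n M \<alpha> = real n + 3 * real n * M + 2 * real n * 3 ^ n * M * (\<alpha> + 1)"

text \<open>It matters only that this is linear in \<open>q\<close>, \<open>d\<close> and \<open>r\<close>, with coefficients independent of them.\<close>

definition flux_error :: "nat \<Rightarrow> real \<Rightarrow> real \<Rightarrow> real \<Rightarrow> real \<Rightarrow> real \<Rightarrow> real \<Rightarrow> real" where
  "flux_error n P M \<alpha> q d r = 288 * P * real n * (2 * M + 1) * q + 288 * \<alpha> * d
    + 72 * P * divergence_constant n M \<alpha> * q + 72 * P * real n * (M * (\<alpha> + 1) + M + 1) * r"

text \<open>The situation on one annulus.  The functions \<open>w\<close> and \<open>v\<close> are the relative and the absolute perturbation of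
  the radial profile, \<open>w1, w2\<close> and \<open>v1, v2\<close> their first and pure second weak derivatives.  In scale-invariant
  form, \<open>q\<close> measures how small all of them and the oscillation of the coefficients are; \<open>M\<close> and \<open>\<alpha>\<close> are
  bounds that do not depend on \<open>r\<close>.\<close>

locale layer = perturbed_Laplacian A \<omega> \<epsilon>
  for A :: "real^'n \<Rightarrow> real^'n^'n" and \<omega> \<epsilon> +
  fixes r M \<alpha> q :: real
    and w v :: "real^'n \<Rightarrow> real" and w1 w2 v1 v2 :: "'n \<Rightarrow> real^'n \<Rightarrow> real"
  assumes dim: "3 \<le> CARD('n)"
    and r: "0 < r" "3 * r \<le> \<epsilon>"
    and M: "1 \<le> M" "\<And>s. s \<in> {0<..\<epsilon>} \<Longrightarrow> exp (I s) \<le> M"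
    and q: "0 \<le> q" "q \<le> 1" "\<omega> (3 * r) \<le> q"
    and volume: "r powr (1 - real CARD('n)) * measure lebesgue (annulus r (2 * r) :: (real^'n) set) \<le> \<alpha> * r"
    and weak: "\<And>i. has_weak_pderiv (annulus r (2 * r)) i w (w1 i)"
      "\<And>i. has_weak_pderiv (annulus r (2 * r)) i (w1 i) (w2 i)"
      "\<And>i. has_weak_pderiv (annulus r (2 * r)) i v (v1 i)"
      "\<And>i. has_weak_pderiv (annulus r (2 * r)) i (v1 i) (v2 i)"
    and integrable: "set_integrable lebesgue (annulus r (2 * r)) w"
      "\<And>i. set_integrable lebesgue (annulus r (2 * r)) (w1 i)"
      "\<And>i. set_integrable lebesgue (annulus r (2 * r)) (w2 i)"
      "\<And>i. set_integrable lebesgue (annulus r (2 * r)) (v1 i)"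
      "\<And>i. set_integrable lebesgue (annulus r (2 * r)) (v2 i)"
    and small: "r powr (1 - real CARD('n)) * (LINT x:annulus r (2 * r)|lebesgue. \<bar>w x\<bar>) \<le> q * r"
      "\<And>i. r powr (1 - real CARD('n)) * (LINT x:annulus r (2 * r)|lebesgue. \<bar>w1 i x\<bar>) \<le> q"
      "\<And>i. r powr (2 - real CARD('n)) * (LINT x:annulus r (2 * r)|lebesgue. \<bar>w2 i x\<bar>) \<le> q"
      "\<And>i. (LINT x:annulus r (2 * r)|lebesgue. \<bar>v1 i x\<bar>) \<le> q * r"
      "\<And>i. (LINT x:annulus r (2 * r)|lebesgue. \<bar>v2 i x\<bar>) \<le> q"
begin

abbreviation (input) Ar :: "(real^'n) set" where "Ar \<equiv> annulus r (2 * r)"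

text \<open>The weak gradient of \<open>profile |x| * (1 + w x) + v x\<close>, by the product rule.\<close>

definition G :: "'n \<Rightarrow> real^'n \<Rightarrow> real" where
  "G i x = exp (I (norm x)) * Newton_field i x * (1 + w x) + profile (norm x) * w1 i x + v1 i x"

lemma ArD: "x \<in> Ar \<Longrightarrow> r < norm x \<and> norm x < 2 * r \<and> 0 < norm x \<and> x \<noteq> 0 \<and> norm x \<in> {0<..\<epsilon>}"
  using r by (auto simp: annulus_def)

lemma Ar_lmeasurable: "Ar \<in> lmeasurable"
  using r by (intro measure_annulus) auto

lemma \<alpha>_nonneg: "0 \<le> \<alpha>"
proof -
  have "0 \<le> r powr (1 - real CARD('n)) * measure lebesgue Ar"
    by simp
  then have "0 \<le> \<alpha> * r"
    using volume by linarith
  then show ?thesis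
    using r by (simp add: zero_le_mult_iff)
qed

lemma C1_profile: "C1_grad Ar (\<lambda>x. profile (norm x)) (\<lambda>x. \<chi> i. exp (I (norm x)) * Newton_field i x)"
  using r by (intro C1_grad_profile) auto

lemma weak_1w: "has_weak_pderiv Ar i (\<lambda>x. 1 + w x) (w1 i)"
  using has_weak_pderiv_add[OF has_weak_pderiv_const[of Ar i 1] weak(1)] by simp

lemma weak_gradient: "has_weak_pderiv Ar i (\<lambda>x. profile (norm x) * (1 + w x) + v x) (G i)"
  using has_weak_pderiv_add[OF has_weak_pderiv_mult[OF open_annulus weak_1w C1_profile] weak(3)]
  by (simp add: G_def [abs_def])

lemma continuous_profile: "continuous_on Ar (\<lambda>x. profile (norm x))"
  using C1_profile by (rule C1_grad_continuous_on)

lemma profile_bound_Ar: "x \<in> Ar \<Longrightarrow> \<bar>profile (norm x)\<bar> \<le> M * r powr (2 - real CARD('n))"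
proof -
  assume x: "x \<in> Ar"
  have "\<bar>profile (norm x)\<bar> \<le> M * norm x powr (2 - real CARD('n))"
    using ArD[OF x] r by (intro profile_bound dim M(2)) auto
  also have "\<dots> \<le> M * r powr (2 - real CARD('n))"
    using ArD[OF x] r M(1) dim by (intro mult_left_mono powr_mono2') auto
  finally show ?thesis .
qed

lemma norm_powr_bound: "x \<in> Ar \<Longrightarrow> norm x powr (1 - real CARD('n)) \<le> r powr (1 - real CARD('n))"
  using ArD[of x] r dim by (intro powr_mono2') auto

lemma continuous_exp_I: "continuous_on Ar (\<lambda>x. exp (I (norm x)))"
proof -
  have "continuous_on {r..\<epsilon>} I"
    by (rule continuous_on_I[OF r(1)])
  moreover have "norm ` Ar \<subseteq> {r..\<epsilon>}"
    using r by (auto simp: annulus_def)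
  ultimately have "continuous_on Ar (\<lambda>x. I (norm x))"
    by (rule continuous_on_compose2[OF _ continuous_on_norm_id])
  then show ?thesis
    by (rule continuous_on_exp)
qed

lemma continuous_Newton: "continuous_on Ar (Newton_field i)"
  unfolding Newton_field_def [abs_def] using r by (intro continuous_intros) (auto simp: annulus_def)

lemma gradient_coefficient_bound: "x \<in> Ar \<Longrightarrow> \<bar>exp (I (norm x)) * Newton_field i x\<bar> \<le> M * r powr (1 - real CARD('n))"
proof -
  assume x: "x \<in> Ar"
  have "\<bar>Newton_field i x\<bar> \<le> r powr (1 - real CARD('n))"
    using Newton_field_radial(3)[of x i] norm_powr_bound[OF x] ArD[OF x] by linarith
  moreover have "exp (I (norm x)) \<le> M"
    using ArD[OF x] by (intro M(2)) auto
  ultimately show ?thesis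
    unfolding abs_mult using M(1) by (intro mult_mono) auto
qed

lemma powr_2_1: "r powr (2 - real CARD('n)) = r * r powr (1 - real CARD('n))"
  using r by (simp add: powr_diff power2_eq_square)

lemma small': "r powr (2 - real CARD('n)) * (LINT x:Ar|lebesgue. \<bar>w1 i x\<bar>) \<le> q * r"
  using mult_left_mono[OF small(2)[of i], of r] r by (simp add: powr_2_1 mult_ac)

lemma one_plus_w:
  shows "set_integrable lebesgue Ar (\<lambda>x. 1 + w x)"
    "r powr (1 - real CARD('n)) * (LINT x:Ar|lebesgue. \<bar>1 + w x\<bar>) \<le> (\<alpha> + 1) * r"
proof -
  have one: "set_integrable lebesgue Ar (\<lambda>_. 1::real)"
    using Ar_lmeasurable by (rule absolutely_integrable_on_const)
  show int: "set_integrable lebesgue Ar (\<lambda>x. 1 + w x)"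
    using one integrable(1) by (rule set_integral_add)
  have "(LINT x:Ar|lebesgue. \<bar>1 + w x\<bar>) \<le> (LINT x:Ar|lebesgue. 1 + \<bar>w x\<bar>)"
    using int one integrable(1) by (intro set_integral_mono set_integral_add(1) set_integrable_abs) auto
  also have "\<dots> = measure lebesgue Ar + (LINT x:Ar|lebesgue. \<bar>w x\<bar>)"
    using one set_integrable_abs[OF integrable(1)] Ar_lmeasurable
    by (simp add: set_integral_add) (simp add: set_lebesgue_integral_def fmeasurableD)
  finally have "r powr (1 - real CARD('n)) * (LINT x:Ar|lebesgue. \<bar>1 + w x\<bar>)
      \<le> r powr (1 - real CARD('n)) * (measure lebesgue Ar + (LINT x:Ar|lebesgue. \<bar>w x\<bar>))"
    by (intro mult_left_mono) auto
  also have "\<dots> \<le> \<alpha> * r + q * r"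
    using volume small(1) by (simp add: distrib_left)
  also have "\<dots> \<le> (\<alpha> + 1) * r"
    using q r by (simp add: distrib_right)
  finally show "r powr (1 - real CARD('n)) * (LINT x:Ar|lebesgue. \<bar>1 + w x\<bar>) \<le> (\<alpha> + 1) * r" .
qed

text \<open>The only term without a small factor is \<open>exp (I |x|)\<close> times the Newton field, which is a divergence-free field
  multiplied by a function of the radius whose Lipschitz constant is of order \<open>q / r\<close>.\<close>

lemma weak_divergence_small:
  assumes \<psi>: "C1_compact Ar \<psi>" and Q: "\<And>x. \<bar>\<psi> x\<bar> \<le> Q"
  shows "\<bar>LINT x:Ar|lebesgue. \<Sum>i\<in>UNIV. G i x * partial_deriv i \<psi> x\<bar> \<le> Q * (divergence_constant CARD('n) M \<alpha> * q)"
proof -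
  let ?n = "CARD('n)"
  have Q0: "0 \<le> Q"
    using Q[of 0] by linarith
  obtain K D P where "C1_grad UNIV \<psi> D"
    by (rule C1_compactE[OF \<psi>]) blast
  then have \<psi>_cont: "continuous_on Ar \<psi>"
    using C1_grad_continuous_on C1_grad_subset by blast
  define u where "u s = exp (I s)" for s
  obtain U where U: "\<And>i. C1_grad Ar (Newton_field i) (U i)" "\<And>x. x \<in> Ar \<Longrightarrow> (\<Sum>i\<in>UNIV. U i x $ i) = 0"
    using C1_grad_Newton_field[of r "2 * r"] r by (metis less_imp_le)
  define F where "F i x = Newton_field i x * (1 + w x)" for i x
  define DF where "DF i x = U i x $ i * (1 + w x) + Newton_field i x * w1 i x" for i x
  have weakF: "has_weak_pderiv Ar i (F i) (DF i)" for i
    unfolding F_def [abs_def] DF_def [abs_def] by (rule has_weak_pderiv_mult[OF open_annulus weak_1w U(1)])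
  have locF: "loc_integrable Ar (F i)" for i
    using has_weak_pderiv_loc[OF weakF] by auto
  note loc_w1 = set_integrable_imp_loc_integrable[OF integrable(2)]
    and loc_w2 = set_integrable_imp_loc_integrable[OF integrable(3)]
    and loc_v1 = set_integrable_imp_loc_integrable[OF integrable(4)]
  have u_cont: "continuous_on Ar (\<lambda>x. u (norm x))"
    unfolding u_def by (rule continuous_exp_I)
  have uN_cont: "continuous_on Ar (\<lambda>x. u (norm x) * Newton_field i x)" for i
    using u_cont continuous_Newton by (intro continuous_on_mult)
  have v_part: "\<bar>LINT x:Ar|lebesgue. v1 i x * partial_deriv i \<psi> x\<bar> \<le> Q * q" for i
    unfolding has_weak_pderiv_test[OF weak(4) \<psi>] abs_minus_cancel
    using integral_mult_bound(2)[OF integrable(5)[of i] _ \<psi>_cont _ small(5)[of i] Q0] Q by (simp add: mult.commute)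
  have uNw1: "set_integrable lebesgue Ar (\<lambda>x. u (norm x) * Newton_field i x * w1 i x * \<psi> x)"
    "\<bar>LINT x:Ar|lebesgue. u (norm x) * Newton_field i x * w1 i x * \<psi> x\<bar> \<le> Q * (M * q)" for i
  proof -
    show "set_integrable lebesgue Ar (\<lambda>x. u (norm x) * Newton_field i x * w1 i x * \<psi> x)"
      using test_integrable(1)[OF loc_integrable_mult_continuous[OF loc_w1 uN_cont] \<psi>] by simp
    have "M * r powr (1 - real CARD('n)) * (LINT x:Ar|lebesgue. \<bar>w1 i x\<bar>) \<le> M * q"
      using mult_left_mono[OF small(2)[of i], of M] M(1) by (simp add: mult.assoc)
    then show "\<bar>LINT x:Ar|lebesgue. u (norm x) * Newton_field i x * w1 i x * \<psi> x\<bar> \<le> Q * (M * q)"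
      using M(1) gradient_coefficient_bound
      by (intro integral_test_bound[OF integrable(2) _ uN_cont _ \<psi>_cont Q]) (auto simp: u_def)
  qed
  have Hw2: "set_integrable lebesgue Ar (\<lambda>x. profile (norm x) * w2 i x * \<psi> x)"
    "\<bar>LINT x:Ar|lebesgue. profile (norm x) * w2 i x * \<psi> x\<bar> \<le> Q * (M * q)" for i
  proof -
    show "set_integrable lebesgue Ar (\<lambda>x. profile (norm x) * w2 i x * \<psi> x)"
      using test_integrable(1)[OF loc_integrable_mult_continuous[OF loc_w2 continuous_profile] \<psi>] by simp
    have "M * r powr (2 - real CARD('n)) * (LINT x:Ar|lebesgue. \<bar>w2 i x\<bar>) \<le> M * q"
      using mult_left_mono[OF small(3)[of i], of M] M(1) by (simp add: mult.assoc)
    then show "\<bar>LINT x:Ar|lebesgue. profile (norm x) * w2 i x * \<psi> x\<bar> \<le> Q * (M * q)"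
      using M(1) profile_bound_Ar
      by (intro integral_test_bound[OF integrable(3) _ continuous_profile _ \<psi>_cont Q]) auto
  qed
  have w_part: "\<bar>LINT x:Ar|lebesgue. profile (norm x) * w1 i x * partial_deriv i \<psi> x\<bar> \<le> Q * (2 * M * q)" for i
  proof -
    have "(LINT x:Ar|lebesgue. profile (norm x) * w1 i x * partial_deriv i \<psi> x)
        = - ((LINT x:Ar|lebesgue. u (norm x) * Newton_field i x * w1 i x * \<psi> x)
           + (LINT x:Ar|lebesgue. profile (norm x) * w2 i x * \<psi> x))"
      using has_weak_pderiv_test[OF has_weak_pderiv_mult[OF open_annulus weak(2) C1_profile] \<psi>, of i]
        uNw1(1)[of i] Hw2(1)[of i] by (simp add: distrib_right u_def)
    then show ?thesis
      using uNw1(2)[of i] Hw2(2)[of i] by (simp add: distrib_left)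
  qed
  define L where "L = M * (2 * real CARD('n) * 3 ^ ?n * \<omega> (3 * r) / r)"
  have "0 \<le> \<omega> (3 * r)"
    using r eps \<omega>_nonneg by auto
  then have L0: "0 \<le> L"
    using M(1) r by (simp add: L_def)
  have u_Lip: "\<bar>u s - u t\<bar> \<le> L * \<bar>s - t\<bar>" if "s \<in> {r..3 * r}" "t \<in> {r..3 * r}" for s t
  proof -
    have *: "u s - u t \<le> M * \<bar>I s - I t\<bar>" if "s \<in> {r..3 * r}" for s t
    proof -
      have "exp (I s) * (1 + (I t - I s)) \<le> exp (I s) * exp (I t - I s)"
        by (intro mult_left_mono exp_ge_add_one_self) auto
      also have "\<dots> = exp (I t)"
        by (simp add: exp_diff)
      finally have "u s - u t \<le> exp (I s) * (I s - I t)"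
        by (simp add: u_def algebra_simps)
      also have "\<dots> \<le> exp (I s) * \<bar>I s - I t\<bar>"
        by (intro mult_left_mono) auto
      also have "\<dots> \<le> M * \<bar>I s - I t\<bar>"
        using that r M(2)[of s] by (intro mult_right_mono) auto
      finally show ?thesis .
    qed
    have "\<bar>u s - u t\<bar> \<le> M * \<bar>I s - I t\<bar>"
      using *[OF that(1), of t] *[OF that(2), of s] by (simp add: abs_minus_commute abs_le_iff)
    also have "\<dots> \<le> M * (2 * real CARD('n) * 3 ^ ?n * \<omega> (3 * r) / r * \<bar>s - t\<bar>)"
      using I_Lipschitz[OF r that] M(1) by (intro mult_left_mono) auto
    finally show ?thesis
      by (simp add: L_def mult.assoc)
  qed
  have "\<bar>LINT x:Ar|lebesgue. u (norm x) * (\<Sum>i\<in>UNIV. F i x * partial_deriv i \<psi> x + DF i x * \<psi> x)\<bar>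
      \<le> L * (LINT x:Ar|lebesgue. \<bar>\<Sum>i\<in>UNIV. F i x * sgn x $ i\<bar> * \<bar>\<psi> x\<bar>)"
    using r by (intro weak_divergence_radial_Lipschitz[where c = "3 * r"] L0 u_Lip weakF \<psi>) auto
  also have "(LINT x:Ar|lebesgue. \<bar>\<Sum>i\<in>UNIV. F i x * sgn x $ i\<bar> * \<bar>\<psi> x\<bar>)
      = (LINT x:Ar|lebesgue. (norm x powr (1 - real CARD('n)) * \<bar>\<psi> x\<bar>) * \<bar>1 + w x\<bar>)"
  proof (rule set_lebesgue_integral_cong)
    show "\<forall>x. x \<in> Ar \<longrightarrow> \<bar>\<Sum>i\<in>UNIV. F i x * sgn x $ i\<bar> * \<bar>\<psi> x\<bar> = norm x powr (1 - real CARD('n)) * \<bar>\<psi> x\<bar> * \<bar>1 + w x\<bar>"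
    proof (intro allI impI)
      fix x assume "x \<in> Ar"
      then have "x \<noteq> 0"
        using ArD by blast
      have "(\<Sum>i\<in>UNIV. F i x * sgn x $ i) = (\<Sum>i\<in>UNIV. Newton_field i x * sgn x $ i) * (1 + w x)"
        unfolding F_def sum_distrib_right by (intro sum.cong refl) (simp add: mult_ac)
      then show "\<bar>\<Sum>i\<in>UNIV. F i x * sgn x $ i\<bar> * \<bar>\<psi> x\<bar> = norm x powr (1 - real CARD('n)) * \<bar>\<psi> x\<bar> * \<bar>1 + w x\<bar>"
        using Newton_field_radial(1)[OF \<open>x \<noteq> 0\<close>] by (simp add: abs_mult)
    qed
  qed simp
  also have "L * \<dots> \<le> L * ((r powr (1 - real CARD('n)) * Q) * (LINT x:Ar|lebesgue. \<bar>1 + w x\<bar>))"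
  proof (rule mult_left_mono[OF order_trans[OF abs_ge_self] L0])
    show "\<bar>LINT x:Ar|lebesgue. (norm x powr (1 - real CARD('n)) * \<bar>\<psi> x\<bar>) * \<bar>1 + w x\<bar>\<bar>
        \<le> (r powr (1 - real CARD('n)) * Q) * (LINT x:Ar|lebesgue. \<bar>1 + w x\<bar>)"
    proof (rule integral_mult_bound(2)[OF set_integrable_abs[OF one_plus_w(1)]])
      show "continuous_on Ar (\<lambda>x. norm x powr (1 - real CARD('n)) * \<bar>\<psi> x\<bar>)"
        using \<psi>_cont r by (intro continuous_intros) (auto simp: annulus_def)
      show "\<bar>norm x powr (1 - real CARD('n)) * \<bar>\<psi> x\<bar>\<bar> \<le> r powr (1 - real CARD('n)) * Q" if "x \<in> Ar" for x
        unfolding abs_mult using norm_powr_bound[OF that] Q[of x] by (intro mult_mono) auto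
    qed (use Q0 in auto)
  qed
  also have "\<dots> = Q * L * (r powr (1 - real CARD('n)) * (LINT x:Ar|lebesgue. \<bar>1 + w x\<bar>))"
    by simp
  also have "\<dots> \<le> Q * L * ((\<alpha> + 1) * r)"
    using one_plus_w(2) Q0 L0 by (intro mult_left_mono) auto
  also have "\<dots> = Q * (2 * real CARD('n) * 3 ^ ?n * M * (\<alpha> + 1) * \<omega> (3 * r))"
    using r by (simp add: L_def)
  also have "\<dots> \<le> Q * (2 * real CARD('n) * 3 ^ ?n * M * (\<alpha> + 1) * q)"
    using Q0 M(1) \<alpha>_nonneg q by (intro mult_left_mono) auto
  finally have main: "\<bar>LINT x:Ar|lebesgue. u (norm x) * (\<Sum>i\<in>UNIV. F i x * partial_deriv i \<psi> x + DF i x * \<psi> x)\<bar>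
      \<le> Q * (2 * real CARD('n) * 3 ^ ?n * M * (\<alpha> + 1) * q)" .
  have intF: "set_integrable lebesgue Ar (\<lambda>x. u (norm x) * F i x * partial_deriv i \<psi> x)" for i
    using test_integrable(2)[OF loc_integrable_mult_continuous[OF locF u_cont] \<psi>] by simp
  have intw: "set_integrable lebesgue Ar (\<lambda>x. profile (norm x) * w1 i x * partial_deriv i \<psi> x)" for i
    using test_integrable(2)[OF loc_integrable_mult_continuous[OF loc_w1 continuous_profile] \<psi>] by simp
  note intv = test_integrable(2)[OF loc_v1 \<psi>]
  have "(LINT x:Ar|lebesgue. u (norm x) * (\<Sum>i\<in>UNIV. F i x * partial_deriv i \<psi> x + DF i x * \<psi> x))
      = (LINT x:Ar|lebesgue. (\<Sum>i\<in>UNIV. u (norm x) * F i x * partial_deriv i \<psi> x)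
          + (\<Sum>i\<in>UNIV. u (norm x) * Newton_field i x * w1 i x * \<psi> x))"
  proof (rule set_lebesgue_integral_cong)
    show "\<forall>x. x \<in> Ar \<longrightarrow> u (norm x) * (\<Sum>i\<in>UNIV. F i x * partial_deriv i \<psi> x + DF i x * \<psi> x)
      = (\<Sum>i\<in>UNIV. u (norm x) * F i x * partial_deriv i \<psi> x)
          + (\<Sum>i\<in>UNIV. u (norm x) * Newton_field i x * w1 i x * \<psi> x)"
    proof (intro allI impI)
      fix x assume x: "x \<in> Ar"
      have "(\<Sum>i\<in>UNIV. DF i x) = (\<Sum>i\<in>UNIV. U i x $ i) * (1 + w x) + (\<Sum>i\<in>UNIV. Newton_field i x * w1 i x)"
        by (simp add: DF_def sum.distrib sum_distrib_right)
      then have "(\<Sum>i\<in>UNIV. DF i x) = (\<Sum>i\<in>UNIV. Newton_field i x * w1 i x)"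
        using U(2)[OF x] by simp
      then have "(\<Sum>i\<in>UNIV. DF i x * \<psi> x) = (\<Sum>i\<in>UNIV. Newton_field i x * w1 i x * \<psi> x)"
        by (simp only: sum_distrib_right[symmetric])
      then show "u (norm x) * (\<Sum>i\<in>UNIV. F i x * partial_deriv i \<psi> x + DF i x * \<psi> x)
        = (\<Sum>i\<in>UNIV. u (norm x) * F i x * partial_deriv i \<psi> x)
          + (\<Sum>i\<in>UNIV. u (norm x) * Newton_field i x * w1 i x * \<psi> x)"
        by (simp add: sum.distrib distrib_left sum_distrib_left mult.assoc)
    qed
  qed simp
  also have "\<dots> = (\<Sum>i\<in>UNIV. LINT x:Ar|lebesgue. u (norm x) * F i x * partial_deriv i \<psi> x)
      + (\<Sum>i\<in>UNIV. LINT x:Ar|lebesgue. u (norm x) * Newton_field i x * w1 i x * \<psi> x)"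
    using intF uNw1(1) by (simp add: set_integral_add set_integrable_sum)
  finally have eqF: "(\<Sum>i\<in>UNIV. LINT x:Ar|lebesgue. u (norm x) * F i x * partial_deriv i \<psi> x)
      = (LINT x:Ar|lebesgue. u (norm x) * (\<Sum>i\<in>UNIV. F i x * partial_deriv i \<psi> x + DF i x * \<psi> x))
        - (\<Sum>i\<in>UNIV. LINT x:Ar|lebesgue. u (norm x) * Newton_field i x * w1 i x * \<psi> x)"
    by simp
  have "(LINT x:Ar|lebesgue. \<Sum>i\<in>UNIV. G i x * partial_deriv i \<psi> x)
      = (LINT x:Ar|lebesgue. (\<Sum>i\<in>UNIV. u (norm x) * F i x * partial_deriv i \<psi> x)
          + (\<Sum>i\<in>UNIV. profile (norm x) * w1 i x * partial_deriv i \<psi> x)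
          + (\<Sum>i\<in>UNIV. v1 i x * partial_deriv i \<psi> x))"
    by (simp add: G_def u_def F_def sum.distrib distrib_right mult.assoc)
  also have "\<dots> = (\<Sum>i\<in>UNIV. LINT x:Ar|lebesgue. u (norm x) * F i x * partial_deriv i \<psi> x)
      + (\<Sum>i\<in>UNIV. LINT x:Ar|lebesgue. profile (norm x) * w1 i x * partial_deriv i \<psi> x)
      + (\<Sum>i\<in>UNIV. LINT x:Ar|lebesgue. v1 i x * partial_deriv i \<psi> x)"
    using intF intw intv by (simp add: set_integral_add set_integrable_sum)
  finally have total: "(LINT x:Ar|lebesgue. \<Sum>i\<in>UNIV. G i x * partial_deriv i \<psi> x) = \<dots>" .
  have sum_le: "\<bar>\<Sum>i\<in>(UNIV::'n set). f i\<bar> \<le> real CARD('n) * b" if "\<And>i. \<bar>f i\<bar> \<le> b" for f :: "'n \<Rightarrow> real" and b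
    using order_trans[OF sum_abs sum_bounded_above[of UNIV "\<lambda>i. \<bar>f i\<bar>" b]] that by simp
  have "\<bar>LINT x:Ar|lebesgue. \<Sum>i\<in>UNIV. G i x * partial_deriv i \<psi> x\<bar>
      \<le> Q * (2 * real CARD('n) * 3 ^ ?n * M * (\<alpha> + 1) * q) + real CARD('n) * (Q * (M * q)) + real CARD('n) * (Q * (2 * M * q)) + real CARD('n) * (Q * q)"
    using main
      sum_le[of "\<lambda>i. LINT x:Ar|lebesgue. u (norm x) * Newton_field i x * w1 i x * \<psi> x", OF uNw1(2)]
      sum_le[of "\<lambda>i. LINT x:Ar|lebesgue. profile (norm x) * w1 i x * partial_deriv i \<psi> x", OF w_part]
      sum_le[of "\<lambda>i. LINT x:Ar|lebesgue. v1 i x * partial_deriv i \<psi> x", OF v_part]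
    unfolding total eqF by linarith
  then show ?thesis
    by (simp add: divergence_constant_def algebra_simps)
qed

lemma integrable_G: "set_integrable lebesgue Ar (G i)"
  and G_bound: "(LINT x:Ar|lebesgue. \<bar>G i x\<bar>) \<le> (M * (\<alpha> + 1) + M + 1) * r"
  and integrable_G_error: "set_integrable lebesgue Ar (\<lambda>x. G i x - exp (I (norm x)) * Newton_field i x)"
  and G_error_bound: "(LINT x:Ar|lebesgue. \<bar>G i x - exp (I (norm x)) * Newton_field i x\<bar>) \<le> (2 * M + 1) * q * r"
proof -
  have cont: "continuous_on Ar (\<lambda>x. exp (I (norm x)) * Newton_field i x)"
    using continuous_exp_I continuous_Newton by (rule continuous_on_mult)
  let ?N = "\<lambda>x. exp (I (norm x)) * Newton_field i x"
  have int: "set_integrable lebesgue Ar (\<lambda>x. ?N x * f x)"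
    and le: "(LINT x:Ar|lebesgue. \<bar>?N x * f x\<bar>) \<le> M * (r powr (1 - real CARD('n)) * (LINT x:Ar|lebesgue. \<bar>f x\<bar>))"
    if "set_integrable lebesgue Ar f" for f
  proof -
    show int: "set_integrable lebesgue Ar (\<lambda>x. ?N x * f x)"
      using that cont gradient_coefficient_bound by (intro set_integrable_mult_bounded_continuous) auto
    have "(LINT x:Ar|lebesgue. \<bar>?N x * f x\<bar>) \<le> (LINT x:Ar|lebesgue. M * r powr (1 - real CARD('n)) * \<bar>f x\<bar>)"
    proof (intro set_integral_mono set_integrable_abs set_integrable_mult_right int that)
      show "\<bar>?N x * f x\<bar> \<le> M * r powr (1 - real CARD('n)) * \<bar>f x\<bar>" if "x \<in> Ar" for x
        unfolding abs_mult[of "?N x"] by (intro mult_right_mono gradient_coefficient_bound that abs_ge_zero)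
    qed
    then show "(LINT x:Ar|lebesgue. \<bar>?N x * f x\<bar>) \<le> M * (r powr (1 - real CARD('n)) * (LINT x:Ar|lebesgue. \<bar>f x\<bar>))"
      by (simp add: mult.assoc)
  qed
  have intH: "set_integrable lebesgue Ar (\<lambda>x. profile (norm x) * w1 i x)"
    using integrable(2) continuous_profile profile_bound_Ar by (intro set_integrable_mult_bounded_continuous) auto
  have leH: "(LINT x:Ar|lebesgue. \<bar>profile (norm x) * w1 i x\<bar>) \<le> M * (q * r)"
  proof -
    have "(LINT x:Ar|lebesgue. \<bar>profile (norm x) * w1 i x\<bar>) \<le> (LINT x:Ar|lebesgue. M * r powr (2 - real CARD('n)) * \<bar>w1 i x\<bar>)"
    proof (intro set_integral_mono set_integrable_abs set_integrable_mult_right intH integrable(2))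
      show "\<bar>profile (norm x) * w1 i x\<bar> \<le> M * r powr (2 - real CARD('n)) * \<bar>w1 i x\<bar>" if "x \<in> Ar" for x
        unfolding abs_mult by (intro mult_right_mono profile_bound_Ar that abs_ge_zero)
    qed
    also have "\<dots> = M * (r powr (2 - real CARD('n)) * (LINT x:Ar|lebesgue. \<bar>w1 i x\<bar>))"
      by simp
    also have "\<dots> \<le> M * (q * r)"
      using small'[of i] M(1) by (intro mult_left_mono) auto
    finally show ?thesis .
  qed
  have tri: "(LINT x:Ar|lebesgue. \<bar>f x + g x + h x\<bar>)
      \<le> (LINT x:Ar|lebesgue. \<bar>f x\<bar>) + (LINT x:Ar|lebesgue. \<bar>g x\<bar>) + (LINT x:Ar|lebesgue. \<bar>h x\<bar>)"
    if "set_integrable lebesgue Ar f" "set_integrable lebesgue Ar g" "set_integrable lebesgue Ar h" for f g h :: "real^'n \<Rightarrow> real"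
  proof -
    have "(LINT x:Ar|lebesgue. \<bar>f x + g x + h x\<bar>) \<le> (LINT x:Ar|lebesgue. \<bar>f x\<bar> + \<bar>g x\<bar> + \<bar>h x\<bar>)"
      using that by (intro set_integral_mono set_integrable_abs set_integral_add(1)) auto
    then show ?thesis
      using that by (simp add: set_integrable_abs set_integral_add)
  qed
  have M0: "0 \<le> M"
    using M(1) by simp
  have Geq: "G i = (\<lambda>x. ?N x * (1 + w x) + profile (norm x) * w1 i x + v1 i x)"
    by (simp add: G_def fun_eq_iff)
  have Eeq: "G i x - ?N x = ?N x * w x + profile (norm x) * w1 i x + v1 i x" for x
    by (simp add: G_def distrib_left)
  show "set_integrable lebesgue Ar (G i)"
    unfolding Geq by (intro set_integral_add(1) int one_plus_w intH integrable)
  show "set_integrable lebesgue Ar (\<lambda>x. G i x - ?N x)"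
    unfolding Eeq by (intro set_integral_add(1) int intH integrable)
  have "(LINT x:Ar|lebesgue. \<bar>G i x\<bar>) \<le> M * ((\<alpha> + 1) * r) + M * (q * r) + q * r"
    unfolding Geq
    using tri[OF int[OF one_plus_w(1)] intH integrable(4)[of i]] le[OF one_plus_w(1)] leH small(4)[of i]
      mult_left_mono[OF one_plus_w(2) M0] by linarith
  also have "\<dots> \<le> M * ((\<alpha> + 1) * r) + M * (1 * r) + 1 * r"
    using q r M(1) by (intro add_mono mult_left_mono mult_right_mono) auto
  finally show "(LINT x:Ar|lebesgue. \<bar>G i x\<bar>) \<le> (M * (\<alpha> + 1) + M + 1) * r"
    by (simp add: algebra_simps)
  have "(LINT x:Ar|lebesgue. \<bar>G i x - ?N x\<bar>) \<le> M * (q * r) + M * (q * r) + q * r"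
    unfolding Eeq
    using tri[OF int[OF integrable(1)] intH integrable(4)[of i]] le[OF integrable(1)] leH small(4)[of i]
      mult_left_mono[OF small(1) M0] by linarith
  then show "(LINT x:Ar|lebesgue. \<bar>G i x - ?N x\<bar>) \<le> (2 * M + 1) * q * r"
    by (simp add: algebra_simps)
qed

end

context layer
begin

text \<open>For the widest cut-off the flux is computed directly; the flux for a thinner one differs by the
  pairing of \<open>G\<close> with the gradient of a function supported inside the annulus, which the bound on the
  weak divergence controls independently of the width.\<close>

lemma flux_through_layer:
  assumes a: "0 < a" "a \<le> r / 8" and \<phi>: "C1_compact (ball 0 \<epsilon>) \<phi>"
    and P: "\<And>x. \<bar>\<phi> x\<bar> \<le> P" "\<And>i x. \<bar>partial_deriv i \<phi> x\<bar> \<le> P"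
    and d: "\<And>x. x \<in> Ar \<Longrightarrow> \<bar>\<phi> x * exp (I (norm x)) - \<phi> 0 * E\<bar> \<le> d"
  shows "\<bar>(\<Sum>i\<in>UNIV. LINT x:Ar|lebesgue. G i x * (\<phi> x * (cutoff_slope r a x * sgn x $ i)))
      + surface_measure (sphere (0::real^'n) 1) * E * \<phi> 0\<bar>
    \<le> flux_error CARD('n) P M \<alpha> q d r"
proof -
  \<comment> \<open>\<open>r + 4b = 3r/2\<close>: a transition layer whose width is comparable to \<open>r\<close>\<close>
  define b where "b = r / 8"
  have b: "0 < b" "b \<le> r / 8"
    using r by (auto simp: b_def)
  have P0: "0 \<le> P"
    using P(1)[of 0] by linarith
  have M0: "0 \<le> M"
    using M(1) by simp
  define t where "t i c x = cutoff_slope r c x * sgn x $ i" for i c and x :: "real^'n"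
  have t: "C1_compact Ar (t i c)" if "0 < c" "c \<le> r / 8" for i c
    unfolding t_def using that r by (intro C1_compact_cutoff_gradient)
  have \<phi>grad: "C1_grad Ar \<phi> (\<lambda>x. \<chi> i. partial_deriv i \<phi> x)"
    using C1_compact_imp_C1_grad[OF \<phi>] by (rule C1_grad_subset) simp
  have \<phi>t: "C1_compact Ar (\<lambda>x. \<phi> x * t i c x)" if "0 < c" "c \<le> r / 8" for i c
    by (rule C1_compact_mult(1)[OF open_annulus \<phi>grad t[OF that]])
  have locG: "loc_integrable Ar (G i)" for i
    by (rule set_integrable_imp_loc_integrable[OF integrable_G])
  have intG: "set_integrable lebesgue Ar (\<lambda>x. G i x * (\<phi> x * t i c x))" if "0 < c" "c \<le> r / 8" for i c
    by (rule test_integrable(1)[OF locG \<phi>t[OF that]])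
  define \<psi> where "\<psi> x = cutoff r a x - cutoff r b x" for x :: "real^'n"
  have \<psi>: "C1_compact Ar \<psi>"
    unfolding \<psi>_def using a b r by (intro C1_compact_cutoff_diff)
  have \<psi>_le: "\<bar>\<psi> x\<bar> \<le> 72" for x
    using cutoff_values(5)[OF a(1), of r x] cutoff_values(5)[OF b(1), of r x] by (simp add: \<psi>_def)
  have \<psi>': "partial_deriv i \<psi> x = t i a x - t i b x" for i x
    using C1_grad_partial_deriv[OF C1_grad_diff[OF C1_grad_cutoff[OF a(1) r(1)] C1_grad_cutoff[OF b(1) r(1)]], of x i]
    by (simp add: \<psi>_def [abs_def] t_def)
  note \<phi>\<psi> = C1_compact_mult[OF open_annulus \<phi>grad \<psi>]
  \<comment> \<open>\<open>\<phi> \<nabla>\<psi> = \<nabla>(\<phi> \<psi>) - \<psi> \<nabla>\<phi>\<close>: the first term meets the weak divergence, the second has no derivative of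
    a cut-off and gains a factor \<open>r\<close>\<close>
  have low: "set_integrable lebesgue Ar (\<lambda>x. (partial_deriv i \<phi> x * \<psi> x) * G i x)"
    "\<bar>LINT x:Ar|lebesgue. (partial_deriv i \<phi> x * \<psi> x) * G i x\<bar> \<le> (P * 72) * ((M * (\<alpha> + 1) + M + 1) * r)" for i
  proof -
    have "continuous_on Ar (\<lambda>x. partial_deriv i \<phi> x * \<psi> x)"
      by (intro continuous_on_mult C1_compact_continuous_on[OF \<phi>] C1_compact_continuous_on[OF \<psi>])
    moreover have "\<bar>partial_deriv i \<phi> x * \<psi> x\<bar> \<le> P * 72" for x
      unfolding abs_mult using P(2) \<psi>_le P0 by (intro mult_mono) auto
    ultimately show "set_integrable lebesgue Ar (\<lambda>x. (partial_deriv i \<phi> x * \<psi> x) * G i x)"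
      "\<bar>LINT x:Ar|lebesgue. (partial_deriv i \<phi> x * \<psi> x) * G i x\<bar> \<le> (P * 72) * ((M * (\<alpha> + 1) + M + 1) * r)"
      using integral_mult_bound[OF integrable_G[of i], where u = "\<lambda>x. partial_deriv i \<phi> x * \<psi> x" and C = "P * 72",
          OF _ _ _ G_bound] P0 by auto
  qed
  have "(LINT x:Ar|lebesgue. \<Sum>i\<in>UNIV. G i x * partial_deriv i (\<lambda>x. \<phi> x * \<psi> x) x)
      = (LINT x:Ar|lebesgue. \<Sum>i\<in>UNIV. G i x * (\<phi> x * t i a x) - G i x * (\<phi> x * t i b x)
          + (partial_deriv i \<phi> x * \<psi> x) * G i x)"
    by (rule set_lebesgue_integral_cong) (auto simp: \<phi>\<psi>(2) \<psi>' algebra_simps intro!: sum.cong)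
  also have "\<dots> = (\<Sum>i\<in>UNIV. (LINT x:Ar|lebesgue. G i x * (\<phi> x * t i a x)) - (LINT x:Ar|lebesgue. G i x * (\<phi> x * t i b x))
          + (LINT x:Ar|lebesgue. (partial_deriv i \<phi> x * \<psi> x) * G i x))"
    using intG[OF a] intG[OF b] low(1)
    by (subst set_integrable_sum(2)) (auto simp: set_integral_add set_integral_diff)
  finally have compare: "(\<Sum>i\<in>UNIV. LINT x:Ar|lebesgue. G i x * (\<phi> x * t i a x))
      = (\<Sum>i\<in>UNIV. LINT x:Ar|lebesgue. G i x * (\<phi> x * t i b x))
        + (LINT x:Ar|lebesgue. \<Sum>i\<in>UNIV. G i x * partial_deriv i (\<lambda>x. \<phi> x * \<psi> x) x)
        - (\<Sum>i\<in>UNIV. LINT x:Ar|lebesgue. (partial_deriv i \<phi> x * \<psi> x) * G i x)"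
    by (simp add: sum.distrib sum_subtractf)
  have div: "\<bar>LINT x:Ar|lebesgue. \<Sum>i\<in>UNIV. G i x * partial_deriv i (\<lambda>x. \<phi> x * \<psi> x) x\<bar>
      \<le> (P * 72) * (divergence_constant CARD('n) M \<alpha> * q)"
  proof (rule weak_divergence_small[OF \<phi>\<psi>(1)])
    show "\<bar>\<phi> x * \<psi> x\<bar> \<le> P * 72" for x
      unfolding abs_mult using P(1) \<psi>_le P0 by (intro mult_mono) auto
  qed
  \<comment> \<open>for the wide cut-off, \<open>exp (I |x|) \<phi>(x)\<close> is replaced by its limit at the origin\<close>
  let ?e = "\<lambda>x::real^'n. exp (I (norm x))"
  define k where "k x = norm x powr (1 - real CARD('n)) * cutoff_slope r b x" for x :: "real^'n"
  have k: "set_integrable lebesgue Ar k" "(LINT x:Ar|lebesgue. k x) = surface_measure (sphere (0::real^'n) 1)"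
    unfolding k_def [abs_def] b_def using integral_cutoff_slope[OF r(1), where 'n = 'n] by simp_all
  have err: "set_integrable lebesgue Ar (\<lambda>x. (\<phi> x * t i b x) * (G i x - ?e x * Newton_field i x))"
    "\<bar>LINT x:Ar|lebesgue. (\<phi> x * t i b x) * (G i x - ?e x * Newton_field i x)\<bar>
      \<le> (P * (36 / b)) * ((2 * M + 1) * q * r)" for i
  proof -
    have "continuous_on Ar (\<lambda>x. \<phi> x * t i b x)"
      using b by (intro C1_compact_continuous_on[OF \<phi>t]) auto
    moreover have "\<bar>\<phi> x * t i b x\<bar> \<le> P * (36 / b)" for x
    proof -
      have "\<bar>sgn x $ i\<bar> \<le> norm (sgn x)"
        by (rule component_le_norm_cart)
      also have "\<dots> \<le> 1"
        by (simp add: norm_sgn)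
      finally have "\<bar>t i b x\<bar> \<le> (36 / b) * 1"
        unfolding t_def abs_mult using cutoff_values(6)[OF b(1), of r x] b by (intro mult_mono) auto
      then show ?thesis
        unfolding abs_mult using P(1) P0 by (intro mult_mono) auto
    qed
    ultimately show "set_integrable lebesgue Ar (\<lambda>x. (\<phi> x * t i b x) * (G i x - ?e x * Newton_field i x))"
      "\<bar>LINT x:Ar|lebesgue. (\<phi> x * t i b x) * (G i x - ?e x * Newton_field i x)\<bar>
        \<le> (P * (36 / b)) * ((2 * M + 1) * q * r)"
      using integral_mult_bound[OF integrable_G_error[of i], where u = "\<lambda>x. \<phi> x * t i b x" and C = "P * (36 / b)",
          OF _ _ _ G_error_bound] P0 b by auto
  qed
  have "(\<Sum>i\<in>UNIV. LINT x:Ar|lebesgue. G i x * (\<phi> x * t i b x))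
      - (\<Sum>i\<in>UNIV. LINT x:Ar|lebesgue. (\<phi> x * t i b x) * (G i x - ?e x * Newton_field i x))
      = (LINT x:Ar|lebesgue. \<Sum>i\<in>UNIV. G i x * (\<phi> x * t i b x) - (\<phi> x * t i b x) * (G i x - ?e x * Newton_field i x))"
    using intG[OF b] err(1) by (subst set_integrable_sum(2)) (auto simp: set_integral_diff sum_subtractf)
  also have "\<dots> = (LINT x:Ar|lebesgue. - (\<phi> 0 * E) * k x - (\<phi> x * ?e x - \<phi> 0 * E) * k x)"
  proof (rule set_lebesgue_integral_cong)
    show "\<forall>x. x \<in> Ar \<longrightarrow> (\<Sum>i\<in>UNIV. G i x * (\<phi> x * t i b x) - (\<phi> x * t i b x) * (G i x - ?e x * Newton_field i x))
        = - (\<phi> 0 * E) * k x - (\<phi> x * ?e x - \<phi> 0 * E) * k x"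
    proof (intro allI impI)
      fix x assume "x \<in> Ar"
      then have "x \<noteq> 0"
        using ArD by blast
      have "(\<Sum>i\<in>UNIV. G i x * (\<phi> x * t i b x) - (\<phi> x * t i b x) * (G i x - ?e x * Newton_field i x))
          = \<phi> x * ?e x * cutoff_slope r b x * (\<Sum>i\<in>UNIV. Newton_field i x * sgn x $ i)"
        unfolding sum_distrib_left by (intro sum.cong refl) (simp add: t_def algebra_simps)
      also have "\<dots> = - (\<phi> 0 * E) * k x - (\<phi> x * ?e x - \<phi> 0 * E) * k x"
        by (simp add: Newton_field_radial(1)[OF \<open>x \<noteq> 0\<close>] k_def algebra_simps)
      finally show "(\<Sum>i\<in>UNIV. G i x * (\<phi> x * t i b x) - (\<phi> x * t i b x) * (G i x - ?e x * Newton_field i x))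
        = - (\<phi> 0 * E) * k x - (\<phi> x * ?e x - \<phi> 0 * E) * k x" .
    qed
  qed simp
  finally have main: "(\<Sum>i\<in>UNIV. LINT x:Ar|lebesgue. G i x * (\<phi> x * t i b x))
      - (\<Sum>i\<in>UNIV. LINT x:Ar|lebesgue. (\<phi> x * t i b x) * (G i x - ?e x * Newton_field i x))
      = (LINT x:Ar|lebesgue. - (\<phi> 0 * E) * k x - (\<phi> x * ?e x - \<phi> 0 * E) * k x)" .
  have main_eq: "(LINT x:Ar|lebesgue. - (\<phi> 0 * E) * k x - (\<phi> x * ?e x - \<phi> 0 * E) * k x)
      = - (\<phi> 0 * E) * surface_measure (sphere (0::real^'n) 1) - (LINT x:Ar|lebesgue. (\<phi> x * ?e x - \<phi> 0 * E) * k x)"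
    and osc: "\<bar>LINT x:Ar|lebesgue. (\<phi> x * ?e x - \<phi> 0 * E) * k x\<bar> \<le> 288 * \<alpha> * d"
  proof -
    have d0: "0 \<le> d"
    proof -
      obtain x :: "real^'n" where "norm x = 3 / 2 * r"
        using vector_choose_size[of "3 / 2 * r"] r by auto
      then have "x \<in> Ar"
        using r by (simp add: annulus_def)
      then show ?thesis
        using d[of x] by linarith
    qed
    have kle: "\<bar>k x\<bar> \<le> r powr (1 - real CARD('n)) * (36 / b)" if "x \<in> Ar" for x
      unfolding k_def abs_mult using norm_powr_bound[OF that] cutoff_values(6)[OF b(1), of r x]
      by (intro mult_mono) auto
    have one: "set_integrable lebesgue Ar (\<lambda>x. r powr (1 - real CARD('n)) * (36 / b))"
      using Ar_lmeasurable by (rule absolutely_integrable_on_const)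
    have "(LINT x:Ar|lebesgue. \<bar>k x\<bar>) \<le> (LINT x:Ar|lebesgue. r powr (1 - real CARD('n)) * (36 / b))"
      by (intro set_integral_mono set_integrable_abs k one kle)
    also have "\<dots> = (36 / b) * (r powr (1 - real CARD('n)) * measure lebesgue Ar)"
      using Ar_lmeasurable by (simp add: set_lebesgue_integral_def fmeasurableD)
    also have "\<dots> \<le> (36 / b) * (\<alpha> * r)"
      using volume b by (intro mult_left_mono) auto
    also have "\<dots> = 288 * \<alpha>"
      using r by (simp add: b_def)
    finally have kint: "(LINT x:Ar|lebesgue. \<bar>k x\<bar>) \<le> 288 * \<alpha>" .
    have cont: "continuous_on Ar (\<lambda>x. \<phi> x * ?e x - \<phi> 0 * E)"
      by (intro continuous_on_diff continuous_on_mult C1_compact_continuous_on[OF \<phi>] continuous_exp_I continuous_on_const)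
    note * = integral_mult_bound[OF k(1) _ cont d kint d0]
    show "\<bar>LINT x:Ar|lebesgue. (\<phi> x * ?e x - \<phi> 0 * E) * k x\<bar> \<le> 288 * \<alpha> * d"
      using *(2) by (simp add: mult.commute)
    have "(LINT x:Ar|lebesgue. - (\<phi> 0 * E) * k x - (\<phi> x * ?e x - \<phi> 0 * E) * k x)
        = (LINT x:Ar|lebesgue. - (\<phi> 0 * E) * k x) - (LINT x:Ar|lebesgue. (\<phi> x * ?e x - \<phi> 0 * E) * k x)"
      using k(1) *(1) by (intro set_integral_diff(2) set_integrable_mult_right) auto
    then show "(LINT x:Ar|lebesgue. - (\<phi> 0 * E) * k x - (\<phi> x * ?e x - \<phi> 0 * E) * k x)
        = - (\<phi> 0 * E) * surface_measure (sphere (0::real^'n) 1) - (LINT x:Ar|lebesgue. (\<phi> x * ?e x - \<phi> 0 * E) * k x)"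
      by (simp only: set_integral_mult_right k(2))
  qed
  have wide: "(\<Sum>i\<in>UNIV. LINT x:Ar|lebesgue. G i x * (\<phi> x * t i b x))
      + surface_measure (sphere (0::real^'n) 1) * E * \<phi> 0
      = (\<Sum>i\<in>UNIV. LINT x:Ar|lebesgue. (\<phi> x * t i b x) * (G i x - ?e x * Newton_field i x))
        - (LINT x:Ar|lebesgue. (\<phi> x * ?e x - \<phi> 0 * E) * k x)"
    using main unfolding main_eq by (simp add: algebra_simps)
  have sum_le: "\<bar>\<Sum>i\<in>(UNIV::'n set). f i\<bar> \<le> real CARD('n) * b" if "\<And>i. \<bar>f i\<bar> \<le> b" for f :: "'n \<Rightarrow> real" and b
    using order_trans[OF sum_abs sum_bounded_above[of UNIV "\<lambda>i. \<bar>f i\<bar>" b]] that by simp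
  have e1: "\<bar>\<Sum>i\<in>UNIV. LINT x:Ar|lebesgue. (\<phi> x * t i b x) * (G i x - ?e x * Newton_field i x)\<bar>
      \<le> 288 * P * real CARD('n) * (2 * M + 1) * q"
    using sum_le[of "\<lambda>i. LINT x:Ar|lebesgue. (\<phi> x * t i b x) * (G i x - ?e x * Newton_field i x)", OF err(2)] r
    by (simp add: b_def mult_ac)
  have e2: "\<bar>\<Sum>i\<in>UNIV. LINT x:Ar|lebesgue. (partial_deriv i \<phi> x * \<psi> x) * G i x\<bar>
      \<le> 72 * P * real CARD('n) * (M * (\<alpha> + 1) + M + 1) * r"
    using sum_le[of "\<lambda>i. LINT x:Ar|lebesgue. (partial_deriv i \<phi> x * \<psi> x) * G i x", OF low(2)]
    by (simp add: mult_ac)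
  have e3: "\<bar>LINT x:Ar|lebesgue. \<Sum>i\<in>UNIV. G i x * partial_deriv i (\<lambda>x. \<phi> x * \<psi> x) x\<bar>
      \<le> 72 * P * divergence_constant CARD('n) M \<alpha> * q"
    using div by (simp add: mult_ac)
  have "\<bar>(\<Sum>i\<in>UNIV. LINT x:Ar|lebesgue. G i x * (\<phi> x * t i a x)) + surface_measure (sphere (0::real^'n) 1) * E * \<phi> 0\<bar>
      \<le> flux_error CARD('n) P M \<alpha> q d r"
    using compare wide e1 osc e3 e2 unfolding flux_error_def by linarith
  then show ?thesis
    by (simp add: t_def)
qed

end

section \<open>The pairing as a limit of fluxes\<close>

context
  fixes A :: "real^'n \<Rightarrow> real^'n^'n" and \<epsilon> p :: real and Z \<phi> :: "real^'n \<Rightarrow> real"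
  assumes solution: "strong_solution p A (ball 0 \<epsilon> - {0}) Z" and \<phi>: "C1_compact (ball 0 \<epsilon>) \<phi>"
begin

abbreviation (input) \<Omega> :: "(real^'n) set" where "\<Omega> \<equiv> ball 0 \<epsilon> - {0}"

text \<open>The divergence of \<open>\<phi> \<nabla>Z\<close>.\<close>

definition J :: "real^'n \<Rightarrow> real" where
  "J x = (\<Sum>i\<in>UNIV. weak_hess \<Omega> Z x $ i $ i * \<phi> x + weak_grad \<Omega> Z x $ i * partial_deriv i \<phi> x)"

lemma pairing_integrand_AE: "AE x in lebesgue. x \<in> \<Omega> \<longrightarrow> pairing_integrand A \<epsilon> Z \<phi> x = - J x"
proof -
  have "AE x in lebesgue. x \<in> \<Omega> \<longrightarrow> (\<Sum>i\<in>UNIV. \<Sum>j\<in>UNIV. A x $ i $ j * weak_hess \<Omega> Z x $ i $ j) = 0"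
    using solution by (simp add: strong_solution_def)
  then show ?thesis
  proof (rule AE_mp, intro AE_I2 impI)
    fix x
    assume "x \<in> \<Omega> \<longrightarrow> (\<Sum>i\<in>UNIV. \<Sum>j\<in>UNIV. A x $ i $ j * weak_hess \<Omega> Z x $ i $ j) = 0" and x: "x \<in> \<Omega>"
    then have eq: "(\<Sum>i\<in>UNIV. \<Sum>j\<in>UNIV. A x $ i $ j * weak_hess \<Omega> Z x $ i $ j) = 0"
      by blast
    have "(\<Sum>i\<in>UNIV. \<Sum>j\<in>UNIV. (A x $ i $ j - mat 1 $ i $ j) * weak_hess \<Omega> Z x $ i $ j * \<phi> x)
      = ((\<Sum>i\<in>UNIV. \<Sum>j\<in>UNIV. A x $ i $ j * weak_hess \<Omega> Z x $ i $ j)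
         - (\<Sum>i\<in>UNIV. \<Sum>j\<in>UNIV. mat 1 $ i $ j * weak_hess \<Omega> Z x $ i $ j)) * \<phi> x"
      by (simp add: sum_subtractf[symmetric] sum_distrib_right left_diff_distrib)
    also have "(\<Sum>i\<in>UNIV. \<Sum>j\<in>UNIV. (mat 1 :: real^'n^'n) $ i $ j * weak_hess \<Omega> Z x $ i $ j)
      = (\<Sum>i\<in>UNIV. weak_hess \<Omega> Z x $ i $ i)"
      by (intro sum.cong refl) (simp add: mat_def if_distrib[of "\<lambda>c. c * _"] cong: if_cong)
    finally show "pairing_integrand A \<epsilon> Z \<phi> x = - J x"
      unfolding eq by (simp add: pairing_integrand_def J_def sum.distrib sum_distrib_right)
  qed
qed

lemma weak_derivatives_Z:
  "has_weak_pderiv \<Omega> i Z (\<lambda>x. weak_grad \<Omega> Z x $ i)"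
  "has_weak_pderiv \<Omega> i (\<lambda>x. weak_grad \<Omega> Z x $ i) (\<lambda>x. weak_hess \<Omega> Z x $ i $ i)"
proof -
  have "twice_weakly_diff \<Omega> Z"
    using solution by (simp add: strong_solution_def W2p_loc_def)
  then show "has_weak_pderiv \<Omega> i Z (\<lambda>x. weak_grad \<Omega> Z x $ i)"
    "has_weak_pderiv \<Omega> i (\<lambda>x. weak_grad \<Omega> Z x $ i) (\<lambda>x. weak_hess \<Omega> Z x $ i $ i)"
    by (rule twice_weakly_diff_weak_derivatives)+
qed

text \<open>On \<open>\<eta> < |x|\<close> the test function agrees with its product with a cut-off, which is supported away from
  the singularity.\<close>

lemma integrable_J:
  assumes \<eta>: "0 < \<eta>"
  shows "set_integrable lebesgue (annulus \<eta> \<epsilon>) J"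
proof -
  \<comment> \<open>this cut-off equals \<open>1\<close> from \<open>3\<eta>/4\<close> on\<close>
  define \<phi>' where "\<phi>' x = \<phi> x * cutoff (\<eta> / 2) (\<eta> / 16) x" for x
  have \<phi>': "C1_compact \<Omega> \<phi>'"
    unfolding \<phi>'_def using \<eta> by (intro C1_compact_times_cutoff[OF \<phi>]) auto
  have eq: "\<phi>' x = \<phi> x" "partial_deriv i \<phi>' x = partial_deriv i \<phi> x" if "x \<in> annulus \<eta> \<epsilon>" for x i
  proof -
    have x: "\<eta> / 2 + 4 * (\<eta> / 16) \<le> norm x"
      using that \<eta> by (simp add: annulus_def)
    show "\<phi>' x = \<phi> x"
      using cutoff_values(2)[OF _ x] \<eta> by (simp add: \<phi>'_def)
    show "partial_deriv i \<phi>' x = partial_deriv i \<phi> x"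
      using C1_compact_times_cutoff(2)[OF \<phi>, of "\<eta> / 16" "\<eta> / 2" i x] cutoff_values(2,4)[OF _ x] \<eta>
      by (simp add: \<phi>'_def [abs_def])
  qed
  have loc: "loc_integrable \<Omega> (\<lambda>x. weak_grad \<Omega> Z x $ i)" "loc_integrable \<Omega> (\<lambda>x. weak_hess \<Omega> Z x $ i $ i)" for i
    using has_weak_pderiv_loc[OF weak_derivatives_Z(2)] by auto
  have "set_integrable lebesgue \<Omega> (\<lambda>x. \<Sum>i\<in>UNIV. weak_hess \<Omega> Z x $ i $ i * \<phi>' x + weak_grad \<Omega> Z x $ i * partial_deriv i \<phi>' x)"
    by (intro set_integrable_sum set_integral_add(1) test_integrable[OF _ \<phi>'] loc)
  then have "set_integrable lebesgue (annulus \<eta> \<epsilon>) (\<lambda>x. \<Sum>i\<in>UNIV. weak_hess \<Omega> Z x $ i $ i * \<phi>' x + weak_grad \<Omega> Z x $ i * partial_deriv i \<phi>' x)"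
    by (rule set_integrable_subset) (use \<eta> in \<open>auto simp: annulus_mem\<close>)
  then show ?thesis
    by (rule iffD1[OF set_integrable_cong, rotated -1]) (auto simp: J_def eq)
qed

lemma pairing_integrable:
  assumes \<eta>: "0 < \<eta>"
  shows "pairing_integrand A \<epsilon> Z \<phi> absolutely_integrable_on annulus \<eta> \<epsilon>"
    and "pairing_upto A \<epsilon> Z \<phi> \<eta> = - (LINT x:annulus \<eta> \<epsilon>|lebesgue. J x)"
proof -
  have int: "set_integrable lebesgue (annulus \<eta> \<epsilon>) (\<lambda>x. - 1 * J x)"
    using integrable_J[OF \<eta>] by (intro set_integrable_mult_right)
  have ae: "AE x in lebesgue. x \<in> annulus \<eta> \<epsilon> \<longrightarrow> - 1 * J x = pairing_integrand A \<epsilon> Z \<phi> x"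
    using pairing_integrand_AE by (rule AE_mp) (use \<eta> in \<open>auto simp: annulus_mem\<close>)
  show "pairing_integrand A \<epsilon> Z \<phi> absolutely_integrable_on annulus \<eta> \<epsilon>"
    by (rule set_integrable_cong_AE_lebesgue(1)[OF int ae])
  show "pairing_upto A \<epsilon> Z \<phi> \<eta> = - (LINT x:annulus \<eta> \<epsilon>|lebesgue. J x)"
    unfolding pairing_upto_def set_integrable_cong_AE_lebesgue(2)[OF int ae, symmetric]
    using set_integral_uminus[OF integrable_J[OF \<eta>]] by simp
qed

text \<open>Testing the weak second derivatives with \<open>\<phi>\<close> times the cut-off leaves only the gradient of the cut-off.  As
  this is a test field on the annulus, any weak gradient \<open>G\<close> of \<open>Z\<close> there gives the same value.\<close>

lemma integral_J_cutoff:
  assumes r: "0 < r" "2 * r < \<epsilon>" and a: "0 < a" "a \<le> r / 8"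
    and G: "\<And>i. has_weak_pderiv (annulus r (2 * r)) i Z (G i)"
  shows "(LINT x:annulus r \<epsilon>|lebesgue. J x * cutoff r a x)
    = - (\<Sum>i\<in>UNIV. LINT x:annulus r (2 * r)|lebesgue. G i x * (\<phi> x * (cutoff_slope r a x * sgn x $ i)))"
proof -
  let ?A = "annulus r (2 * r) :: (real^'n) set"
  let ?g = "\<lambda>i x. weak_grad \<Omega> Z x $ i" and ?h = "\<lambda>i x. weak_hess \<Omega> Z x $ i $ i"
  define t where "t i x = \<phi> x * (cutoff_slope r a x * sgn x $ i)" for i x
  have A\<Omega>: "?A \<subseteq> \<Omega>"
    using r by (auto simp: annulus_mem)
  have \<phi>grad: "C1_grad ?A \<phi> (\<lambda>x. \<chi> i. partial_deriv i \<phi> x)"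
    using C1_compact_imp_C1_grad[OF \<phi>] by (rule C1_grad_subset) simp
  have t: "C1_compact ?A (t i)" for i
    unfolding t_def using C1_compact_mult(1)[OF open_annulus \<phi>grad C1_compact_cutoff_gradient[OF a(1) r(1) a(2)]] .
  have t0: "t i x = 0" if "x \<notin> ?A" for i x
    using C1_compactE[OF t[of i]] that by (metis subsetD)
  have t\<Omega>: "C1_compact \<Omega> (t i)" for i
    using t A\<Omega> by (rule C1_compact_subset)
  define \<theta> where "\<theta> x = \<phi> x * cutoff r a x" for x
  have \<theta>: "C1_compact \<Omega> \<theta>"
    unfolding \<theta>_def using r a by (intro C1_compact_times_cutoff[OF \<phi>]) auto
  have \<theta>': "partial_deriv i \<theta> x = cutoff r a x * partial_deriv i \<phi> x + t i x" for i x
    using C1_compact_times_cutoff(2)[OF \<phi> a(1) r(1)] by (simp add: \<theta>_def [abs_def] t_def)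
  have loc: "loc_integrable \<Omega> (?g i)" "loc_integrable \<Omega> (?h i)" for i
    using has_weak_pderiv_loc[OF weak_derivatives_Z(2)] by auto
  have swap: "(LINT x:\<Omega>|lebesgue. ?g i x * t i x) = (LINT x:?A|lebesgue. G i x * t i x)" for i
  proof -
    have "(LINT x:\<Omega>|lebesgue. ?g i x * t i x) = (LINT x:?A|lebesgue. ?g i x * t i x)"
      using t0 by (intro set_integral_superset(1)[OF A\<Omega>]) auto
    then show ?thesis
      using has_weak_pderiv_test[OF has_weak_pderiv_subset[OF weak_derivatives_Z(1) A\<Omega>] t[of i]]
        has_weak_pderiv_test[OF G t[of i]] by simp
  qed
  have "(LINT x:annulus r \<epsilon>|lebesgue. J x * cutoff r a x) = (LINT x:\<Omega>|lebesgue. J x * cutoff r a x)"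
  proof (rule set_integral_superset(1)[symmetric])
    show "annulus r \<epsilon> \<subseteq> \<Omega>"
      using r by (auto simp: annulus_mem)
    show "J x * cutoff r a x = 0" if "x \<in> \<Omega>" "x \<notin> annulus r \<epsilon>" for x
      using that a cutoff_values(1)[OF a(1), of x r] by (simp add: annulus_mem)
  qed
  also have "\<dots> = (LINT x:\<Omega>|lebesgue. \<Sum>i\<in>UNIV. (?h i x * \<theta> x + ?g i x * partial_deriv i \<theta> x) - ?g i x * t i x)"
    unfolding J_def sum_distrib_right
    by (intro arg_cong[where f = "set_lebesgue_integral lebesgue \<Omega>"] ext sum.cong refl)
      (simp add: \<theta>' \<theta>_def algebra_simps)
  also have "\<dots> = (\<Sum>i\<in>UNIV. ((LINT x:\<Omega>|lebesgue. ?h i x * \<theta> x) + (LINT x:\<Omega>|lebesgue. ?g i x * partial_deriv i \<theta> x))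
      - (LINT x:\<Omega>|lebesgue. ?g i x * t i x))"
  proof -
    have 1: "set_integrable lebesgue \<Omega> (\<lambda>x. ?h i x * \<theta> x)" "set_integrable lebesgue \<Omega> (\<lambda>x. ?g i x * partial_deriv i \<theta> x)"
      "set_integrable lebesgue \<Omega> (\<lambda>x. ?g i x * t i x)" for i
      by (intro test_integrable[OF loc(2) \<theta>] test_integrable[OF loc(1) \<theta>] test_integrable[OF loc(1) t\<Omega>])+
    note 2 = set_integral_add[OF 1(1,2)]
    have "set_integrable lebesgue \<Omega> (\<lambda>x. (?h i x * \<theta> x + ?g i x * partial_deriv i \<theta> x) - ?g i x * t i x)" for i
      by (rule set_integral_diff(1)[OF 2(1) 1(3)])
    from set_integrable_sum(2)[of UNIV, OF this] show ?thesis
      by (simp only: set_integral_diff(2)[OF 2(1) 1(3)] 2(2))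
  qed
  also have "\<dots> = - (\<Sum>i\<in>UNIV. LINT x:\<Omega>|lebesgue. ?g i x * t i x)"
    by (simp add: has_weak_pderiv_test[OF weak_derivatives_Z(2) \<theta>] sum_negf)
  also have "\<dots> = - (\<Sum>i\<in>UNIV. LINT x:?A|lebesgue. G i x * t i x)"
    by (simp only: swap)
  finally show ?thesis
    by (simp add: t_def)
qed

text \<open>As \<open>a\<close> tends to \<open>0\<close> the cut-offs tend boundedly to the indicator function of \<open>|x| > r\<close>.\<close>

lemma pairing_upto_flux:
  assumes r: "0 < r" "2 * r < \<epsilon>"
    and G: "\<And>i. has_weak_pderiv (annulus r (2 * r)) i Z (G i)"
    and flux: "\<And>a. 0 < a \<Longrightarrow> a \<le> r / 8 \<Longrightarrow>
      \<bar>(\<Sum>i\<in>UNIV. LINT x:annulus r (2 * r)|lebesgue. G i x * (\<phi> x * (cutoff_slope r a x * sgn x $ i))) + c\<bar> \<le> B"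
  shows "\<bar>pairing_upto A \<epsilon> Z \<phi> r + c\<bar> \<le> B"
proof -
  define a where "a k = r / 8 * inverse (real (Suc k))" for k
  have a: "0 < a k" "a k \<le> r / 8" for k
    using r by (auto simp: a_def field_simps)
  have a_lim: "(\<lambda>k. r + 4 * a k) \<longlonglongrightarrow> r + 4 * (r / 8 * 0)"
    unfolding a_def by (intro tendsto_intros LIMSEQ_inverse_real_of_nat)
  note intJ = integrable_J[OF r(1)]
  have "(\<lambda>k. LINT x|lebesgue. indicator (annulus r \<epsilon>) x *\<^sub>R (J x * cutoff r (a k) x))
      \<longlonglongrightarrow> (LINT x|lebesgue. indicator (annulus r \<epsilon>) x *\<^sub>R J x)"
  proof (rule integral_dominated_convergence[where w = "\<lambda>x. 36 * \<bar>indicator (annulus r \<epsilon>) x *\<^sub>R J x\<bar>"])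
    show meas: "(\<lambda>x. indicator (annulus r \<epsilon>) x *\<^sub>R J x) \<in> borel_measurable lebesgue"
      using intJ by (auto simp: set_integrable_def)
    show "integrable lebesgue (\<lambda>x. 36 * \<bar>indicator (annulus r \<epsilon>) x *\<^sub>R J x\<bar>)"
      using intJ by (auto simp: set_integrable_def)
    show "(\<lambda>x. indicator (annulus r \<epsilon>) x *\<^sub>R (J x * cutoff r (a k) x)) \<in> borel_measurable lebesgue" for k
    proof -
      have "continuous_on UNIV (cutoff r (a k) :: real^'n \<Rightarrow> real)"
        using C1_grad_continuous_on[OF C1_grad_cutoff[OF a(1) r(1)]] .
      then have "(cutoff r (a k) :: real^'n \<Rightarrow> real) \<in> borel_measurable lebesgue"
        using continuous_imp_measurable_on_sets_lebesgue[of UNIV] by (simp add: lebesgue_on_UNIV_eq)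
      from borel_measurable_times[OF meas this] show ?thesis
        by (simp add: mult.assoc)
    qed
    show "AE x in lebesgue. (\<lambda>k. indicator (annulus r \<epsilon>) x *\<^sub>R (J x * cutoff r (a k) x))
        \<longlonglongrightarrow> indicator (annulus r \<epsilon>) x *\<^sub>R J x"
    proof (rule AE_I2)
      fix x :: "real^'n"
      show "(\<lambda>k. indicator (annulus r \<epsilon>) x *\<^sub>R (J x * cutoff r (a k) x)) \<longlonglongrightarrow> indicator (annulus r \<epsilon>) x *\<^sub>R J x"
      proof (cases "x \<in> annulus r \<epsilon>")
        case True
        then have "\<forall>\<^sub>F k in sequentially. r + 4 * a k < norm x"
          using a_lim by (intro order_tendstoD(2)) (auto simp: annulus_mem)
        then have "\<forall>\<^sub>F k in sequentially. J x = J x * cutoff r (a k) x"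
          by (rule eventually_mono) (simp add: cutoff_values(2)[OF a(1)])
        then have "(\<lambda>k. J x * cutoff r (a k) x) \<longlonglongrightarrow> J x"
          by (rule Lim_transform_eventually[OF tendsto_const])
        then show ?thesis
          using True by simp
      qed simp
    qed
    show "AE x in lebesgue. norm (indicator (annulus r \<epsilon>) x *\<^sub>R (J x * cutoff r (a k) x))
        \<le> 36 * \<bar>indicator (annulus r \<epsilon>) x *\<^sub>R J x\<bar>" for k
    proof (rule AE_I2)
      fix x :: "real^'n"
      have "\<bar>J x\<bar> * \<bar>cutoff r (a k) x\<bar> \<le> \<bar>J x\<bar> * 36"
        by (intro mult_left_mono cutoff_values(5)[OF a(1)]) auto
      then show "norm (indicator (annulus r \<epsilon>) x *\<^sub>R (J x * cutoff r (a k) x)) \<le> 36 * \<bar>indicator (annulus r \<epsilon>) x *\<^sub>R J x\<bar>"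
        by (simp add: abs_mult indicator_def)
    qed
  qed
  then have lim: "(\<lambda>k. LINT x:annulus r \<epsilon>|lebesgue. J x * cutoff r (a k) x) \<longlonglongrightarrow> (LINT x:annulus r \<epsilon>|lebesgue. J x)"
    by (simp add: set_lebesgue_integral_def)
  have "\<bar>- (LINT x:annulus r \<epsilon>|lebesgue. J x) + c\<bar> \<le> B"
  proof (rule LIMSEQ_le_const2)
    show "(\<lambda>k. \<bar>- (LINT x:annulus r \<epsilon>|lebesgue. J x * cutoff r (a k) x) + c\<bar>) \<longlonglongrightarrow> \<bar>- (LINT x:annulus r \<epsilon>|lebesgue. J x) + c\<bar>"
      by (intro tendsto_intros lim)
    show "\<exists>N. \<forall>k\<ge>N. \<bar>- (LINT x:annulus r \<epsilon>|lebesgue. J x * cutoff r (a k) x) + c\<bar> \<le> B"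
      using flux[OF a] by (simp add: integral_J_cutoff[OF r a G])
  qed
  then show ?thesis
    by (simp add: pairing_integrable(2)[OF r(1)])
qed

end

section \<open>Passage to the limit\<close>

lemma M_2p_component_bounds:
  fixes w :: "real^'n \<Rightarrow> real"
  assumes "1 < p" "0 < r" and W: "W2p p (annulus r (2 * r)) w" and b: "M_2p p w r \<le> b"
  defines "A \<equiv> annulus r (2 * r)"
  shows "set_integrable lebesgue A w"
    "set_integrable lebesgue A (\<lambda>x. weak_grad A w x $ i)"
    "set_integrable lebesgue A (\<lambda>x. weak_hess A w x $ i $ i)"
    "(LINT x:A|lebesgue. \<bar>w x\<bar>) \<le> 2 * b * measure lebesgue A"
    "(LINT x:A|lebesgue. \<bar>weak_grad A w x $ i\<bar>) \<le> 2 * (b / r) * measure lebesgue A"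
    "(LINT x:A|lebesgue. \<bar>weak_hess A w x $ i $ i\<bar>) \<le> 2 * (b / r\<^sup>2) * measure lebesgue A"
proof -
  note L1 = M_2p_L1[OF assms(1-4), folded A_def]
  have loc: "set_integrable lebesgue A f \<and> (LINT x:A|lebesgue. \<bar>f x\<bar>) \<le> (LINT x:A|lebesgue. B x)"
    if f: "f \<in> borel_measurable (lebesgue_on A)" and B: "set_integrable lebesgue A B" and le: "\<And>x. \<bar>f x\<bar> \<le> B x"
    for f B :: "real^'n \<Rightarrow> real"
  proof
    show f_int: "set_integrable lebesgue A f"
    proof (rule set_integrable_bound[OF B])
      show "set_borel_measurable lebesgue A f"
        using f by (simp add: A_def set_borel_measurable_def borel_measurable_restrict_space_iff)
      show "AE x in lebesgue. x \<in> A \<longrightarrow> norm (f x) \<le> norm (B x)"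
        using le by (auto intro: order_trans[OF _ abs_ge_self])
    qed
    show "(LINT x:A|lebesgue. \<bar>f x\<bar>) \<le> (LINT x:A|lebesgue. B x)"
      using f_int B le by (intro set_integral_mono set_integrable_abs)
  qed
  have meas: "w \<in> borel_measurable (lebesgue_on A)" "weak_grad A w \<in> borel_measurable (lebesgue_on A)"
    "weak_hess A w \<in> borel_measurable (lebesgue_on A)"
    using W by (auto simp: W2p_def Lp_on_def A_def)
  have "(\<lambda>x. weak_grad A w x $ i) \<in> borel_measurable (lebesgue_on A)"
    by (rule borel_measurable_continuous_on[OF _ meas(2)]) (intro continuous_intros)
  from loc[OF this L1(2)] L1(5)
  show "set_integrable lebesgue A (\<lambda>x. weak_grad A w x $ i)"
    "(LINT x:A|lebesgue. \<bar>weak_grad A w x $ i\<bar>) \<le> 2 * (b / r) * measure lebesgue A"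
    using component_le_norm_cart by (blast intro: order_trans)+
  have "(\<lambda>x. weak_hess A w x $ i $ i) \<in> borel_measurable (lebesgue_on A)"
    by (rule borel_measurable_continuous_on[OF _ meas(3)]) (intro continuous_intros)
  moreover have "\<bar>weak_hess A w x $ i $ i\<bar> \<le> norm (weak_hess A w x)" for x
    using component_le_norm_cart Finite_Cartesian_Product.norm_nth_le by (rule order_trans)
  ultimately show "set_integrable lebesgue A (\<lambda>x. weak_hess A w x $ i $ i)"
    "(LINT x:A|lebesgue. \<bar>weak_hess A w x $ i $ i\<bar>) \<le> 2 * (b / r\<^sup>2) * measure lebesgue A"
    using loc[OF _ L1(3)] L1(6) by (blast intro: order_trans)+
  show "set_integrable lebesgue A w" "(LINT x:A|lebesgue. \<bar>w x\<bar>) \<le> 2 * b * measure lebesgue A"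
    using loc[OF meas(1) L1(1)] L1(4) by auto
qed

lemma set_integral_shrinking_tendsto_0:
  fixes f :: "real \<Rightarrow> real"
  assumes "set_integrable lborel {0<..<1} f"
  shows "((\<lambda>r. LINT t:{0<..<r}|lborel. f t) \<longlongrightarrow> 0) (at_right 0)"
proof (rule tendsto_at_right_sequentially[of 0 1])
  fix S :: "nat \<Rightarrow> real"
  assume S: "\<And>n. 0 < S n" "\<And>n. S n < 1" "S \<longlonglongrightarrow> 0"
  have f: "integrable lborel (\<lambda>t. indicator {0<..<1} t *\<^sub>R f t)"
    using assms by (simp add: set_integrable_def)
  have eq: "indicator {0<..<S n} t *\<^sub>R f t = indicator {0<..<S n} t *\<^sub>R (indicator {0<..<1} t *\<^sub>R f t)" for n t
    using S(2)[of n] by (auto simp: indicator_def)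
  have "(\<lambda>n. LINT t|lborel. indicator {0<..<S n} t *\<^sub>R f t) \<longlonglongrightarrow> (LINT t::real|lborel. 0::real)"
  proof (rule integral_dominated_convergence[where w = "\<lambda>t. \<bar>indicator {0<..<1} t *\<^sub>R f t\<bar>"])
    show "integrable lborel (\<lambda>t. \<bar>indicator {0<..<1} t *\<^sub>R f t\<bar>)"
      using f by (rule integrable_abs)
    show "(\<lambda>t. indicator {0<..<S n} t *\<^sub>R f t) \<in> borel_measurable lborel" for n
      unfolding eq by (rule borel_measurable_scaleR[OF _ borel_measurable_integrable[OF f]]) auto
    show "AE t in lborel. (\<lambda>n. indicator {0<..<S n} t *\<^sub>R f t) \<longlonglongrightarrow> 0"
    proof (rule AE_I2)
      fix t :: real
      show "(\<lambda>n. indicator {0<..<S n} t *\<^sub>R f t) \<longlonglongrightarrow> 0"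
      proof (cases "0 < t")
        case True
        then have "\<forall>\<^sub>F n in sequentially. S n < t"
          using S(3) by (intro order_tendstoD(2))
        then have "\<forall>\<^sub>F n in sequentially. 0 = indicator {0<..<S n} t *\<^sub>R f t"
          by (rule eventually_mono) auto
        then show ?thesis
          by (rule Lim_transform_eventually[OF tendsto_const])
      qed auto
    qed
    show "AE t in lborel. norm (indicator {0<..<S n} t *\<^sub>R f t) \<le> \<bar>indicator {0<..<1} t *\<^sub>R f t\<bar>" for n
      using S(2)[of n] by (intro AE_I2) (auto simp: indicator_def)
  qed simp
  then show "(\<lambda>n. LINT t:{0<..<S n}|lborel. f t) \<longlonglongrightarrow> 0"
    by (simp add: set_lebesgue_integral_def)
qed simp

lemma annulus_volume_le:
  assumes "0 < r"
  shows "r powr (1 - real CARD('n)) * measure lebesgue (annulus r (2 * r) :: (real^'n) set)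
    \<le> (unit_vol TYPE('n) * 2 ^ CARD('n)) * r"
proof -
  have "measure lebesgue (annulus r (2 * r) :: (real^'n) set) \<le> unit_vol TYPE('n) * (2 ^ CARD('n) * r ^ CARD('n))"
    using assms measure_annulus(2)[of r "2 * r", where 'n = 'n]
    by (simp add: power_mult_distrib mult_left_mono)
  then have "r powr (1 - real CARD('n)) * measure lebesgue (annulus r (2 * r) :: (real^'n) set)
      \<le> r powr (1 - real CARD('n)) * (unit_vol TYPE('n) * (2 ^ CARD('n) * r ^ CARD('n)))"
    by (intro mult_left_mono) auto
  also have "\<dots> = (unit_vol TYPE('n) * 2 ^ CARD('n)) * (r powr (1 - real CARD('n)) * r ^ CARD('n))"
    by simp
  also have "r powr (1 - real CARD('n)) * r ^ CARD('n) = r"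
    using assms by (simp add: powr_diff powr_realpow)
  finally show ?thesis .
qed

context perturbed_Laplacian
begin

text \<open>The bounds \<open>b\<close> and \<open>b' r\<^sup>2\<^sup>-\<^sup>n\<close> for the annular means match the scaling of the estimate on a layer: after
  multiplication by the volume of the annulus all powers of \<open>r\<close> cancel.\<close>

lemma pairing_upto_estimate:
  fixes Z v \<phi> :: "real^'n \<Rightarrow> real" and \<zeta> :: "real \<Rightarrow> real"
  defines "\<alpha> \<equiv> unit_vol TYPE('n) * 2 ^ CARD('n)"
  assumes n: "3 \<le> CARD('n)" and p: "1 < p" and r: "0 < r" "3 * r \<le> \<epsilon>"
    and solution: "strong_solution p A (ball 0 \<epsilon> - {0}) Z"
    and Z: "AE x in lebesgue. x \<in> ball 0 \<epsilon> - {0} \<longrightarrow> Z x = h_of A \<epsilon> \<zeta> (norm x) + v x"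
    and W\<zeta>: "W2p p (annulus r (2 * r)) (\<lambda>x::real^'n. \<zeta> (norm x))" "M_2p p (\<lambda>x::real^'n. \<zeta> (norm x)) r \<le> b"
    and Wv: "W2p p (annulus r (2 * r)) v" "M_2p p v r \<le> b' * r powr (2 - real CARD('n))"
    and M: "1 \<le> M" "\<And>s. s \<in> {0<..\<epsilon>} \<Longrightarrow> exp (I s) \<le> M"
    and q: "0 \<le> q" "q \<le> 1" "\<omega> (3 * r) \<le> q" "2 * b * \<alpha> \<le> q" "2 * b' * \<alpha> \<le> q" "0 \<le> b" "0 \<le> b'"
    and \<phi>: "C1_compact (ball 0 \<epsilon>) \<phi>" and P: "\<And>x. \<bar>\<phi> x\<bar> \<le> P" "\<And>i x. \<bar>partial_deriv i \<phi> x\<bar> \<le> P"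
    and d: "\<And>x. x \<in> annulus r (2 * r) \<Longrightarrow> \<bar>\<phi> x * exp (I (norm x)) - \<phi> 0 * E\<bar> \<le> d"
  shows "\<bar>pairing_upto A \<epsilon> Z \<phi> r + surface_measure (sphere (0::real^'n) 1) * E * \<phi> 0\<bar>
    \<le> flux_error CARD('n) P M \<alpha> q d r"
proof -
  let ?n = "real CARD('n)"
  let ?A = "annulus r (2 * r) :: (real^'n) set"
  let ?w = "\<lambda>x::real^'n. \<zeta> (norm x)"
  let ?\<mu> = "measure lebesgue ?A"
  note \<zeta>_bounds = M_2p_component_bounds[OF p r(1) W\<zeta>]
    and v_bounds = M_2p_component_bounds[OF p r(1) Wv]
  have twice: "twice_weakly_diff ?A ?w" "twice_weakly_diff ?A v"
    using W\<zeta>(1) Wv(1) by (auto simp: W2p_def)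
  have vol: "r powr (1 - ?n) * ?\<mu> \<le> \<alpha> * r"
    unfolding \<alpha>_def by (rule annulus_volume_le[OF r(1)])
  have powr2: "r powr (2 - ?n) = r * r powr (1 - ?n)"
    using r by (simp add: powr_diff power2_eq_square)
  have scaled: "2 * c * (r powr (1 - ?n) * ?\<mu>) \<le> q * r" if "0 \<le> c" "2 * c * \<alpha> \<le> q" for c
  proof -
    have "2 * c * (r powr (1 - ?n) * ?\<mu>) \<le> 2 * c * (\<alpha> * r)"
      using that vol by (intro mult_left_mono) auto
    also have "\<dots> \<le> q * r"
      using mult_right_mono[OF that(2), of r] r by (simp add: mult.assoc)
    finally show ?thesis .
  qed
  interpret layer A \<omega> \<epsilon> r M \<alpha> q ?w v "\<lambda>i x. weak_grad ?A ?w x $ i" "\<lambda>i x. weak_hess ?A ?w x $ i $ i"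
    "\<lambda>i x. weak_grad ?A v x $ i" "\<lambda>i x. weak_hess ?A v x $ i $ i"
  proof
    show "has_weak_pderiv ?A i ?w (\<lambda>x. weak_grad ?A ?w x $ i)"
      "has_weak_pderiv ?A i (\<lambda>x. weak_grad ?A ?w x $ i) (\<lambda>x. weak_hess ?A ?w x $ i $ i)"
      "has_weak_pderiv ?A i v (\<lambda>x. weak_grad ?A v x $ i)"
      "has_weak_pderiv ?A i (\<lambda>x. weak_grad ?A v x $ i) (\<lambda>x. weak_hess ?A v x $ i $ i)" for i
      by (rule twice_weakly_diff_weak_derivatives[OF twice(1)] twice_weakly_diff_weak_derivatives[OF twice(2)])+
    have "r powr (1 - ?n) * (LINT x:?A|lebesgue. \<bar>?w x\<bar>) \<le> r powr (1 - ?n) * (2 * b * ?\<mu>)"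
      by (intro mult_left_mono \<zeta>_bounds) auto
    then show "r powr (1 - ?n) * (LINT x:?A|lebesgue. \<bar>?w x\<bar>) \<le> q * r"
      using scaled[of b] q by (simp add: mult_ac)
    show "r powr (1 - ?n) * (LINT x:?A|lebesgue. \<bar>weak_grad ?A ?w x $ i\<bar>) \<le> q" for i
    proof -
      have "r powr (1 - ?n) * (LINT x:?A|lebesgue. \<bar>weak_grad ?A ?w x $ i\<bar>) \<le> r powr (1 - ?n) * (2 * (b / r) * ?\<mu>)"
        by (intro mult_left_mono \<zeta>_bounds) auto
      also have "\<dots> = (2 * b * (r powr (1 - ?n) * ?\<mu>)) / r"
        by simp
      also have "\<dots> \<le> (q * r) / r"
        using scaled[of b] q r by (intro divide_right_mono) auto
      finally show ?thesis
        using r by simp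
    qed
    show "r powr (2 - ?n) * (LINT x:?A|lebesgue. \<bar>weak_hess ?A ?w x $ i $ i\<bar>) \<le> q" for i
    proof -
      have "r powr (2 - ?n) * (LINT x:?A|lebesgue. \<bar>weak_hess ?A ?w x $ i $ i\<bar>) \<le> r powr (2 - ?n) * (2 * (b / r\<^sup>2) * ?\<mu>)"
        by (intro mult_left_mono \<zeta>_bounds) auto
      also have "\<dots> = (2 * b * (r powr (1 - ?n) * ?\<mu>)) / r"
        using r by (simp add: powr2 power2_eq_square)
      also have "\<dots> \<le> (q * r) / r"
        using scaled[of b] q r by (intro divide_right_mono) auto
      finally show ?thesis
        using r by simp
    qed
    show "(LINT x:?A|lebesgue. \<bar>weak_grad ?A v x $ i\<bar>) \<le> q * r" for i
    proof -
      have "(LINT x:?A|lebesgue. \<bar>weak_grad ?A v x $ i\<bar>) \<le> 2 * (b' * r powr (2 - ?n) / r) * ?\<mu>"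
        by (rule v_bounds)
      also have "\<dots> = 2 * b' * (r powr (1 - ?n) * ?\<mu>)"
        using r by (simp add: powr2)
      also have "\<dots> \<le> q * r"
        using scaled[of b'] q by simp
      finally show ?thesis .
    qed
    show "(LINT x:?A|lebesgue. \<bar>weak_hess ?A v x $ i $ i\<bar>) \<le> q" for i
    proof -
      have "(LINT x:?A|lebesgue. \<bar>weak_hess ?A v x $ i $ i\<bar>) \<le> 2 * (b' * r powr (2 - ?n) / r\<^sup>2) * ?\<mu>"
        by (rule v_bounds)
      also have "\<dots> = 2 * b' * (r powr (1 - ?n) * ?\<mu>) / r"
        using r by (simp add: powr2 power2_eq_square)
      also have "\<dots> \<le> (q * r) / r"
        using scaled[of b'] q r by (intro divide_right_mono) auto
      finally show ?thesis
        using r by simp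
    qed
  qed (use n r M q vol \<zeta>_bounds v_bounds in auto)
  have ae: "AE x in lebesgue. x \<in> ?A \<longrightarrow> profile (norm x) * (1 + \<zeta> (norm x)) + v x = Z x"
    using Z by (rule AE_mp) (use r in \<open>auto simp: annulus_mem h_of_eq\<close>)
  show ?thesis
  proof (rule pairing_upto_flux[OF solution \<phi> r(1)])
    show "2 * r < \<epsilon>"
      using r by simp
    show "has_weak_pderiv ?A i Z (G i)" for i
      using weak_gradient ae by (rule has_weak_pderiv_cong_AE)
    show "\<bar>(\<Sum>i\<in>UNIV. LINT x:?A|lebesgue. G i x * (\<phi> x * (cutoff_slope r a x * sgn x $ i)))
        + surface_measure (sphere (0::real^'n) 1) * E * \<phi> 0\<bar>
      \<le> flux_error CARD('n) P M \<alpha> q d r"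
      if "0 < a" "a \<le> r / 8" for a
      using that \<phi> P d by (rule flux_through_layer)
  qed
qed

text \<open>Only the limit of \<open>exp I\<close> matters, which covers a finite limit of \<open>I\<close> and divergence to minus infinity at
  once.\<close>

lemma minus_LZ_eq_delta_exp_limit:
  fixes Z v :: "real^'n \<Rightarrow> real" and \<zeta> :: "real \<Rightarrow> real"
  assumes n: "3 \<le> CARD('n)" and p: "1 < p"
    and \<omega>: "continuous_on {0..<1} \<omega>" "\<omega> 0 = 0" and Dini: "set_integrable lborel {0<..<1} (\<lambda>t. (\<omega> t)\<^sup>2 / t)"
    and solution: "strong_solution p A (ball 0 \<epsilon> - {0}) Z"
    and Z: "AE x in lebesgue. x \<in> ball 0 \<epsilon> - {0} \<longrightarrow> Z x = h_of A \<epsilon> \<zeta> (norm x) + v x"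
    and bound_\<zeta>: "M_2p_bound p (\<lambda>x::real^'n. \<zeta> (norm x)) (\<lambda>r. max (\<omega> r) (sigma_of \<omega> r))"
    and bound_v: "M_2p_bound p v (\<lambda>r. r powr (2 - real CARD('n)) * exp (I r) * \<omega> r)"
    and E: "((\<lambda>r. exp (I r)) \<longlongrightarrow> E) (at_right 0)"
  shows "minus_LZ_eq_delta A \<epsilon> Z (surface_measure (sphere (0::real^'n) 1) * E)"
  unfolding minus_LZ_eq_delta_def
proof (intro allI impI)
  fix \<phi> :: "real^'n \<Rightarrow> real" assume \<phi>: "C1_compact (ball 0 \<epsilon>) \<phi>"
  define c where "c = surface_measure (sphere (0::real^'n) 1) * E * \<phi> 0"
  obtain M where M: "1 \<le> M" "\<And>s. s \<in> {0<..\<epsilon>} \<Longrightarrow> exp (I s) \<le> M"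
    using exp_I_bounded[OF E] by blast
  obtain K D P where D: "\<And>i x. partial_deriv i \<phi> x = D x $ i" and P: "0 < P" "\<And>x. \<bar>\<phi> x\<bar> \<le> P" "\<And>x. norm (D x) \<le> P"
    by (rule C1_compactE[OF \<phi>]) blast
  have P': "\<bar>partial_deriv i \<phi> x\<bar> \<le> P" for i x
    unfolding D using component_le_norm_cart P(3) by (rule order_trans)
  define \<alpha> where "\<alpha> = unit_vol TYPE('n) * 2 ^ CARD('n)"
  have \<alpha>: "0 \<le> \<alpha>"
    by (simp add: \<alpha>_def)
  obtain c1 where c1: "\<forall>\<^sub>F r in at_right 0. W2p p (annulus r (2 * r)) (\<lambda>x::real^'n. \<zeta> (norm x)) \<and>
      M_2p p (\<lambda>x::real^'n. \<zeta> (norm x)) r \<le> c1 * max (\<omega> r) (sigma_of \<omega> r)"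
    using bound_\<zeta> by (auto simp: M_2p_bound_def)
  obtain c2 where c2: "\<forall>\<^sub>F r in at_right 0. W2p p (annulus r (2 * r)) v \<and>
      M_2p p v r \<le> c2 * (r powr (2 - real CARD('n)) * exp (I r) * \<omega> r)"
    using bound_v by (auto simp: M_2p_bound_def)
  have \<omega>_lim: "(\<omega> \<longlongrightarrow> 0) (at_right 0)"
  proof -
    have "(\<omega> \<longlongrightarrow> \<omega> 0) (at 0 within {0..<1})"
      using \<omega>(1) by (simp add: continuous_on_def)
    moreover have "at (0::real) within {0..<1} = at_right 0"
      by (rule at_within_nhd[of _ "{-1<..<1}"]) auto
    ultimately show ?thesis
      by (simp add: \<omega>(2))
  qed
  have m: "((\<lambda>r. max (\<omega> r) (sigma_of \<omega> r)) \<longlongrightarrow> max 0 0) (at_right 0)"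
    unfolding sigma_of_def by (intro tendsto_max \<omega>_lim set_integral_shrinking_tendsto_0 Dini)
  have m_lim: "((\<lambda>r. 2 * (\<bar>c1\<bar> * max (\<omega> r) (sigma_of \<omega> r)) * \<alpha>) \<longlongrightarrow> 0) (at_right 0)"
    using tendsto_mult_right[OF tendsto_mult_left[OF tendsto_mult_left[OF m, of "\<bar>c1\<bar>"], of 2], of \<alpha>] by simp
  have v_lim: "((\<lambda>r. 2 * (\<bar>c2\<bar> * (M * \<omega> r)) * \<alpha>) \<longlongrightarrow> 0) (at_right 0)"
    using \<omega>_lim by (auto intro!: tendsto_eq_intros)
  have "filterlim (\<lambda>r::real. 3 * r) (at_right 0) (at_right 0)"
    unfolding filterlim_at by (auto intro!: tendsto_eq_intros exI[of _ "1::real"] simp: eventually_at_right_field)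
  then have \<omega>3_lim: "((\<lambda>r. \<omega> (3 * r)) \<longlongrightarrow> 0) (at_right 0)"
    by (rule filterlim_compose[OF \<omega>_lim])
  have "filterlim norm (at_right 0) (at (0::real^'n))"
    unfolding filterlim_at by (auto intro!: tendsto_eq_intros simp: eventually_at_filter)
  from filterlim_compose[OF E this] have eI_lim: "((\<lambda>x::real^'n. exp (I (norm x))) \<longlongrightarrow> E) (at 0)" .
  have "(\<phi> \<longlongrightarrow> \<phi> 0) (at 0)"
    using C1_compact_continuous_on(1)[OF \<phi>, of UNIV] by (simp add: continuous_on_def)
  then have \<phi>_lim: "((\<lambda>x. \<phi> x * exp (I (norm x))) \<longlongrightarrow> \<phi> 0 * E) (at 0)"
    using eI_lim by (rule tendsto_mult)
  define K1 where "K1 = 288 * P * real CARD('n) * (2 * M + 1) + 72 * P * divergence_constant CARD('n) M \<alpha>"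
  define K2 where "K2 = 288 * \<alpha>"
  define K3 where "K3 = 72 * P * real CARD('n) * (M * (\<alpha> + 1) + M + 1)"
  have K: "0 \<le> K1" "0 \<le> K2" "0 \<le> K3"
    using P(1) M(1) \<alpha> by (simp_all add: K1_def K2_def K3_def divergence_constant_def)
  have lim: "(pairing_upto A \<epsilon> Z \<phi> \<longlongrightarrow> - c) (at_right 0)"
  proof (rule tendstoI)
    fix e :: real assume e: "0 < e"
    \<comment> \<open>the three parts of the error are made at most \<open>e/4\<close> each\<close>
    define q where "q = min 1 (e / (4 * (K1 + 1)))"
    define d where "d = e / (4 * (K2 + 1))"
    define \<rho> where "\<rho> = e / (4 * (K3 + 1))"
    have pos: "0 < q" "q \<le> 1" "0 < d" "0 < \<rho>"
      using e K by (auto simp: q_def d_def \<rho>_def)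
    have frac: "k * x \<le> e / 4" if "0 \<le> k" "x \<le> e / (4 * (k + 1))" for k x :: real
    proof -
      have "k * x \<le> k * (e / (4 * (k + 1)))"
        using that by (intro mult_left_mono)
      also have "\<dots> \<le> (k + 1) * (e / (4 * (k + 1)))"
        using that e by (intro mult_right_mono) auto
      also have "\<dots> = e / 4"
      proof -
        have "s * (e / (4 * s)) = e / 4" if "s \<noteq> 0" for s
          using that by simp
        then show ?thesis
          using \<open>0 \<le> k\<close> by (metis add_nonneg_pos less_irrefl zero_less_one)
      qed
      finally show ?thesis .
    qed
    obtain \<delta> where \<delta>: "0 < \<delta>" "\<And>x. x \<noteq> 0 \<Longrightarrow> norm x < \<delta> \<Longrightarrow> \<bar>\<phi> x * exp (I (norm x)) - \<phi> 0 * E\<bar> < d"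
      using tendstoD[OF \<phi>_lim pos(3)] by (auto simp: eventually_at dist_real_def)
    have "\<forall>\<^sub>F r::real in at_right 0. r < min (\<epsilon> / 3) (min (\<delta> / 2) \<rho>)"
      using eps \<delta> pos by (intro eventually_at_rightI[of 0 "min (\<epsilon> / 3) (min (\<delta> / 2) \<rho>)"]) auto
    moreover have "\<forall>\<^sub>F r::real in at_right 0. 0 < r"
      by (auto simp: eventually_at_right_field intro: exI[of _ 1])
    moreover note c1 c2 order_tendstoD(2)[OF m_lim pos(1)] order_tendstoD(2)[OF v_lim pos(1)]
      order_tendstoD(2)[OF \<omega>3_lim pos(1)]
    ultimately show "\<forall>\<^sub>F r in at_right 0. dist (pairing_upto A \<epsilon> Z \<phi> r) (- c) < e"
    proof eventually_elim
      case (elim r)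
      let ?m = "max (\<omega> r) (sigma_of \<omega> r)"
      have r: "0 < r" "3 * r \<le> \<epsilon>" "r < 1"
        using elim eps by auto
      have \<omega>r: "0 \<le> \<omega> r"
        using r by (intro \<omega>_nonneg) auto
      have "c1 * ?m \<le> \<bar>c1\<bar> * ?m"
        using \<omega>r by (intro mult_right_mono) auto
      then have b: "M_2p p (\<lambda>x::real^'n. \<zeta> (norm x)) r \<le> \<bar>c1\<bar> * ?m"
        using elim by linarith
      have "c2 * (r powr (2 - real CARD('n)) * exp (I r) * \<omega> r) \<le> \<bar>c2\<bar> * (r powr (2 - real CARD('n)) * M * \<omega> r)"
        using \<omega>r M(2)[of r] r by (intro mult_mono mult_right_mono mult_left_mono) auto
      then have b': "M_2p p v r \<le> \<bar>c2\<bar> * (M * \<omega> r) * r powr (2 - real CARD('n))"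
        using elim by (simp add: mult_ac)
      have dd: "\<bar>\<phi> x * exp (I (norm x)) - \<phi> 0 * E\<bar> \<le> d" if "x \<in> annulus r (2 * r)" for x
        using that elim r by (intro less_imp_le \<delta>(2)) (auto simp: annulus_mem)
      have "\<bar>pairing_upto A \<epsilon> Z \<phi> r + c\<bar> \<le> flux_error CARD('n) P M \<alpha> q d r"
        unfolding c_def \<alpha>_def
      proof (rule pairing_upto_estimate[OF n p r(1,2) solution Z _ b _ b' M])
        show "\<bar>\<phi> x\<bar> \<le> P" for x
          by (rule P)
        show "\<bar>partial_deriv i \<phi> x\<bar> \<le> P" for i x
          by (rule P')
      qed (use elim pos \<omega>r M(1) \<phi> dd in \<open>auto simp: \<alpha>_def\<close>)
      also have "\<dots> = K1 * q + K2 * d + K3 * r"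
        by (simp add: flux_error_def K1_def K2_def K3_def algebra_simps)
      also have "\<dots> \<le> e / 4 + e / 4 + e / 4"
        using K elim by (intro add_mono frac) (auto simp: q_def d_def \<rho>_def)
      also have "\<dots> < e"
        using e by simp
      finally show ?case
        by (simp add: dist_real_def)
    qed
  qed
  then have "pairing A \<epsilon> Z \<phi> = - c"
    unfolding pairing_def by (intro tendsto_Lim) simp_all
  moreover have "pairing_converges A \<epsilon> Z \<phi>"
    unfolding pairing_converges_def using lim pairing_integrable(1)[OF solution \<phi>] by blast
  ultimately show "pairing_converges A \<epsilon> Z \<phi> \<and> - pairing A \<epsilon> Z \<phi> = surface_measure (sphere (0::real^'n) 1) * E * \<phi> 0"
    by (simp add: c_def)
qed

end

theorem theorem2:
  fixes A :: "real^'n \<Rightarrow> real^'n^'n"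
    and \<omega> :: "real \<Rightarrow> real"
    and \<kappa> p :: real
  assumes "CARD('n) \<ge> 3"
    and "1 < p"
    and "\<And>x i j. x \<in> ball 0 1 \<Longrightarrow> A x $ i $ j = A x $ j $ i"
    and "bounded (A ` ball 0 1)"
    and "A \<in> borel_measurable (lebesgue_on (ball 0 1))"
    and "\<And>r. 0 < r \<Longrightarrow> r < 1 \<Longrightarrow>
           (SUP x\<in>sphere 0 r. onorm (\<lambda>y. (A x - mat 1) *v y)) \<le> \<omega> r"
    and "continuous_on {0..<1} \<omega>"
    and "mono_on {0..<1} \<omega>"
    and "\<omega> 0 = 0"
    and "set_integrable lborel {0<..<1} (\<lambda>t. (\<omega> t)\<^sup>2 / t)"
    and "0 < \<kappa>" "\<kappa> < 1"
    and "antimono_on {0<..<1} (\<lambda>r. \<omega> r * r powr (-1 + \<kappa>))"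
  shows "\<exists>\<epsilon>\<^sub>0>0. \<forall>\<epsilon>. 0 < \<epsilon> \<and> \<epsilon> < \<epsilon>\<^sub>0 \<longrightarrow>
    (\<forall>Z \<zeta> v.
       strong_solution p A (ball 0 \<epsilon> - {0}) Z \<and>
       (AE x in lebesgue. x \<in> ball 0 \<epsilon> - {0} \<longrightarrow> Z x = h_of A \<epsilon> \<zeta> (norm x) + v x) \<and>
       M_2p_bound p (\<lambda>x::real^'n. \<zeta> (norm x)) (\<lambda>r. max (\<omega> r) (sigma_of \<omega> r)) \<and>
       M_2p_bound p v (\<lambda>r. r powr (2 - real CARD('n)) * exp (I_of A \<epsilon> r) * \<omega> r)
       \<longrightarrow>
       (\<forall>I\<^sub>0. (I_of A \<epsilon> \<longlongrightarrow> I\<^sub>0) (at_right 0) \<longrightarrow>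
          minus_LZ_eq_delta A \<epsilon> Z (surface_measure (sphere (0::real^'n) 1) * exp I\<^sub>0)) \<and>
       (filterlim (I_of A \<epsilon>) at_bot (at_right 0) \<longrightarrow>
          minus_LZ_eq_delta A \<epsilon> Z 0))"
proof (intro exI[of _ "1::real"] conjI allI impI; (elim conjE)?)
  have delta: "minus_LZ_eq_delta A \<epsilon> Z (surface_measure (sphere (0::real^'n) 1) * E)"
    if eps: "0 < \<epsilon>" "\<epsilon> < 1"
      and Z: "strong_solution p A (ball 0 \<epsilon> - {0}) Z"
        "AE x in lebesgue. x \<in> ball 0 \<epsilon> - {0} \<longrightarrow> Z x = h_of A \<epsilon> \<zeta> (norm x) + v x"
        "M_2p_bound p (\<lambda>x::real^'n. \<zeta> (norm x)) (\<lambda>r. max (\<omega> r) (sigma_of \<omega> r))"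
        "M_2p_bound p v (\<lambda>r. r powr (2 - real CARD('n)) * exp (I_of A \<epsilon> r) * \<omega> r)"
      and lim: "((\<lambda>r. exp (I_of A \<epsilon> r)) \<longlongrightarrow> E) (at_right 0)"
    for \<epsilon> E \<zeta> and Z v :: "real^'n \<Rightarrow> real"
  proof -
    interpret perturbed_Laplacian A \<omega> \<epsilon>
      using assms eps by unfold_locales auto
    show ?thesis
      by (rule minus_LZ_eq_delta_exp_limit[OF assms(1,2,7,9,10) Z lim])
  qed
  show "minus_LZ_eq_delta A \<epsilon> Z (surface_measure (sphere (0::real^'n) 1) * exp I\<^sub>0)"
    if "0 < \<epsilon>" "\<epsilon> < 1" "strong_solution p A (ball 0 \<epsilon> - {0}) Z"
      "AE x in lebesgue. x \<in> ball 0 \<epsilon> - {0} \<longrightarrow> Z x = h_of A \<epsilon> \<zeta> (norm x) + v x"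
      "M_2p_bound p (\<lambda>x::real^'n. \<zeta> (norm x)) (\<lambda>r. max (\<omega> r) (sigma_of \<omega> r))"
      "M_2p_bound p v (\<lambda>r. r powr (2 - real CARD('n)) * exp (I_of A \<epsilon> r) * \<omega> r)"
      "(I_of A \<epsilon> \<longlongrightarrow> I\<^sub>0) (at_right 0)" for \<epsilon> Z \<zeta> v I\<^sub>0
    using that by (intro delta tendsto_exp)
  show "minus_LZ_eq_delta A \<epsilon> Z 0"
    if *: "0 < \<epsilon>" "\<epsilon> < 1" "strong_solution p A (ball 0 \<epsilon> - {0}) Z"
      "AE x in lebesgue. x \<in> ball 0 \<epsilon> - {0} \<longrightarrow> Z x = h_of A \<epsilon> \<zeta> (norm x) + v x"
      "M_2p_bound p (\<lambda>x::real^'n. \<zeta> (norm x)) (\<lambda>r. max (\<omega> r) (sigma_of \<omega> r))"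
      "M_2p_bound p v (\<lambda>r. r powr (2 - real CARD('n)) * exp (I_of A \<epsilon> r) * \<omega> r)"
      "filterlim (I_of A \<epsilon>) at_bot (at_right 0)" for \<epsilon> Z \<zeta> v
    using delta[OF *(1-6) filterlim_compose[OF exp_at_bot *(7)]] by simp
qed simp

end
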